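(* Let $(M,\tau)$ be a tracial $W^\ast$-probability space, let $X_1,\dots,X_n\in M$ be self-adjoint elements and assume that $\delta^\ast(X_1,\dots,X_n)=n$. Then: (a) $X_1,\dots,X_n$ do not satisfy any non-trivial algebraic relation, i.e. there exists no non-zero polynomial $P\in\mathbb{C}\langle Z_1,\dots,Z_n\rangle$ such that $P(X_1,\dots,X_n)=0$. (b) For each $j=1,\dots,n$, there is a unique derivation $$\hat\partial_j:\ \mathbb{C}\langle X_1,\dots,X_n\rangle\to\mathbb{C}\langle X_1,\dots,X_n\rangle\otimes\mathbb{C}\langle X_1,\dots,X_n\rangle$$ which satisfies $\hat\partial_j(X_i)=\delta_{j,i}\,1\otimes1$ for $i=1,\dots,n$.
   Context: A tracial $W^\ast$-probability space $(M,\tau)$ is a von Neumann algebra $M$ with a faithful normal tracial state $\tau$. $L^2(M,\tau)$ is the completion of $M$ for $\langle a,b\rangle=\tau(ab^* )$, with norm $\|\cdot\|_2$; for $\xi\in L^2(M,\tau)$ and $a\in M$, $\tau(\xi a):=\langle\xi,a^*\rangle$. A derivation from a unital algebra $\mathcal{A}$ to an $\mathcal{A}$-bimodule is a linear map $\delta$ with $\delta(ab)=\delta(a)\cdot b+a\cdot\delta(b)$; the bimodule structure on the algebraic tensor product $\mathcal{A}\otimes\mathcal{A}$ is $a\cdot(b\otimes c)\cdot d=(ab)\otimes(cd)$. $\mathbb{C}\langle Z_1,\dots,Z_n\rangle$ is the unital $\ast$-algebra of non-commutative polynomials in $n$ self-adjoint formal variables; $\partial_j:\mathbb{C}\langle Z_1,\dots,Z_n\rangle\to\mathbb{C}\langle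 Z_1,\dots,Z_n\rangle^{\otimes2}$ is the linear map with $\partial_jP=\sum_{P=P_1Z_jP_2}P_1\otimes P_2$ on monomials $P$ (sum over all factorizations with monomials $P_1,P_2$). For self-adjoint $X=(X_1,\dots,X_n)$, $P(X)$ is the image of $P$ under the unital homomorphism $\mathrm{ev}_X:Z_i\mapsto X_i$, and $Q(X):=(\mathrm{ev}_X\otimes\mathrm{ev}_X)(Q)$ for $Q\in\mathbb{C}\langle Z_1,\dots,Z_n\rangle^{\otimes2}$. $\mathbb{C}\langle X_1,\dots,X_n\rangle$ is the range of $\mathrm{ev}_X$, and $L^2(X_1,\dots,X_n,\tau)$ is its closure in $L^2(M,\tau)$. A conjugate system for $(X_1,\dots,X_n)$ is a tuple $(\xi_1,\dots,\xi_n)$ in $L^2(X_1,\dots,X_n,\tau)$ with $(\tau\otimes\tau)((\partial_jP)(X))=\tau(\xi_jP(X))$ for all $P\in\mathbb{C}\langle Z_1,\dots,Z_n\rangle$ and $j=1,\dots,n$; it is unique if it exists. The non-microstates free Fisher information is $\Phi^\ast(X_1,\dots,X_n):=\sum_{j=1}^n\|\xi_j\|_2^2$ if a conjugate system exists, and $:=\infty$ otherwise. After enlarging $(M,\tau)$ if necessary (e.g. replacing it by the free product with $(L(\mathbb{F}_n),\tau_n)$), let $S_1,\dots,S_n\in M$ be normalized semicircular elements (mean $0$, variance $1$) such that $\{X_1,\dots,X_n\},\{S_1\},\dots,\{S_n\}$ are freely independent. The non-microstates free entropy is $$\chi^\ast(X_1,\dots,X_n):=\frac12\int_0^\infty\Big(\frac{n}{1+t}-\Phi^\ast(X_1+\sqrt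 t S_1,\dots,X_n+\sqrt t S_n)\Big)dt+\frac n2\log(2\pi e),$$ and the non-microstates free entropy dimension is $$\delta^\ast(X_1,\dots,X_n):=n-\liminf_{\epsilon\searrow0}\frac{\chi^\ast(X_1+\sqrt\epsilon S_1,\dots,X_n+\sqrt\epsilon S_n)}{\log(\sqrt\epsilon)}.$$ *)

theory Defs
  imports "HOL-Analysis.Analysis" "HOL-Library.Poly_Mapping"
begin

section \<open>Complex vector spaces and Hilbert spaces\<close>

class scaleC =
  fixes scaleC :: "complex \<Rightarrow> 'a \<Rightarrow> 'a"  (infixr "*\<^sub>C" 75)

class complex_vector = scaleC + ab_group_add +
  assumes scaleC_add_right: "c *\<^sub>C (x + y) = c *\<^sub>C x + c *\<^sub>C y"
    and scaleC_add_left: "(c + d) *\<^sub>C x = c *\<^sub>C x + d *\<^sub>C x"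
    and scaleC_scaleC: "c *\<^sub>C d *\<^sub>C x = (c * d) *\<^sub>C x"
    and scaleC_one: "1 *\<^sub>C x = x"

interpretation cvec: vector_space "scaleC :: complex \<Rightarrow> 'a \<Rightarrow> 'a::complex_vector"
  by unfold_locales
    (simp_all add: scaleC_add_right scaleC_add_left scaleC_scaleC scaleC_one)

instantiation complex :: complex_vector
begin
definition scaleC_complex :: "complex \<Rightarrow> complex \<Rightarrow> complex" where
  "scaleC_complex = (*)"
instance by standard (simp_all add: scaleC_complex_def algebra_simps)
end

instantiation poly_mapping :: (type, complex_vector) complex_vector
begin
definition scaleC_poly_mapping :: "complex \<Rightarrow> ('a \<Rightarrow>\<^sub>0 'b) \<Rightarrow> 'a \<Rightarrow>\<^sub>0 'b" where
  "scaleC_poly_mapping c = Poly_Mapping.map (scaleC c)"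

lemma lookup_scaleC:
  "Poly_Mapping.lookup (c *\<^sub>C p) k = c *\<^sub>C Poly_Mapping.lookup p k"
  for p :: "'a \<Rightarrow>\<^sub>0 'b::complex_vector"
  by (cases "Poly_Mapping.lookup p k = 0")
    (simp_all add: scaleC_poly_mapping_def Poly_Mapping.map.rep_eq)

instance
  by standard
    (rule poly_mapping_eqI,
      simp add: lookup_scaleC lookup_add scaleC_add_right scaleC_add_left scaleC_scaleC scaleC_one)+
end

text \<open>The inner product is linear in the first argument.  Norm, metric and completeness are those
  of the underlying real Hilbert space.\<close>

class complex_hilbert_space = complex_vector + real_inner + complete_space +
  fixes cinner :: "'a \<Rightarrow> 'a \<Rightarrow> complex"
  assumes scaleR_scaleC: "r *\<^sub>R x = complex_of_real r *\<^sub>C x"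
    and cinner_commute: "cinner x y = cnj (cinner y x)"
    and cinner_add_left: "cinner (x + y) z = cinner x z + cinner y z"
    and cinner_scaleC_left: "cinner (c *\<^sub>C x) y = c * cinner x y"
    and inner_eq_Re_cinner: "x \<bullet> y = Re (cinner x y)"


section \<open>The *-algebra of bounded operators\<close>

typedef (overloaded) 'h cop =
  "{f :: 'h::complex_hilbert_space \<Rightarrow> 'h. bounded_linear f \<and> (\<forall>c x. f (c *\<^sub>C x) = c *\<^sub>C f x)}"
  morphisms cop_apply Abs_cop
  by (rule exI[of _ "\<lambda>_. 0"]) simp

setup_lifting type_definition_cop

instantiation cop :: (complex_hilbert_space) "{complex_vector, ring, monoid_mult}"
begin

lift_definition zero_cop :: "'a cop" is "\<lambda>_. 0" by simp
lift_definition one_cop :: "'a cop" is "\<lambda>x. x" by (simp add: bounded_linear_ident)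
lift_definition plus_cop :: "'a cop \<Rightarrow> 'a cop \<Rightarrow> 'a cop" is "\<lambda>f g x. f x + g x"
  by (simp add: bounded_linear_add scaleC_add_right)
lift_definition minus_cop :: "'a cop \<Rightarrow> 'a cop \<Rightarrow> 'a cop" is "\<lambda>f g x. f x - g x"
  by (simp add: bounded_linear_sub cvec.scale_right_diff_distrib)
lift_definition uminus_cop :: "'a cop \<Rightarrow> 'a cop" is "\<lambda>f x. - f x"
  by (simp add: bounded_linear_minus)
lift_definition times_cop :: "'a cop \<Rightarrow> 'a cop \<Rightarrow> 'a cop" is "\<lambda>f g x. f (g x)"
  by (simp add: bounded_linear_compose)
lift_definition scaleC_cop :: "complex \<Rightarrow> 'a cop \<Rightarrow> 'a cop" is "\<lambda>c f x. c *\<^sub>C f x"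
proof (intro conjI allI)
  fix c :: complex and f :: "'a \<Rightarrow> 'a"
  assume f: "bounded_linear f \<and> (\<forall>c x. f (c *\<^sub>C x) = c *\<^sub>C f x)"
  show "c *\<^sub>C f (d *\<^sub>C x) = d *\<^sub>C c *\<^sub>C f x" for d x
    using f by (simp add: scaleC_scaleC mult.commute)
  have nrm: "norm (c *\<^sub>C x) = cmod c * norm x" for x :: 'a
  proof -
    have "cinner x (c *\<^sub>C x) = cnj c * cinner x x"
      using cinner_commute[of x "c *\<^sub>C x"] cinner_commute[of x x]
      by (simp add: cinner_scaleC_left)
    then have "cinner (c *\<^sub>C x) (c *\<^sub>C x) = complex_of_real ((cmod c)\<^sup>2) * cinner x x"
      by (simp only: cinner_scaleC_left complex_norm_square mult.assoc)
    then have "(norm (c *\<^sub>C x))\<^sup>2 = (cmod c * norm x)\<^sup>2"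
      by (simp only: power2_norm_eq_inner inner_eq_Re_cinner power_mult_distrib
          Re_complex_of_real Im_complex_of_real times_complex.simps mult_zero_left diff_zero)
    then show ?thesis by (simp add: power2_eq_iff_nonneg)
  qed
  interpret f: bounded_linear f using f by simp
  have "bounded_linear (\<lambda>x. c *\<^sub>C x :: 'a)"
    by (rule bounded_linear_intro[where K = "cmod c"])
      (simp_all add: scaleC_add_right scaleR_scaleC scaleC_scaleC nrm mult.commute)
  then show "bounded_linear (\<lambda>x. c *\<^sub>C f x)"
    using f.bounded_linear_axioms by (rule bounded_linear_compose)
qed

instance
proof
  fix a b c :: "'a cop" and r s :: complex
  show "a * b * c = a * (b * c)" by transfer simp
  show "1 * a = a" by transfer simp
  show "a * 1 = a" by transfer simp
  show "a + b + c = a + (b + c)" by transfer (simp add: add.assoc)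
  show "a + b = b + a" by transfer (simp add: add.commute)
  show "0 + a = a" by transfer simp
  show "- a + a = 0" by transfer simp
  show "a - b = a + - b" by transfer simp
  show "(a + b) * c = a * c + b * c" by transfer simp
  show "a * (b + c) = a * b + a * c"
    by transfer (simp add: linear_add bounded_linear.linear)
  show "r *\<^sub>C (a + b) = r *\<^sub>C a + r *\<^sub>C b" by transfer (simp add: scaleC_add_right)
  show "(r + s) *\<^sub>C a = r *\<^sub>C a + s *\<^sub>C a" by transfer (simp add: scaleC_add_left)
  show "r *\<^sub>C s *\<^sub>C a = (r * s) *\<^sub>C a" by transfer (simp add: scaleC_scaleC)
  show "1 *\<^sub>C a = a" by transfer (simp add: scaleC_one)
qed

end

text \<open>The adjoint exists (and is unique) by the Riesz representation theorem.\<close>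

definition adj :: "'h::complex_hilbert_space cop \<Rightarrow> 'h cop" where
  "adj a = (THE b. \<forall>x y. cinner (cop_apply a x) y = cinner x (cop_apply b y))"

definition self_adjoint :: "'h::complex_hilbert_space cop \<Rightarrow> bool" where
  "self_adjoint a \<longleftrightarrow> adj a = a"

definition op_le :: "'h::complex_hilbert_space cop \<Rightarrow> 'h cop \<Rightarrow> bool" where
  "op_le a b \<longleftrightarrow> (\<forall>x. cinner (cop_apply (b - a) x) x \<in> \<real>\<^sub>\<ge>\<^sub>0)"

definition commutant :: "'h::complex_hilbert_space cop set \<Rightarrow> 'h cop set" where
  "commutant M = {a. \<forall>b\<in>M. a * b = b * a}"

definition von_neumann_algebra :: "'h::complex_hilbert_space cop set \<Rightarrow> bool" where
  "von_neumann_algebra M \<longleftrightarrow> adj ` M \<subseteq> M \<and> commutant (commutant M) = M"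


section \<open>Tracial W*-probability spaces\<close>

text \<open>\<open>\<tau>\<close> preserves suprema in \<open>M\<close> of upward directed families of self-adjoint elements.\<close>

definition normal_on ::
  "'h::complex_hilbert_space cop set \<Rightarrow> ('h cop \<Rightarrow> complex) \<Rightarrow> bool" where
  "normal_on M \<tau> \<longleftrightarrow>
     (\<forall>D s. D \<subseteq> M \<and> D \<noteq> {} \<and> (\<forall>a\<in>D. self_adjoint a) \<and>
        (\<forall>a\<in>D. \<forall>b\<in>D. \<exists>c\<in>D. op_le a c \<and> op_le b c) \<and>
        s \<in> M \<and> (\<forall>a\<in>D. op_le a s) \<and> (\<forall>u\<in>M. (\<forall>a\<in>D. op_le a u) \<longrightarrow> op_le s u)
      \<longrightarrow> Re (\<tau> s) = (SUP a\<in>D. Re (\<tau> a)))"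

text \<open>Only the values of \<open>\<tau>\<close> on \<open>M\<close> matter; \<open>\<tau>\<close> is not assumed linear elsewhere.\<close>

definition tracial_wstar_space ::
  "'h::complex_hilbert_space cop set \<Rightarrow> ('h cop \<Rightarrow> complex) \<Rightarrow> bool" where
  "tracial_wstar_space M \<tau> \<longleftrightarrow>
     von_neumann_algebra M \<and>
     (\<forall>a\<in>M. \<forall>b\<in>M. \<tau> (a + b) = \<tau> a + \<tau> b) \<and>
     (\<forall>c. \<forall>a\<in>M. \<tau> (c *\<^sub>C a) = c * \<tau> a) \<and>
     \<tau> 1 = 1 \<and>
     (\<forall>a\<in>M. \<tau> (adj a * a) \<in> \<real>\<^sub>\<ge>\<^sub>0) \<and>
     (\<forall>a\<in>M. \<tau> (adj a * a) = 0 \<longrightarrow> a = 0) \<and>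
     (\<forall>a\<in>M. \<forall>b\<in>M. \<tau> (a * b) = \<tau> (b * a)) \<and>
     normal_on M \<tau>"

text \<open>An enlargement: a trace-preserving unital *-homomorphism \<open>\<iota>\<close> from \<open>M\<close> into \<open>N\<close>.  It is
  automatically injective and normal because \<open>\<tau>\<close> and \<open>\<sigma>\<close> are faithful and normal.  The algebras may act on different Hilbert
  spaces.\<close>

definition enlargement ::
  "'h::complex_hilbert_space cop set \<Rightarrow> ('h cop \<Rightarrow> complex) \<Rightarrow>
   'k::complex_hilbert_space cop set \<Rightarrow> ('k cop \<Rightarrow> complex) \<Rightarrow> ('h cop \<Rightarrow> 'k cop) \<Rightarrow> bool" where
  "enlargement M \<tau> N \<sigma> \<iota> \<longleftrightarrow>
     tracial_wstar_space N \<sigma> \<and>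
     \<iota> ` M \<subseteq> N \<and>
     (\<forall>a\<in>M. \<forall>b\<in>M. \<iota> (a + b) = \<iota> a + \<iota> b) \<and>
     (\<forall>c. \<forall>a\<in>M. \<iota> (c *\<^sub>C a) = c *\<^sub>C \<iota> a) \<and>
     (\<forall>a\<in>M. \<forall>b\<in>M. \<iota> (a * b) = \<iota> a * \<iota> b) \<and>
     (\<forall>a\<in>M. \<iota> (adj a) = adj (\<iota> a)) \<and>
     \<iota> 1 = 1 \<and>
     (\<forall>a\<in>M. \<sigma> (\<iota> a) = \<tau> a)"


section \<open>The space L2\<close>

text \<open>The completion of \<open>M\<close> is realised as Cauchy sequences modulo null sequences.\<close>

definition norm2 :: "('h::complex_hilbert_space cop \<Rightarrow> complex) \<Rightarrow> 'h cop \<Rightarrow> real" where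
  "norm2 \<tau> a = sqrt (Re (\<tau> (a * adj a)))"

definition l2_cauchy ::
  "'h::complex_hilbert_space cop set \<Rightarrow> ('h cop \<Rightarrow> complex) \<Rightarrow> (nat \<Rightarrow> 'h cop) set" where
  "l2_cauchy M \<tau> =
     {a. range a \<subseteq> M \<and> (\<forall>e>0. \<exists>m. \<forall>k\<ge>m. \<forall>l\<ge>m. norm2 \<tau> (a k - a l) < e)}"

definition l2_equiv ::
  "'h::complex_hilbert_space cop set \<Rightarrow> ('h cop \<Rightarrow> complex) \<Rightarrow>
   ((nat \<Rightarrow> 'h cop) \<times> (nat \<Rightarrow> 'h cop)) set" where
  "l2_equiv M \<tau> =
     {(a, b). a \<in> l2_cauchy M \<tau> \<and> b \<in> l2_cauchy M \<tau> \<and>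
              (\<lambda>k. norm2 \<tau> (a k - b k)) \<longlonglongrightarrow> 0}"

definition L2 ::
  "'h::complex_hilbert_space cop set \<Rightarrow> ('h cop \<Rightarrow> complex) \<Rightarrow> (nat \<Rightarrow> 'h cop) set set" where
  "L2 M \<tau> = l2_cauchy M \<tau> // l2_equiv M \<tau>"

definition l2_embed ::
  "'h::complex_hilbert_space cop set \<Rightarrow> ('h cop \<Rightarrow> complex) \<Rightarrow> 'h cop \<Rightarrow> (nat \<Rightarrow> 'h cop) set" where
  "l2_embed M \<tau> a = l2_equiv M \<tau> `` {\<lambda>_. a}"

definition l2_rep :: "(nat \<Rightarrow> 'h::complex_hilbert_space cop) set \<Rightarrow> nat \<Rightarrow> 'h cop" where
  "l2_rep \<xi> = (SOME a. a \<in> \<xi>)"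

definition l2_inner ::
  "('h::complex_hilbert_space cop \<Rightarrow> complex) \<Rightarrow> (nat \<Rightarrow> 'h cop) set \<Rightarrow> (nat \<Rightarrow> 'h cop) set \<Rightarrow> complex"
  where "l2_inner \<tau> \<xi> \<eta> = lim (\<lambda>k. \<tau> (l2_rep \<xi> k * adj (l2_rep \<eta> k)))"

definition l2_norm ::
  "('h::complex_hilbert_space cop \<Rightarrow> complex) \<Rightarrow> (nat \<Rightarrow> 'h cop) set \<Rightarrow> real" where
  "l2_norm \<tau> \<xi> = sqrt (Re (l2_inner \<tau> \<xi> \<xi>))"

definition l2_dist ::
  "('h::complex_hilbert_space cop \<Rightarrow> complex) \<Rightarrow> (nat \<Rightarrow> 'h cop) set \<Rightarrow> (nat \<Rightarrow> 'h cop) set \<Rightarrow> real"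
  where "l2_dist \<tau> \<xi> \<eta> = lim (\<lambda>k. norm2 \<tau> (l2_rep \<xi> k - l2_rep \<eta> k))"

definition l2_closure ::
  "'h::complex_hilbert_space cop set \<Rightarrow> ('h cop \<Rightarrow> complex) \<Rightarrow> 'h cop set \<Rightarrow>
   (nat \<Rightarrow> 'h cop) set set" where
  "l2_closure M \<tau> A = {\<xi> \<in> L2 M \<tau>. \<forall>e>0. \<exists>a\<in>A. l2_dist \<tau> \<xi> (l2_embed M \<tau> a) < e}"

text \<open>\<open>\<tau>(\<xi> a)\<close> for \<open>\<xi> \<in> L2\<close> and \<open>a \<in> M\<close>.\<close>

definition l2_tau ::
  "'h::complex_hilbert_space cop set \<Rightarrow> ('h cop \<Rightarrow> complex) \<Rightarrow> (nat \<Rightarrow> 'h cop) set \<Rightarrow> 'h cop \<Rightarrow>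
   complex" where
  "l2_tau M \<tau> \<xi> a = l2_inner \<tau> \<xi> (l2_embed M \<tau> (adj a))"


section \<open>Algebraic tensor products\<close>

definition lin_ext :: "('k \<Rightarrow> 'v::complex_vector) \<Rightarrow> ('k \<Rightarrow>\<^sub>0 complex) \<Rightarrow> 'v" where
  "lin_ext f p = (\<Sum>k\<in>Poly_Mapping.keys p. Poly_Mapping.lookup p k *\<^sub>C f k)"

abbreviation basis :: "'k \<Rightarrow> ('k \<Rightarrow>\<^sub>0 complex)" where
  "basis k \<equiv> Poly_Mapping.single k 1"

definition bilinear_relations :: "(('a::complex_vector \<times> 'a) \<Rightarrow>\<^sub>0 complex) set" where
  "bilinear_relations =
     {basis (a + a', b) - basis (a, b) - basis (a', b) | a a' b. True} \<union>
     {basis (a, b + b') - basis (a, b) - basis (a, b') | a b b'. True} \<union>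
     {basis (c *\<^sub>C a, b) - c *\<^sub>C basis (a, b) | a b c. True} \<union>
     {basis (a, c *\<^sub>C b) - c *\<^sub>C basis (a, b) | a b c. True}"

definition tensor_eq ::
  "(('a::complex_vector \<times> 'a) \<Rightarrow>\<^sub>0 complex) \<Rightarrow> (('a \<times> 'a) \<Rightarrow>\<^sub>0 complex) \<Rightarrow> bool" where
  "tensor_eq p q \<longleftrightarrow> p - q \<in> cvec.span bilinear_relations"

quotient_type (overloaded) 'a tensor = "('a::complex_vector \<times> 'a) \<Rightarrow>\<^sub>0 complex" / tensor_eq
proof (rule equivpI)
  show "reflp (tensor_eq :: (('a \<times> 'a) \<Rightarrow>\<^sub>0 complex) \<Rightarrow> _)"
    by (simp add: reflp_def tensor_eq_def cvec.span_zero)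
  show "symp (tensor_eq :: (('a \<times> 'a) \<Rightarrow>\<^sub>0 complex) \<Rightarrow> _)"
    unfolding symp_def tensor_eq_def using cvec.span_neg by fastforce
  show "transp (tensor_eq :: (('a \<times> 'a) \<Rightarrow>\<^sub>0 complex) \<Rightarrow> _)"
    unfolding transp_def tensor_eq_def using cvec.span_add by fastforce
qed

instantiation tensor :: (complex_vector) complex_vector
begin

lift_definition zero_tensor :: "'a tensor" is 0 .
lift_definition plus_tensor :: "'a tensor \<Rightarrow> 'a tensor \<Rightarrow> 'a tensor" is "(+)"
  unfolding tensor_eq_def by (simp only: add_diff_add cvec.span_add)
lift_definition minus_tensor :: "'a tensor \<Rightarrow> 'a tensor \<Rightarrow> 'a tensor" is "(-)"
  unfolding tensor_eq_def by (drule (1) cvec.span_diff) (simp add: algebra_simps)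
lift_definition uminus_tensor :: "'a tensor \<Rightarrow> 'a tensor" is uminus
  unfolding tensor_eq_def by (simp only: minus_diff_minus cvec.span_neg)
lift_definition scaleC_tensor :: "complex \<Rightarrow> 'a tensor \<Rightarrow> 'a tensor" is scaleC
  unfolding tensor_eq_def
  by (simp only: cvec.span_scale cvec.scale_right_diff_distrib[symmetric])

instance
proof
  fix a b c :: "'a tensor" and r s :: complex
  note te = tensor_eq_def cvec.span_zero
  show "a + b + c = a + (b + c)" by transfer (simp add: te add.assoc)
  show "a + b = b + a" by transfer (simp add: te add.commute)
  show "0 + a = a" by transfer (simp add: te)
  show "- a + a = 0" by transfer (simp add: te)
  show "a - b = a + - b" by transfer (simp add: te)
  show "r *\<^sub>C (a + b) = r *\<^sub>C a + r *\<^sub>C b" by transfer (simp add: te scaleC_add_right)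
  show "(r + s) *\<^sub>C a = r *\<^sub>C a + s *\<^sub>C a" by transfer (simp add: te scaleC_add_left)
  show "r *\<^sub>C s *\<^sub>C a = (r * s) *\<^sub>C a" by transfer (simp add: te scaleC_scaleC)
  show "1 *\<^sub>C a = a" by transfer (simp add: te scaleC_one)
qed

end

lift_definition tprod :: "'a::complex_vector \<Rightarrow> 'a \<Rightarrow> 'a tensor"  (infixr "\<otimes>" 69)
  is "\<lambda>a b. basis (a, b)" .

text \<open>For a subspace \<open>A\<close> of \<open>V\<close>, the product \<open>A \<otimes> A\<close> is identified with its (faithful) image in
  \<open>V \<otimes> V\<close>.\<close>

definition tensor_space :: "'a::complex_vector set \<Rightarrow> 'a tensor set" where
  "tensor_space A = cvec.span {a \<otimes> b | a b. a \<in> A \<and> b \<in> A}"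

text \<open>The linear map on \<open>A \<otimes> A\<close> induced by a map \<open>f\<close> that is bilinear on \<open>A \<times> A\<close>, but possibly not
  elsewhere; hence the restriction to representatives supported in \<open>A \<times> A\<close>.  The result does not
  depend on the representative, see below.\<close>

definition tensor_lift ::
  "'a::complex_vector set \<Rightarrow> ('a \<Rightarrow> 'a \<Rightarrow> 'v::complex_vector) \<Rightarrow> 'a tensor \<Rightarrow> 'v" where
  "tensor_lift A f t =
     lin_ext (\<lambda>(a, b). f a b) (SOME p. Poly_Mapping.keys p \<subseteq> A \<times> A \<and> abs_tensor p = t)"

lemma lin_ext_superset:
  assumes "finite S" "Poly_Mapping.keys p \<subseteq> S"
  shows "lin_ext f p = (\<Sum>k\<in>S. Poly_Mapping.lookup p k *\<^sub>C f k)"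
  unfolding lin_ext_def using assms by (intro sum.mono_neutral_left) (auto simp: in_keys_iff)

lemma linear_lin_ext: "Vector_Spaces.linear scaleC scaleC (lin_ext f)"
proof -
  have add: "lin_ext f (p + q) = lin_ext f p + lin_ext f q" for p q
  proof -
    let ?S = "Poly_Mapping.keys p \<union> Poly_Mapping.keys q"
    have "Poly_Mapping.keys (p + q) \<subseteq> ?S" by (rule Poly_Mapping.keys_add)
    then show ?thesis
      by (simp add: lin_ext_superset[of ?S] lookup_add scaleC_add_left sum.distrib)
  qed
  have "lin_ext f (c *\<^sub>C p) = c *\<^sub>C lin_ext f p" for c p
  proof -
    have "Poly_Mapping.keys (c *\<^sub>C p) \<subseteq> Poly_Mapping.keys p"
      by (auto simp: in_keys_iff lookup_scaleC)
    then have "lin_ext f (c *\<^sub>C p) =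
        (\<Sum>k\<in>Poly_Mapping.keys p. Poly_Mapping.lookup (c *\<^sub>C p) k *\<^sub>C f k)"
      by (intro lin_ext_superset) auto
    also have "\<dots> = (\<Sum>k\<in>Poly_Mapping.keys p. c *\<^sub>C (Poly_Mapping.lookup p k *\<^sub>C f k))"
      by (simp add: lookup_scaleC scaleC_scaleC scaleC_complex_def)
    finally show ?thesis by (simp add: lin_ext_def cvec.scale_sum_right)
  qed
  with add show ?thesis
    by (intro Vector_Spaces.linear.intro module_hom.intro module_hom_axioms.intro
        cvec.vector_space_axioms cvec.module_axioms)
qed

lemma lin_ext_basis [simp]: "lin_ext f (basis k) = f k"
  by (simp add: lin_ext_def scaleC_one)

lemma tensor_lift_abs:
  fixes f :: "'a::complex_vector \<Rightarrow> 'a \<Rightarrow> 'v::complex_vector"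
  assumes A: "cvec.subspace A"
    and add_left: "\<And>a a' b. a \<in> A \<Longrightarrow> a' \<in> A \<Longrightarrow> b \<in> A \<Longrightarrow> f (a + a') b = f a b + f a' b"
    and add_right: "\<And>a b b'. a \<in> A \<Longrightarrow> b \<in> A \<Longrightarrow> b' \<in> A \<Longrightarrow> f a (b + b') = f a b + f a b'"
    and scale_left: "\<And>c a b. a \<in> A \<Longrightarrow> b \<in> A \<Longrightarrow> f (c *\<^sub>C a) b = c *\<^sub>C f a b"
    and scale_right: "\<And>c a b. a \<in> A \<Longrightarrow> b \<in> A \<Longrightarrow> f a (c *\<^sub>C b) = c *\<^sub>C f a b"
    and p: "Poly_Mapping.keys p \<subseteq> A \<times> A"
  shows "tensor_lift A f (abs_tensor p) = lin_ext (\<lambda>(a, b). f a b) p"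
proof -
  interpret vp: vector_space_pair "scaleC :: complex \<Rightarrow> 'a \<Rightarrow> 'a" "scaleC :: complex \<Rightarrow> 'a \<Rightarrow> 'a"
    by unfold_locales
  have "Vector_Spaces.linear scaleC scaleC (\<lambda>x :: 'a. x)"
    by (rule cvec.linear_ident)
  from vp.linear_exists_left_inverse_on[OF this A] obtain \<pi> :: "'a \<Rightarrow> 'a" where
    ran: "\<And>x. \<pi> x \<in> A" and lin: "Vector_Spaces.linear scaleC scaleC \<pi>"
    and id: "\<And>x. x \<in> A \<Longrightarrow> \<pi> x = x"
    by (auto simp: image_subset_iff)
  interpret \<pi>: Vector_Spaces.linear scaleC scaleC \<pi> by (rule lin)
  let ?F = "\<lambda>(a, b). f (\<pi> a) (\<pi> b)"
  interpret F: Vector_Spaces.linear scaleC scaleC "lin_ext ?F" by (rule linear_lin_ext)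
  have gen: "lin_ext ?F r = 0" if "r \<in> bilinear_relations" for r
    using that unfolding bilinear_relations_def
    by (auto simp: F.diff F.scale \<pi>.add \<pi>.scale ran add_left add_right scale_left scale_right)
  have van: "lin_ext ?F r = 0" if "r \<in> cvec.span bilinear_relations" for r
    using that by (induction rule: cvec.span_induct_alt) (simp_all add: F.zero F.add F.scale gen)
  have eq: "lin_ext (\<lambda>(a, b). f a b) q = lin_ext ?F q" if "Poly_Mapping.keys q \<subseteq> A \<times> A" for q
    unfolding lin_ext_def using that by (intro sum.cong) (auto simp: id)
  define q where "q = (SOME q. Poly_Mapping.keys q \<subseteq> A \<times> A \<and> abs_tensor q = abs_tensor p)"
  have q: "Poly_Mapping.keys q \<subseteq> A \<times> A \<and> abs_tensor q = abs_tensor p"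
    unfolding q_def by (rule someI[of _ p]) (simp add: p)
  then have "q - p \<in> cvec.span bilinear_relations"
    by (simp add: tensor.abs_eq_iff tensor_eq_def)
  then have "lin_ext ?F q = lin_ext ?F p" using van F.diff by force
  then show ?thesis using p q eq by (simp add: tensor_lift_def flip: q_def)
qed

text \<open>The bimodule structure \<open>a \<cdot> (b \<otimes> c) \<cdot> d = (a b) \<otimes> (c d)\<close>.\<close>

definition left_act :: "'h::complex_hilbert_space cop \<Rightarrow> 'h cop tensor \<Rightarrow> 'h cop tensor" where
  "left_act a = tensor_lift UNIV (\<lambda>b c. (a * b) \<otimes> c)"

definition right_act :: "'h::complex_hilbert_space cop tensor \<Rightarrow> 'h cop \<Rightarrow> 'h cop tensor" where
  "right_act t d = tensor_lift UNIV (\<lambda>b c. b \<otimes> (c * d)) t"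

definition derivation_on ::
  "'h::complex_hilbert_space cop set \<Rightarrow> ('h cop \<Rightarrow> 'h cop tensor) \<Rightarrow> bool" where
  "derivation_on A D \<longleftrightarrow>
     (\<forall>a\<in>A. \<forall>b\<in>A. D (a + b) = D a + D b) \<and>
     (\<forall>c. \<forall>a\<in>A. D (c *\<^sub>C a) = c *\<^sub>C D a) \<and>
     (\<forall>a\<in>A. \<forall>b\<in>A. D (a * b) = right_act (D a) b + left_act a (D b))"


section \<open>Non-commutative polynomials\<close>

text \<open>A monomial is the word of its letters, with concatenation as product.\<close>

type_synonym 'n ncpoly = "'n list \<Rightarrow>\<^sub>0 complex"

definition free_diff :: "'n \<Rightarrow> 'n ncpoly \<Rightarrow> 'n ncpoly tensor" where
  "free_diff j = lin_ext (\<lambda>w. \<Sum>(u, v)\<in>{(u, v). w = u @ [j] @ v}. basis u \<otimes> basis v)"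

definition nc_eval :: "('n \<Rightarrow> 'h::complex_hilbert_space cop) \<Rightarrow> 'n ncpoly \<Rightarrow> 'h cop" where
  "nc_eval X = lin_ext (\<lambda>w. prod_list (map X w))"

definition nc_eval2 :: "('n \<Rightarrow> 'h::complex_hilbert_space cop) \<Rightarrow> 'n ncpoly tensor \<Rightarrow> 'h cop tensor"
  where "nc_eval2 X = tensor_lift UNIV (\<lambda>P Q. nc_eval X P \<otimes> nc_eval X Q)"

abbreviation poly_algebra :: "('n \<Rightarrow> 'h::complex_hilbert_space cop) \<Rightarrow> 'h cop set" where
  "poly_algebra X \<equiv> range (nc_eval X)"


section \<open>Conjugate systems and free Fisher information\<close>

definition tau2 ::
  "'h::complex_hilbert_space cop set \<Rightarrow> ('h cop \<Rightarrow> complex) \<Rightarrow> 'h cop tensor \<Rightarrow> complex" where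
  "tau2 M \<tau> = tensor_lift M (\<lambda>a b. \<tau> a * \<tau> b)"

definition conjugate_system ::
  "'h::complex_hilbert_space cop set \<Rightarrow> ('h cop \<Rightarrow> complex) \<Rightarrow> ('n \<Rightarrow> 'h cop) \<Rightarrow>
   ('n \<Rightarrow> (nat \<Rightarrow> 'h cop) set) \<Rightarrow> bool" where
  "conjugate_system M \<tau> X \<xi> \<longleftrightarrow>
     (\<forall>j. \<xi> j \<in> l2_closure M \<tau> (poly_algebra X) \<and>
          (\<forall>P. tau2 M \<tau> (nc_eval2 X (free_diff j P)) = l2_tau M \<tau> (\<xi> j) (nc_eval X P)))"

definition free_fisher ::
  "'h::complex_hilbert_space cop set \<Rightarrow> ('h cop \<Rightarrow> complex) \<Rightarrow> ('n::finite \<Rightarrow> 'h cop) \<Rightarrow> ereal" where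
  "free_fisher M \<tau> X =
     (if \<exists>\<xi>. conjugate_system M \<tau> X \<xi>
      then ereal (\<Sum>j\<in>UNIV. (l2_norm \<tau> ((SOME \<xi>. conjugate_system M \<tau> X \<xi>) j))\<^sup>2)
      else \<infinity>)"


section \<open>Freeness and semicircular elements\<close>

inductive_set generated_algebra :: "'h::complex_hilbert_space cop set \<Rightarrow> 'h cop set"
  for B :: "'h cop set" where
  base: "b \<in> B \<Longrightarrow> b \<in> generated_algebra B"
| one: "1 \<in> generated_algebra B"
| add: "a \<in> generated_algebra B \<Longrightarrow> b \<in> generated_algebra B \<Longrightarrow> a + b \<in> generated_algebra B"
| scale: "a \<in> generated_algebra B \<Longrightarrow> c *\<^sub>C a \<in> generated_algebra B"
| mult: "a \<in> generated_algebra B \<Longrightarrow> b \<in> generated_algebra B \<Longrightarrow> a * b \<in> generated_algebra B"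
| star: "a \<in> generated_algebra B \<Longrightarrow> adj a \<in> generated_algebra B"

definition freely_independent ::
  "('h::complex_hilbert_space cop \<Rightarrow> complex) \<Rightarrow> ('i \<Rightarrow> 'h cop set) \<Rightarrow> bool" where
  "freely_independent \<tau> B \<longleftrightarrow>
     (\<forall>is as. as \<noteq> [] \<and> distinct_adj is \<and>
        list_all2 (\<lambda>i a. a \<in> generated_algebra (B i) \<and> \<tau> a = 0) is as \<longrightarrow> \<tau> (prod_list as) = 0)"

text \<open>The semicircle law on \<open>[-2, 2]\<close> is compactly supported, hence given by its moments.\<close>

definition semicircular ::
  "'h::complex_hilbert_space cop set \<Rightarrow> ('h cop \<Rightarrow> complex) \<Rightarrow> 'h cop \<Rightarrow> bool" where
  "semicircular M \<tau> s \<longleftrightarrow>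
     s \<in> M \<and> self_adjoint s \<and>
     (\<forall>k. \<tau> (s ^ k) =
        complex_of_real (1 / (2 * pi) * integral {-2..2} (\<lambda>x. x ^ k * sqrt (4 - x\<^sup>2))))"

text \<open>Each \<open>S j\<close> is semicircular and \<open>range X\<close>, \<open>{S j}\<close> (for all \<open>j\<close>) are free; the index
  \<open>None\<close> stands for the tuple \<open>X\<close>.\<close>

definition free_semicirculars ::
  "'h::complex_hilbert_space cop set \<Rightarrow> ('h cop \<Rightarrow> complex) \<Rightarrow> ('n \<Rightarrow> 'h cop) \<Rightarrow> ('n \<Rightarrow> 'h cop) \<Rightarrow>
   bool" where
  "free_semicirculars M \<tau> X S \<longleftrightarrow>
     (\<forall>j. semicircular M \<tau> (S j)) \<and>
     freely_independent \<tau> (case_option (range X) (\<lambda>j. {S j}))"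

definition perturb ::
  "('n \<Rightarrow> 'h::complex_hilbert_space cop) \<Rightarrow> real \<Rightarrow> ('n \<Rightarrow> 'h cop) \<Rightarrow> 'n \<Rightarrow> 'h cop" where
  "perturb X t S = (\<lambda>j. X j + complex_of_real (sqrt t) *\<^sub>C S j)"


section \<open>Free entropy and free entropy dimension\<close>

text \<open>The integral over \<open>(0, \<infinity>)\<close> of a function with values in \<open>[-\<infinity>, \<infinity>]\<close>, as positive minus
  negative part.  In its only use below, the positive part has a finite integral.\<close>

definition ereal_integral :: "(real \<Rightarrow> ereal) \<Rightarrow> ereal" where
  "ereal_integral f =
     enn2ereal (\<integral>\<^sup>+t\<in>{0<..}. e2ennreal (f t) \<partial>lborel) -
     enn2ereal (\<integral>\<^sup>+t\<in>{0<..}. e2ennreal (- f t) \<partial>lborel)"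

definition free_entropy_via ::
  "'h::complex_hilbert_space cop set \<Rightarrow> ('h cop \<Rightarrow> complex) \<Rightarrow> ('n::finite \<Rightarrow> 'h cop) \<Rightarrow>
   ('n \<Rightarrow> 'h cop) \<Rightarrow> ereal" where
  "free_entropy_via M \<tau> X S =
     ereal (1 / 2) * ereal_integral
        (\<lambda>t. ereal (real CARD('n) / (1 + t)) - free_fisher M \<tau> (perturb X t S)) +
     ereal (real CARD('n) / 2 * ln (2 * pi * exp 1))"

text \<open>The value of \<open>free_entropy_via\<close> depends only on the joint distribution of \<open>X\<close>, not on the
  choice of \<open>S\<close>, so an arbitrary one is taken.  This is meaningful as soon as \<open>M\<close> contains such an
  \<open>S\<close>, which can always be achieved by enlarging \<open>M\<close>.\<close>

definition free_entropy ::
  "'h::complex_hilbert_space cop set \<Rightarrow> ('h cop \<Rightarrow> complex) \<Rightarrow> ('n::finite \<Rightarrow> 'h cop) \<Rightarrow> ereal" where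
  "free_entropy M \<tau> X = free_entropy_via M \<tau> X (SOME S. free_semicirculars M \<tau> X S)"

text \<open>The semicirculars \<open>S\<close> in the definition of the free entropy dimension have to leave room in
  \<open>M\<close> for further ones, free from the tuple \<open>X + \<surd>\<epsilon> S\<close>, that define its free entropy.\<close>

definition dimension_semicirculars ::
  "'h::complex_hilbert_space cop set \<Rightarrow> ('h cop \<Rightarrow> complex) \<Rightarrow> ('n::finite \<Rightarrow> 'h cop) \<Rightarrow>
   ('n \<Rightarrow> 'h cop) \<Rightarrow> bool" where
  "dimension_semicirculars M \<tau> X S \<longleftrightarrow>
     free_semicirculars M \<tau> X S \<and>
     (\<forall>\<epsilon>>0. \<exists>S'. free_semicirculars M \<tau> (perturb X \<epsilon> S) S')"

definition sufficiently_large ::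
  "'h::complex_hilbert_space cop set \<Rightarrow> ('h cop \<Rightarrow> complex) \<Rightarrow> ('n::finite \<Rightarrow> 'h cop) \<Rightarrow> bool" where
  "sufficiently_large M \<tau> X \<longleftrightarrow> (\<exists>S. dimension_semicirculars M \<tau> X S)"

definition free_entropy_dim_via ::
  "'h::complex_hilbert_space cop set \<Rightarrow> ('h cop \<Rightarrow> complex) \<Rightarrow> ('n::finite \<Rightarrow> 'h cop) \<Rightarrow>
   ('n \<Rightarrow> 'h cop) \<Rightarrow> ereal" where
  "free_entropy_dim_via M \<tau> X S =
     ereal (real CARD('n)) -
     Liminf (at_right 0) (\<lambda>\<epsilon>. free_entropy M \<tau> (perturb X \<epsilon> S) / ereal (ln (sqrt \<epsilon>)))"

definition free_entropy_dim ::
  "'h::complex_hilbert_space cop set \<Rightarrow> ('h cop \<Rightarrow> complex) \<Rightarrow> ('n::finite \<Rightarrow> 'h cop) \<Rightarrow> ereal" where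
  "free_entropy_dim M \<tau> X =
     free_entropy_dim_via M \<tau> X (SOME S. dimension_semicirculars M \<tau> X S)"

end

theory Submission
  imports Defs
begin

text \<open>
  Suppose \<open>P(X) = 0\<close>, and let \<open>Y\<close> be a tuple at distance \<open>r\<close> from \<open>X\<close> (as left multipliers on L2) with
  conjugate system \<open>\<xi>\<close>.  For a word \<open>q\<close>, the conjugate relation for \<open>P q\<close> at \<open>Y\<close> and the Leibniz rule
  express \<open>(\<tau> \<otimes> \<tau>) ((\<partial>\<^sub>j P)(Y) (1 \<otimes> q(Y)))\<close> through \<open>\<tau>(\<xi>\<^sub>j P(Y) q(Y))\<close> and traces of products with
  the factor \<open>P(Y)\<close>.  As \<open>P(Y)\<close> has 2-norm \<open>O(r)\<close>, all this is \<open>O(r (1 + \<parallel>\<xi>\<^sub>j\<parallel>\<^sub>2))\<close>.  If \<open>r \<parallel>\<xi>\<^sub>j\<parallel>\<^sub>2\<close>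
  can be made arbitrarily small along with \<open>r\<close>, the pairing vanishes at \<open>X\<close> for every \<open>q\<close>, so faithfulness
  of \<open>\<tau>\<close> gives \<open>(\<tau> \<otimes> id) ((\<partial>\<^sub>j P)(X)) = 0\<close>.  This is again a relation, of smaller degree, and its
  coefficient at \<open>w\<close> is that of \<open>P\<close> at \<open>j w\<close> when \<open>j w\<close> has maximal length; by induction on the degree,
  \<open>P = 0\<close> (\<open>no_relation\<close>).

  If \<open>\<delta>\<^sup>* = n\<close>, such \<open>Y\<close> exist among the perturbations \<open>X + \<surd>\<epsilon> S + \<surd>t S'\<close>, for which \<open>r\<close> is of order \<open>\<surd>(\<epsilon> + t)\<close>:
  if \<open>\<Phi>\<^sup>* \<ge> c / (\<epsilon> + t)\<close> held for all small \<open>\<epsilon>\<close> and \<open>t\<close>, integrating over \<open>t\<close> would bound the entropy of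
  \<open>X + \<surd>\<epsilon> S\<close> by \<open>(c / 2) ln \<surd>\<epsilon> + O(1)\<close>, and the entropy dimension would be at most \<open>n - c / 2\<close>
  (\<open>full_dimension_small_fisher\<close>).  The distance estimate needs bounds on the operators: normality of
  \<open>\<tau>\<close> bounds left multiplication by an element of \<open>M\<close> on L2 (\<open>norm2_left_bounded\<close>), and the moments
  of a semicircular element bound it by 2, uniformly in the choice of \<open>S'\<close>
  (\<open>norm2_left_bound_of_moments\<close>).

  Without relations, evaluation at \<open>X\<close> is injective and \<open>\<partial>\<^sub>j\<close> descends to \<open>\<complex>\<langle>X\<rangle>\<close>; uniqueness holds
  because a derivation is determined by its values on the generators (\<open>ex1_derivation\<close>).
\<close>

section \<open>Adjoints\<close>

text \<open>The Riesz representation theorem, by minimising \<open>J x = \<parallel>x\<parallel>\<^sup>2 - 2 f x\<close>: the parallelogram law makes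
  every minimising sequence Cauchy, and the vanishing of the first variation at the minimiser \<open>z\<close>
  says \<open>f v = v \<bullet> z\<close>.\<close>

lemma riesz_representation:
  fixes f :: "'a::{real_inner,complete_space} \<Rightarrow> real"
  assumes f: "bounded_linear f"
  shows "\<exists>z. \<forall>v. f v = v \<bullet> z"
proof -
  interpret f: bounded_linear f by (rule f)
  define J where "J x = (norm x)\<^sup>2 - 2 * f x" for x
  obtain K where K: "\<And>x. norm (f x) \<le> norm x * K" using f.bounded by blast
  have lower: "- K\<^sup>2 \<le> J x" for x
  proof -
    have "f x \<le> norm x * K" using K[of x] by simp
    moreover have "0 \<le> (norm x - K)\<^sup>2" by simp
    ultimately show ?thesis by (simp add: J_def power2_diff)
  qed
  define m where "m = Inf (range J)"
  have bdd: "bdd_below (range J)" using lower by (intro bdd_belowI[of _ "- K\<^sup>2"]) auto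
  have m_le: "m \<le> J x" for x unfolding m_def using bdd by (intro cInf_lower) auto
  have par: "(norm (x - y))\<^sup>2 \<le> 2 * (J x + J y - 2 * m)" for x y
  proof -
    have "m \<le> J ((1/2) *\<^sub>R (x + y))" by (rule m_le)
    also have "\<dots> = (norm (x + y))\<^sup>2 / 4 - f x - f y"
      by (simp add: J_def f.scaleR f.add power_divide add_divide_distrib del: scaleR_add_right)
    finally have "4 * m \<le> (norm (x + y))\<^sup>2 - 4 * f x - 4 * f y" by simp
    moreover have "(norm (x + y))\<^sup>2 + (norm (x - y))\<^sup>2 = 2 * (norm x)\<^sup>2 + 2 * (norm y)\<^sup>2"
      by (simp add: power2_norm_eq_inner inner_simps inner_commute)
    ultimately show ?thesis by (simp add: J_def)
  qed
  have "\<exists>x. J x < m + 1 / Suc n" for n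
  proof -
    have "Inf (range J) < m + 1 / Suc n" by (simp add: m_def)
    then show ?thesis using cInf_lessD[of "range J" "m + 1 / Suc n"] by auto
  qed
  then obtain x where x: "\<And>n. J (x n) < m + 1 / Suc n" by metis
  have "Cauchy x"
    unfolding Cauchy_def dist_norm
  proof (intro allI impI)
    fix e :: real assume e: "0 < e"
    then obtain n0 where n0: "1 / Suc n0 < e\<^sup>2 / 4"
      using reals_Archimedean[of "e\<^sup>2 / 4"] by (auto simp: inverse_eq_divide)
    have small: "J (x k) - m < e\<^sup>2 / 4" if "n0 \<le> k" for k
    proof -
      have "1 / Suc k \<le> 1 / Suc n0" using that by (simp add: field_simps)
      then show ?thesis using x[of k] n0 by linarith
    qed
    have "norm (x k - x l) < e" if "n0 \<le> k" "n0 \<le> l" for k l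
    proof -
      have "(norm (x k - x l))\<^sup>2 < e\<^sup>2"
        using par[of "x k" "x l"] small[OF that(1)] small[OF that(2)] by argo
      then show ?thesis using e by (simp add: power2_less_imp_less)
    qed
    then show "\<exists>M. \<forall>k\<ge>M. \<forall>l\<ge>M. norm (x k - x l) < e" by blast
  qed
  then obtain z where z: "x \<longlonglongrightarrow> z" using Cauchy_convergent_iff convergent_def by blast
  have "(\<lambda>n. J (x n)) \<longlonglongrightarrow> J z"
    unfolding J_def by (intro tendsto_intros f.tendsto z)
  moreover have "(\<lambda>n. m + 1 / Suc n) \<longlonglongrightarrow> m"
    using tendsto_add[OF tendsto_const LIMSEQ_inverse_real_of_nat, of m]
    by (simp add: inverse_eq_divide)
  ultimately have "J z \<le> m" using x by (intro LIMSEQ_le) (auto intro: less_imp_le)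
  have "f v = v \<bullet> z" for v
  proof -
    define b where "b = v \<bullet> z - f v"
    define q where "q = (norm v)\<^sup>2 + 1"
    have q: "q > 0" by (simp add: q_def add_nonneg_pos)
    define s where "s = - b / q"
    have "(norm (z + s *\<^sub>R v))\<^sup>2 = (norm z)\<^sup>2 + 2 * s * (v \<bullet> z) + s\<^sup>2 * (norm v)\<^sup>2"
      unfolding power2_norm_eq_inner
      by (simp add: inner_simps inner_commute power2_eq_square algebra_simps)
    then have "J (z + s *\<^sub>R v) = J z + 2 * s * b + s\<^sup>2 * (norm v)\<^sup>2"
      by (simp add: J_def b_def f.add f.scaleR algebra_simps)
    moreover have "J z \<le> J (z + s *\<^sub>R v)" using \<open>J z \<le> m\<close> m_le order_trans by blast
    ultimately have "0 \<le> (2 * s * b + s\<^sup>2 * (norm v)\<^sup>2) * q\<^sup>2" by (simp add: q)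
    also have "\<dots> = 2 * b * (s * q) * q + (s * q)\<^sup>2 * (norm v)\<^sup>2"
      by (simp add: algebra_simps power2_eq_square)
    also have "s * q = - b" using q by (simp add: s_def)
    also have "2 * b * (- b) * q + (- b)\<^sup>2 * (norm v)\<^sup>2 = - (b\<^sup>2 * (q + 1))"
      by (simp add: q_def algebra_simps power2_eq_square)
    finally have "b\<^sup>2 * (q + 1) \<le> 0" by simp
    then have "b = 0" using q by (auto simp: mult_le_0_iff power2_eq_square)
    then show ?thesis by (simp add: b_def)
  qed
  then show ?thesis by blast
qed

lemma cinner_zero_left [simp]: "cinner 0 (y :: 'a::complex_hilbert_space) = 0"
  using cinner_add_left[of 0 0 y] by simp

lemma cinner_zero_right [simp]: "cinner (x :: 'a::complex_hilbert_space) 0 = 0"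
  using cinner_commute[of x 0] by simp

lemma cinner_add_right:
  "cinner (x :: 'a::complex_hilbert_space) (y + z) = cinner x y + cinner x z"
  using cinner_commute[of x "y + z"] cinner_commute[of x y] cinner_commute[of x z]
  by (simp add: cinner_add_left)

lemma cinner_scaleC_right:
  "cinner (x :: 'a::complex_hilbert_space) (c *\<^sub>C y) = cnj c * cinner x y"
  using cinner_commute[of x "c *\<^sub>C y"] cinner_commute[of x y]
  by (simp add: cinner_scaleC_left)

lemma cinner_minus_left [simp]: "cinner (- x) (y :: 'a::complex_hilbert_space) = - cinner x y"
  using cinner_add_left[of x "- x" y] by (simp add: add_eq_0_iff)

lemma cinner_diff_left: "cinner (x - y) (z :: 'a::complex_hilbert_space) = cinner x z - cinner y z"
  using cinner_add_left[of x "- y" z] by simp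

lemma cinner_diff_right: "cinner (x :: 'a::complex_hilbert_space) (y - z) = cinner x y - cinner x z"
  using cinner_commute[of x "y - z"] cinner_commute[of x y] cinner_commute[of x z]
  by (simp add: cinner_diff_left)

lemma cinner_self: "cinner x x = complex_of_real ((norm (x :: 'a::complex_hilbert_space))\<^sup>2)"
proof (rule complex_eqI)
  show "Re (cinner x x) = Re (complex_of_real ((norm x)\<^sup>2))"
    by (simp only: power2_norm_eq_inner inner_eq_Re_cinner Re_complex_of_real)
  have "cinner x x = cnj (cinner x x)" by (rule cinner_commute)
  then have "Im (cinner x x) = - Im (cinner x x)" by (metis complex_cnj cnj.sel(2))
  then show "Im (cinner x x) = Im (complex_of_real ((norm x)\<^sup>2))" by simp
qed

lemma cinner_right_eqI:
  assumes "\<And>x. cinner x y = cinner x (z :: 'a::complex_hilbert_space)"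
  shows "y = z"
proof -
  have "cinner (y - z) (y - z) = 0" by (simp add: assms cinner_diff_right)
  then show ?thesis by (simp add: cinner_self)
qed

text \<open>Replacing \<open>x\<close> by \<open>- \<i> x\<close> turns real parts into imaginary parts.\<close>

lemma cinner_eqI_Re:
  assumes "\<And>x. Re (cinner (f x) y) = Re (cinner x (z :: 'a::complex_hilbert_space))"
    and "\<And>c x. f (c *\<^sub>C x) = c *\<^sub>C f x"
  shows "cinner (f x) (y :: 'a) = cinner x z"
proof (rule complex_eqI)
  show "Re (cinner (f x) y) = Re (cinner x z)" by (rule assms)
  show "Im (cinner (f x) y) = Im (cinner x z)"
    using assms(1)[of "(- \<i>) *\<^sub>C x"] unfolding assms(2) cinner_scaleC_left by simp
qed

lemma cop_eqI: "(\<And>x. cop_apply a x = cop_apply b x) \<Longrightarrow> a = b"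
  by (metis cop_apply_inject ext)

lemma adjoint_exists:
  fixes a :: "'h::complex_hilbert_space cop"
  shows "\<exists>b. \<forall>x y. cinner (cop_apply a x) y = cinner x (cop_apply b y)"
proof -
  have bl: "bounded_linear (cop_apply a)" and sc: "cop_apply a (c *\<^sub>C x) = c *\<^sub>C cop_apply a x" for c x
    using cop_apply[of a] by auto
  interpret a: bounded_linear "cop_apply a" by (rule bl)
  have "\<exists>z. \<forall>x. cinner (cop_apply a x) y = cinner x z" for y
  proof -
    have "bounded_linear (\<lambda>x. cop_apply a x \<bullet> y)"
      using bounded_linear_compose[OF bounded_linear_inner_left bl] by simp
    then obtain z where "\<And>x. cop_apply a x \<bullet> y = x \<bullet> z" using riesz_representation by blast
    then have "Re (cinner (cop_apply a x) y) = Re (cinner x z)" for x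
      by (simp add: inner_eq_Re_cinner)
    then show ?thesis using cinner_eqI_Re[of "cop_apply a"] sc by blast
  qed
  then obtain B where B: "\<And>x y. cinner (cop_apply a x) y = cinner x (B y)" by metis
  obtain K where K: "\<And>x. norm (cop_apply a x) \<le> norm x * K" using a.bounded by blast
  have add: "B (y + z) = B y + B z" for y z
    by (rule cinner_right_eqI) (simp add: cinner_add_right B[symmetric])
  have scale: "B (c *\<^sub>C y) = c *\<^sub>C B y" for c y
    by (rule cinner_right_eqI) (simp add: cinner_scaleC_right B[symmetric])
  have "norm (B y) \<le> norm y * K" for y
  proof (cases "B y = 0")
    case True
    have "0 \<le> norm (cop_apply a y)" by simp
    also have "\<dots> \<le> norm y * K" by (rule K)
    finally show ?thesis using True by simp
  next
    case False
    have "(norm (B y))\<^sup>2 = B y \<bullet> B y" by (rule power2_norm_eq_inner)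
    also have "\<dots> = cop_apply a (B y) \<bullet> y" by (simp add: inner_eq_Re_cinner B)
    also have "\<dots> \<le> norm (cop_apply a (B y)) * norm y" by (rule norm_cauchy_schwarz)
    also have "\<dots> \<le> norm (B y) * K * norm y" by (intro mult_right_mono K) simp
    finally show ?thesis using False by (simp add: power2_eq_square mult_ac)
  qed
  then have "bounded_linear B"
    using add scale by (intro bounded_linear_intro[where K = K]) (auto simp: scaleR_scaleC)
  then have "cop_apply (Abs_cop B) = B" using scale by (simp add: Abs_cop_inverse)
  then show ?thesis using B by metis
qed

lemma adj_unique:
  assumes "\<And>x y. cinner (cop_apply a x) y = cinner x (cop_apply b y)"
  shows "adj a = b"
  unfolding adj_def
proof (rule the_equality)
  fix c assume c: "\<forall>x y. cinner (cop_apply a x) y = cinner x (cop_apply c y)"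
  show "c = b" by (intro cop_eqI cinner_right_eqI) (metis c assms)
qed (use assms in blast)

lemma cinner_adj_right: "cinner x (cop_apply (adj a) y) = cinner (cop_apply a x) y"
  using adjoint_exists[of a] adj_unique by metis

lemma cinner_adj_left: "cinner (cop_apply (adj a) x) y = cinner x (cop_apply a y)"
  using cinner_adj_right[of y a x] cinner_commute by metis

lemmas cop_apply_simps =
  zero_cop.rep_eq one_cop.rep_eq plus_cop.rep_eq minus_cop.rep_eq times_cop.rep_eq
  uminus_cop.rep_eq scaleC_cop.rep_eq

lemma adj_add [simp]: "adj (a + b) = adj a + adj b"
  by (rule adj_unique) (simp add: cop_apply_simps cinner_add_left cinner_add_right cinner_adj_right)

lemma adj_scaleC [simp]: "adj (c *\<^sub>C a) = cnj c *\<^sub>C adj a"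
  by (rule adj_unique)
    (simp add: cop_apply_simps cinner_scaleC_left cinner_scaleC_right cinner_adj_right)

lemma adj_mult [simp]: "adj (a * b) = adj b * adj a"
  by (rule adj_unique) (simp add: cop_apply_simps cinner_adj_right)

lemma adj_one [simp]: "adj 1 = 1"
  by (rule adj_unique) (simp add: cop_apply_simps)

lemma adj_zero [simp]: "adj 0 = 0"
  by (rule adj_unique) (simp add: cop_apply_simps)

lemma adj_adj [simp]: "adj (adj a) = a"
  by (rule adj_unique) (simp add: cinner_adj_left)

lemma adj_diff [simp]: "adj (a - b) = adj a - adj b"
  by (rule adj_unique) (simp add: cop_apply_simps cinner_diff_left cinner_diff_right cinner_adj_right)

lemma scaleC_mult_left [simp]: "(c *\<^sub>C a) * b = c *\<^sub>C (a * (b :: 'h::complex_hilbert_space cop))"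
  by (rule cop_eqI) (simp add: cop_apply_simps)

lemma scaleC_mult_right [simp]: "a * (c *\<^sub>C b) = c *\<^sub>C (a * (b :: 'h::complex_hilbert_space cop))"
proof (rule cop_eqI)
  have "cop_apply a (c *\<^sub>C x) = c *\<^sub>C cop_apply a x" for x using cop_apply[of a] by auto
  then show "cop_apply (a * c *\<^sub>C b) x = cop_apply (c *\<^sub>C (a * b)) x" for x
    by (simp add: cop_apply_simps)
qed

section \<open>The trace and its 2-norm\<close>

lemma cmod_power2_cnj: "(complex_of_real (cmod c))\<^sup>2 = c * cnj c"
  by (metis complex_norm_square of_real_power)

text \<open>Throughout the locale \<open>norm2 \<tau>\<close> is the 2-norm on \<open>M\<close>, and \<open>M\<close> is closed under the *-algebra operations
  because it is a bicommutant.\<close>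

locale tracial =
  fixes M :: "'h::complex_hilbert_space cop set" and \<tau> :: "'h cop \<Rightarrow> complex"
  assumes space: "tracial_wstar_space M \<tau>"
begin

lemma vn: "adj ` M \<subseteq> M" "commutant (commutant M) = M"
  using space by (auto simp: tracial_wstar_space_def von_neumann_algebra_def)

lemma in_M_iff: "a \<in> M \<longleftrightarrow> (\<forall>b\<in>commutant M. a * b = b * a)"
  using vn(2) by (auto simp: commutant_def)

lemma M_zero [simp]: "0 \<in> M" by (simp add: in_M_iff)
lemma M_one [simp]: "1 \<in> M" by (simp add: in_M_iff)
lemma M_add [simp]: "a \<in> M \<Longrightarrow> b \<in> M \<Longrightarrow> a + b \<in> M" by (simp add: in_M_iff algebra_simps)
lemma M_diff [simp]: "a \<in> M \<Longrightarrow> b \<in> M \<Longrightarrow> a - b \<in> M" by (simp add: in_M_iff algebra_simps)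
lemma M_mult [simp]: "a \<in> M \<Longrightarrow> b \<in> M \<Longrightarrow> a * b \<in> M"
  unfolding in_M_iff by (metis mult.assoc)
lemma M_scaleC [simp]: "a \<in> M \<Longrightarrow> c *\<^sub>C a \<in> M" by (simp add: in_M_iff)
lemma M_adj [simp]: "a \<in> M \<Longrightarrow> adj a \<in> M" using vn(1) by auto
lemma M_power [simp]: "a \<in> M \<Longrightarrow> a ^ k \<in> M" by (induction k) auto
lemma M_sum: "(\<And>i. i \<in> I \<Longrightarrow> f i \<in> M) \<Longrightarrow> sum f I \<in> M"
  by (induction I rule: infinite_finite_induct) auto
lemma M_prod_list: "(\<And>i. X i \<in> M) \<Longrightarrow> prod_list (map X w) \<in> M"
  by (induction w) auto
lemma M_lin_ext: "(\<And>k. f k \<in> M) \<Longrightarrow> lin_ext f p \<in> M"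
  unfolding lin_ext_def by (intro M_sum) auto
lemma M_nc_eval: "(\<And>i. X i \<in> M) \<Longrightarrow> nc_eval X P \<in> M"
  unfolding nc_eval_def by (intro M_lin_ext M_prod_list)

lemmas space_props = space[unfolded tracial_wstar_space_def, THEN conjunct2]
lemmas tau_add = space_props[THEN conjunct1, THEN bspec, THEN bspec]
lemmas tau_scaleC = space_props[THEN conjunct2, THEN conjunct1, THEN spec, THEN bspec]
lemmas space_props' = space_props[THEN conjunct2, THEN conjunct2]
lemmas tau_one [simp] = space_props'[THEN conjunct1]
lemmas tau_star_nonneg = space_props'[THEN conjunct2, THEN conjunct1, THEN bspec]
lemmas space_props'' = space_props'[THEN conjunct2, THEN conjunct2]
lemmas tau_faithful = space_props''[THEN conjunct1, THEN bspec, THEN mp]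
lemmas tau_commute = space_props''[THEN conjunct2, THEN conjunct1, THEN bspec, THEN bspec]
lemmas tau_normal = space_props''[THEN conjunct2, THEN conjunct2]

lemma tau_zero [simp]: "\<tau> 0 = 0"
  using tau_add[of 0 0] by simp

lemma tau_diff: "a \<in> M \<Longrightarrow> b \<in> M \<Longrightarrow> \<tau> (a - b) = \<tau> a - \<tau> b"
  using tau_add[of "a - b" b] by simp

lemma tau_sum: "(\<And>i. i \<in> I \<Longrightarrow> f i \<in> M) \<Longrightarrow> \<tau> (sum f I) = (\<Sum>i\<in>I. \<tau> (f i))"
  by (induction I rule: infinite_finite_induct) (auto simp: tau_add M_sum)

lemma tau_lin_ext:
  assumes "\<And>k. f k \<in> M"
  shows "\<tau> (lin_ext f p) = (\<Sum>k\<in>Poly_Mapping.keys p. Poly_Mapping.lookup p k * \<tau> (f k))"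
  unfolding lin_ext_def by (simp add: tau_sum tau_scaleC assms)

text \<open>The trace is hermitian because \<open>\<tau>(x\<^sup>* x)\<close> is real for \<open>x = 1 + a\<close> and \<open>x = 1 + \<i> a\<close>.\<close>

lemma tau_adj:
  assumes a: "a \<in> M"
  shows "\<tau> (adj a) = cnj (\<tau> a)"
proof -
  have real: "Im (\<tau> (adj x * x)) = 0" if "x \<in> M" for x
    using tau_star_nonneg[OF that] by (auto simp: complex_nonneg_Reals_iff)
  have "adj (1 + a) * (1 + a) = 1 + (a + (adj a + adj a * a))" by (simp add: algebra_simps)
  then have 1: "Im (\<tau> a) + Im (\<tau> (adj a)) = 0"
    using real[of "1 + a"] real[of a] a by (simp add: tau_add)
  have "adj (1 + \<i> *\<^sub>C a) * (1 + \<i> *\<^sub>C a) = 1 + (\<i> *\<^sub>C a + ((- \<i>) *\<^sub>C adj a + adj a * a))"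
    by (simp add: distrib_left distrib_right left_diff_distrib right_diff_distrib
        scaleC_add_right cvec.scale_right_diff_distrib scaleC_scaleC scaleC_one algebra_simps)
  then have 2: "Re (\<tau> a) - Re (\<tau> (adj a)) = 0"
    using real[of "1 + \<i> *\<^sub>C a"] real[of a] a
    by (simp add: tau_add tau_scaleC del: cvec.scale_minus_left)
  show ?thesis using 1 2 by (intro complex_eqI) auto
qed

lemma tau_mult_adj_self:
  assumes a: "a \<in> M"
  shows "\<tau> (a * adj a) = complex_of_real ((norm2 \<tau> a)\<^sup>2)"
  using tau_star_nonneg[of "adj a"] a
  by (auto simp: norm2_def complex_nonneg_Reals_iff complex_eq_iff)

lemma norm2_power2: "a \<in> M \<Longrightarrow> (norm2 \<tau> a)\<^sup>2 = Re (\<tau> (a * adj a))"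
  by (simp add: tau_mult_adj_self)

lemma norm2_nonneg: "a \<in> M \<Longrightarrow> 0 \<le> norm2 \<tau> a"
  using tau_star_nonneg[of "adj a"] by (auto simp: norm2_def complex_nonneg_Reals_iff)

lemma norm2_zero [simp]: "norm2 \<tau> 0 = 0"
  by (simp add: norm2_def)

lemma norm2_one [simp]: "norm2 \<tau> 1 = 1"
  by (simp add: norm2_def)

lemma norm2_adj: "a \<in> M \<Longrightarrow> norm2 \<tau> (adj a) = norm2 \<tau> a"
  by (simp add: norm2_def tau_commute)

lemma norm2_eq_0: "a \<in> M \<Longrightarrow> norm2 \<tau> a = 0 \<Longrightarrow> a = 0"
  using tau_mult_adj_self[of "adj a"] tau_faithful[of a] by (simp add: norm2_adj)

lemma norm2_scaleC: "a \<in> M \<Longrightarrow> norm2 \<tau> (c *\<^sub>C a) = cmod c * norm2 \<tau> a"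
proof -
  assume a: "a \<in> M"
  have "\<tau> ((c *\<^sub>C a) * adj (c *\<^sub>C a)) = complex_of_real ((cmod c * norm2 \<tau> a)\<^sup>2)"
    using a by (simp add: tau_scaleC tau_mult_adj_self power_mult_distrib)
      (simp add: cmod_power2_cnj mult.assoc[symmetric] mult.commute)
  then have "(norm2 \<tau> (c *\<^sub>C a))\<^sup>2 = (cmod c * norm2 \<tau> a)\<^sup>2"
    using a by (simp add: norm2_power2)
  then show ?thesis using a by (simp add: power2_eq_iff_nonneg norm2_nonneg)
qed

lemma tau_Cauchy_Schwarz:
  assumes a: "a \<in> M" and b: "b \<in> M"
  shows "cmod (\<tau> (a * adj b)) \<le> norm2 \<tau> a * norm2 \<tau> b"
proof (cases "norm2 \<tau> b = 0")
  case True
  then show ?thesis using norm2_eq_0[OF b] by simp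
next
  case False
  define q where "q = (norm2 \<tau> b)\<^sup>2"
  have q: "q > 0" using False by (simp add: q_def)
  define c where "c = \<tau> (a * adj b)"
  have cc: "\<tau> (b * adj a) = cnj c"
    using tau_adj[of "a * adj b"] a b by (simp add: c_def)
  \<comment> \<open>\<open>d b\<close> is the orthogonal projection of \<open>a\<close> to the line through \<open>b\<close>.\<close>
  define d where "d = c / complex_of_real q"
  have "(a - d *\<^sub>C b) * adj (a - d *\<^sub>C b) =
      a * adj a - cnj d *\<^sub>C (a * adj b) - (d *\<^sub>C (b * adj a) - (d * cnj d) *\<^sub>C (b * adj b))"
    by (simp add: left_diff_distrib right_diff_distrib cvec.scale_right_diff_distrib
        scaleC_scaleC mult.commute)
  then have "\<tau> ((a - d *\<^sub>C b) * adj (a - d *\<^sub>C b)) =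
      complex_of_real ((norm2 \<tau> a)\<^sup>2) - cnj d * c - (d * cnj c - d * cnj d * complex_of_real q)"
    using a b by (simp add: tau_diff tau_scaleC tau_mult_adj_self cc q_def) (simp add: c_def)
  also have "\<dots> = complex_of_real ((norm2 \<tau> a)\<^sup>2 - (cmod c)\<^sup>2 / q)"
    using q by (simp add: d_def field_simps cmod_power2_cnj)
  finally have "(norm2 \<tau> (a - d *\<^sub>C b))\<^sup>2 = (norm2 \<tau> a)\<^sup>2 - (cmod c)\<^sup>2 / q"
    using a b by (simp add: norm2_power2)
  then have "(cmod c)\<^sup>2 / q \<le> (norm2 \<tau> a)\<^sup>2" by (metis diff_ge_0_iff_ge zero_le_power2)
  then have "(cmod c)\<^sup>2 \<le> (norm2 \<tau> a * norm2 \<tau> b)\<^sup>2"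
    using q by (simp add: q_def power_mult_distrib field_simps)
  then show ?thesis
    using a b by (simp add: c_def norm2_nonneg power2_le_iff_abs_le)
qed

lemma tau_mult_bound:
  "a \<in> M \<Longrightarrow> b \<in> M \<Longrightarrow> cmod (\<tau> (a * b)) \<le> norm2 \<tau> a * norm2 \<tau> b"
  using tau_Cauchy_Schwarz[of a "adj b"] by (simp add: norm2_adj)

lemma tau_bound: "a \<in> M \<Longrightarrow> cmod (\<tau> a) \<le> norm2 \<tau> a"
  using tau_mult_bound[of a 1] by simp

lemma norm2_triangle:
  assumes a: "a \<in> M" and b: "b \<in> M"
  shows "norm2 \<tau> (a + b) \<le> norm2 \<tau> a + norm2 \<tau> b"
proof -
  have "(norm2 \<tau> (a + b))\<^sup>2 =
      (norm2 \<tau> a)\<^sup>2 + (norm2 \<tau> b)\<^sup>2 + (Re (\<tau> (a * adj b)) + Re (\<tau> (b * adj a)))"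
    using a b by (simp add: norm2_power2 distrib_left distrib_right tau_add)
  also have "\<dots> \<le> (norm2 \<tau> a)\<^sup>2 + (norm2 \<tau> b)\<^sup>2 + (norm2 \<tau> a * norm2 \<tau> b + norm2 \<tau> b * norm2 \<tau> a)"
    using tau_Cauchy_Schwarz[OF a b] tau_Cauchy_Schwarz[OF b a]
      complex_Re_le_cmod[of "\<tau> (a * adj b)"] complex_Re_le_cmod[of "\<tau> (b * adj a)"] by linarith
  also have "\<dots> = (norm2 \<tau> a + norm2 \<tau> b)\<^sup>2" by (simp add: power2_sum)
  finally show ?thesis using a b by (simp add: norm2_nonneg power2_le_iff_abs_le)
qed

lemma norm2_minus_commute: "a \<in> M \<Longrightarrow> b \<in> M \<Longrightarrow> norm2 \<tau> (a - b) = norm2 \<tau> (b - a)"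
  using norm2_scaleC[of "b - a" "- 1"] by (simp add: scaleC_one)

lemma norm2_triangle_diff: "a \<in> M \<Longrightarrow> b \<in> M \<Longrightarrow> norm2 \<tau> a \<le> norm2 \<tau> b + norm2 \<tau> (a - b)"
  using norm2_triangle[of b "a - b"] by simp

lemma norm2_sum: "(\<And>i. i \<in> I \<Longrightarrow> f i \<in> M) \<Longrightarrow> norm2 \<tau> (sum f I) \<le> (\<Sum>i\<in>I. norm2 \<tau> (f i))"
proof (induction I rule: infinite_finite_induct)
  case (insert i I)
  then have "norm2 \<tau> (f i + sum f I) \<le> norm2 \<tau> (f i) + norm2 \<tau> (sum f I)"
    by (intro norm2_triangle M_sum) auto
  with insert show ?case by fastforce
qed auto

section \<open>Left multiplication is bounded in the 2-norm\<close>

text \<open>Normality yields positivity: a positive \<open>b\<close> is the supremum of the directed set \<open>{0, b}\<close>.\<close>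

lemma tau_nonneg:
  assumes "b \<in> M" "self_adjoint b" "op_le 0 b"
  shows "0 \<le> Re (\<tau> b)"
proof -
  have refl: "op_le a a" for a :: "'h cop" by (simp add: op_le_def cop_apply_simps)
  have "self_adjoint 0" by (simp add: self_adjoint_def)
  then have "Re (\<tau> b) = (SUP a\<in>{0, b}. Re (\<tau> a))"
    by (intro tau_normal[unfolded normal_on_def, THEN spec, THEN spec, THEN mp])
      (use assms refl in auto)
  also have "Re (\<tau> 0) \<le> \<dots>" by (rule cSUP_upper) auto
  finally show ?thesis by simp
qed

lemma norm2_left_bounded:
  assumes a: "a \<in> M"
  obtains K where "0 \<le> K" "\<And>x. x \<in> M \<Longrightarrow> norm2 \<tau> (a * x) \<le> K * norm2 \<tau> x"
proof -
  interpret a: bounded_linear "cop_apply a" using cop_apply[of a] by auto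
  obtain K where K: "K > 0" "\<And>h. norm (cop_apply a h) \<le> norm h * K"
    using a.pos_bounded by blast
  have "norm2 \<tau> (a * x) \<le> K * norm2 \<tau> x" if x: "x \<in> M" for x
  proof -
    \<comment> \<open>\<open>T = x\<^sup>* (K\<^sup>2 - a\<^sup>* a) x\<close> is a positive operator.\<close>
    define T where "T = complex_of_real (K\<^sup>2) *\<^sub>C (adj x * x) - adj (a * x) * (a * x)"
    have "cinner (cop_apply (T - 0) h) h =
        complex_of_real (K\<^sup>2 * (norm (cop_apply x h))\<^sup>2 - (norm (cop_apply (a * x) h))\<^sup>2)" for h
      unfolding T_def of_real_diff of_real_mult
      by (simp add: cop_apply_simps cinner_diff_left cinner_scaleC_left cinner_adj_left
          cinner_self del: adj_mult)
    moreover have "(norm (cop_apply (a * x) h))\<^sup>2 \<le> K\<^sup>2 * (norm (cop_apply x h))\<^sup>2" for h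
      using power_mono[OF K(2)[of "cop_apply x h"], of 2]
      by (simp add: times_cop.rep_eq power_mult_distrib mult_ac)
    ultimately have "op_le 0 T"
      unfolding op_le_def by (simp only: nonneg_Reals_of_real_iff diff_ge_0_iff_ge simp_thms)
    moreover have "self_adjoint T" by (simp add: T_def self_adjoint_def)
    moreover have "T \<in> M" unfolding T_def using a x by simp
    ultimately have "0 \<le> Re (\<tau> T)" by (intro tau_nonneg)
    moreover have "\<tau> T = complex_of_real (K\<^sup>2 * (norm2 \<tau> x)\<^sup>2 - (norm2 \<tau> (a * x))\<^sup>2)"
      using tau_mult_adj_self[of "adj x"] tau_mult_adj_self[of "adj (a * x)"] a x
      by (simp add: T_def tau_diff tau_scaleC norm2_adj del: adj_mult)
    ultimately have "(norm2 \<tau> (a * x))\<^sup>2 \<le> (K * norm2 \<tau> x)\<^sup>2"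
      by (simp add: power_mult_distrib)
    then show ?thesis using K a x by (simp add: norm2_nonneg power2_le_iff_abs_le)
  qed
  with K(1) show ?thesis by (intro that[of K]) auto
qed

text \<open>The moments alone bound a self-adjoint \<open>s\<close> on the 2-norm.  With \<open>g k = \<parallel>s\<^sup>k x\<parallel>\<^sub>2\<close>, the
  Cauchy-Schwarz inequality gives \<open>(g k)\<^sup>2 \<le> g (2k) g 0\<close>, so \<open>(g 1 / g 0) ^ 2\<^sup>m \<le> g (2\<^sup>m) / g 0\<close>,
  and the right-hand side grows at most like \<open>R ^ 2\<^sup>m\<close>.\<close>

lemma norm2_left_bound_of_moments:
  assumes s: "s \<in> M" "self_adjoint s" and R: "R > 0"
    and mom: "\<And>k. Re (\<tau> (s ^ (2 * k))) \<le> (R ^ k)\<^sup>2" and x: "x \<in> M"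
  shows "norm2 \<tau> (s * x) \<le> R * norm2 \<tau> x"
proof (rule ccontr)
  assume neg: "\<not> ?thesis"
  have adj_s: "adj (s ^ k) = s ^ k" for k
    using s(2) by (induction k) (auto simp: self_adjoint_def power_commutes)
  define g where "g k = norm2 \<tau> (s ^ k * x)" for k
  have g_nonneg: "0 \<le> g k" for k unfolding g_def using s x by (simp add: norm2_nonneg)
  have sq: "(g k)\<^sup>2 = Re (\<tau> (s ^ (2 * k) * x * adj x))" for k
  proof -
    have "\<tau> (s ^ k * x * adj (s ^ k * x)) = \<tau> (s ^ k * (x * adj x) * s ^ k)"
      by (simp add: adj_s mult.assoc)
    also have "\<dots> = \<tau> (s ^ k * (s ^ k * (x * adj x)))"
      using s x by (intro tau_commute) auto
    also have "s ^ k * (s ^ k * (x * adj x)) = s ^ (2 * k) * x * adj x"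
      by (simp add: mult_2 power_add mult.assoc)
    finally show ?thesis using s x by (simp add: g_def norm2_power2)
  qed
  have conv: "(g k)\<^sup>2 \<le> g (2 * k) * g 0" for k
    using tau_Cauchy_Schwarz[of "s ^ (2 * k) * x" x] s x
      complex_Re_le_cmod[of "\<tau> (s ^ (2 * k) * x * adj x)"]
    by (simp add: sq) (simp add: g_def)
  have growth: "(g k)\<^sup>2 \<le> (R ^ k)\<^sup>2 * norm2 \<tau> (x * adj x)" for k
  proof -
    have "(norm2 \<tau> (s ^ (2 * k)))\<^sup>2 = Re (\<tau> (s ^ (2 * (2 * k))))"
      using s by (simp add: norm2_power2 adj_s power_add[symmetric] mult_2)
    also have "\<dots> \<le> ((R ^ k)\<^sup>2)\<^sup>2"
      using mom[of "2 * k"] by (simp add: power_even_eq)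
    finally have "norm2 \<tau> (s ^ (2 * k)) \<le> (R ^ k)\<^sup>2"
      by (rule power2_le_imp_le) simp
    moreover have "(g k)\<^sup>2 \<le> norm2 \<tau> (s ^ (2 * k)) * norm2 \<tau> (x * adj x)"
      using tau_mult_bound[of "s ^ (2 * k)" "x * adj x"] s x
        complex_Re_le_cmod[of "\<tau> (s ^ (2 * k) * (x * adj x))"]
      by (simp add: sq mult.assoc)
    ultimately show ?thesis
      using x by (meson order_trans mult_right_mono norm2_nonneg M_mult M_adj)
  qed
  have neg': "R * g 0 < g 1" using neg by (simp add: g_def)
  have g0: "g 0 > 0"
  proof (rule ccontr)
    assume "\<not> 0 < g 0"
    then have "x = 0" using g_nonneg[of 0] norm2_eq_0[OF x] by (simp add: g_def)
    then show False using neg by simp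
  qed
  define r where "r = g 1 / g 0"
  have r: "R < r" using neg' g0 by (simp add: r_def field_simps)
  have low: "r ^ (2 ^ m) * g 0 \<le> g (2 ^ m)" for m
  proof (induction m)
    case 0
    then show ?case using g0 by (simp add: r_def)
  next
    case (Suc m)
    have "(r ^ (2 ^ m) * g 0)\<^sup>2 \<le> (g (2 ^ m))\<^sup>2"
      using Suc r R g0 by (intro power_mono) auto
    also have "\<dots> \<le> g (2 ^ Suc m) * g 0" using conv[of "2 ^ m"] by simp
    finally have "r ^ (2 ^ Suc m) * g 0 * g 0 \<le> g (2 ^ Suc m) * g 0"
      by (simp add: power_mult_distrib power2_eq_square power_add[symmetric] mult_2 mult_ac)
    then show ?case using g0 by simp
  qed
  define C where "C = sqrt (norm2 \<tau> (x * adj x)) / g 0"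
  have bound: "(r / R) ^ (2 ^ m) \<le> C" for m
  proof -
    have "r ^ (2 ^ m) * g 0 \<le> g (2 ^ m)" by (rule low)
    also have "\<dots> \<le> sqrt ((R ^ (2 ^ m))\<^sup>2 * norm2 \<tau> (x * adj x))"
      by (rule real_le_rsqrt) (rule growth)
    also have "\<dots> = R ^ (2 ^ m) * sqrt (norm2 \<tau> (x * adj x))"
      using R by (simp add: real_sqrt_mult)
    finally show ?thesis using R g0 by (simp add: C_def field_simps)
  qed
  obtain n where n: "C < (r / R) ^ n"
    using real_arch_pow[of "r / R" C] r R by auto
  have "(r / R) ^ n \<le> (r / R) ^ (2 ^ n)"
    using r R by (intro power_increasing) (auto simp: less_imp_le)
  with n bound[of n] show False by simp
qed

end

section \<open>Linear maps on tensors and polynomials\<close>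

text \<open>Complex-linear maps.\<close>

abbreviation clinear :: "('a::complex_vector \<Rightarrow> 'b::complex_vector) \<Rightarrow> bool" where
  "clinear \<equiv> Vector_Spaces.linear scaleC scaleC"

lemma clinearI:
  assumes "\<And>x y. f (x + y) = f x + f y" "\<And>c x. f (c *\<^sub>C x) = c *\<^sub>C f x"
  shows "clinear f"
  using assms
  by (intro Vector_Spaces.linear.intro module_hom.intro module_hom_axioms.intro
      cvec.vector_space_axioms cvec.module_axioms)

lemma clinear_add: "clinear f \<Longrightarrow> f (x + y) = f x + f y"
  by (rule module_hom.add) (rule Vector_Spaces.linear.axioms)

lemma clinear_scale: "clinear f \<Longrightarrow> f (c *\<^sub>C x) = c *\<^sub>C f x"
  by (rule module_hom.scale) (rule Vector_Spaces.linear.axioms)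

lemma clinear_zero: "clinear f \<Longrightarrow> f 0 = 0"
  by (rule module_hom.zero) (rule Vector_Spaces.linear.axioms)

lemma clinear_sum: "clinear f \<Longrightarrow> f (sum g I) = (\<Sum>i\<in>I. f (g i))"
  by (rule module_hom.sum) (rule Vector_Spaces.linear.axioms)

lemma clinear_of_lin_ext: "clinear L \<Longrightarrow> L (lin_ext f p) = lin_ext (\<lambda>k. L (f k)) p"
  by (simp add: lin_ext_def clinear_sum clinear_scale)

lemma clinear_compose: "clinear f \<Longrightarrow> clinear g \<Longrightarrow> clinear (\<lambda>x. g (f x))"
  by (intro clinearI) (simp_all add: clinear_add clinear_scale)

lemma clinear_plus: "clinear f \<Longrightarrow> clinear g \<Longrightarrow> clinear (\<lambda>x. f x + g x)"
  by (intro clinearI) (simp_all add: clinear_add clinear_scale scaleC_add_right algebra_simps)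

lemma lin_ext_single: "lin_ext basis p = p"
proof (rule poly_mapping_eqI)
  fix k
  have "Poly_Mapping.lookup (lin_ext basis p) k =
      (\<Sum>i\<in>Poly_Mapping.keys p. Poly_Mapping.lookup p i * (1 when i = k))"
    by (simp add: lin_ext_def lookup_sum lookup_scaleC scaleC_complex_def lookup_single)
  also have "\<dots> = (\<Sum>i\<in>Poly_Mapping.keys p. Poly_Mapping.lookup p i when i = k)"
    by (intro sum.cong) (auto simp: when_def)
  also have "\<dots> = Poly_Mapping.lookup p k"
    by (simp add: when_def sum.delta' in_keys_iff)
  finally show "Poly_Mapping.lookup (lin_ext basis p) k = Poly_Mapping.lookup p k" .
qed

lemma clinear_eq_on_basis:
  assumes "clinear f" "clinear g" "\<And>k. f (basis k) = g (basis k)"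
  shows "f p = g p"
  using clinear_of_lin_ext[OF assms(1), of basis p] clinear_of_lin_ext[OF assms(2), of basis p]
  by (simp add: lin_ext_single assms(3))

lemma lin_ext_sum: "lin_ext (\<lambda>k. \<Sum>i\<in>I. f i k) p = (\<Sum>i\<in>I. lin_ext (f i) p)"
  unfolding lin_ext_def by (simp add: cvec.scale_sum_right sum.swap[of _ I])

lemma lin_ext_plus: "lin_ext (\<lambda>k. f k + g k) p = lin_ext f p + lin_ext g p"
  unfolding lin_ext_def by (simp add: scaleC_add_right sum.distrib)

lemma abs_tensor_eqI:
  "abs_tensor p = abs_tensor q" if "p - q \<in> bilinear_relations"
  using that by (simp add: tensor.abs_eq_iff tensor_eq_def cvec.span_base)

lemma tprod_add_left: "(a + a') \<otimes> b = a \<otimes> b + a' \<otimes> b"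
proof -
  have "basis (a + a', b) - (basis (a, b) + basis (a', b)) \<in> bilinear_relations"
    unfolding bilinear_relations_def diff_diff_add[symmetric] by blast
  then show ?thesis by (simp add: tprod.abs_eq plus_tensor.abs_eq abs_tensor_eqI)
qed

lemma tprod_add_right: "a \<otimes> (b + b') = a \<otimes> b + a \<otimes> b'"
proof -
  have "basis (a, b + b') - (basis (a, b) + basis (a, b')) \<in> bilinear_relations"
    unfolding bilinear_relations_def diff_diff_add[symmetric] by blast
  then show ?thesis by (simp add: tprod.abs_eq plus_tensor.abs_eq abs_tensor_eqI)
qed

lemma tprod_scale_left: "(c *\<^sub>C a) \<otimes> b = c *\<^sub>C (a \<otimes> b)"
proof -
  have "basis (c *\<^sub>C a, b) - c *\<^sub>C basis (a, b) \<in> bilinear_relations"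
    unfolding bilinear_relations_def by blast
  then show ?thesis by (simp add: tprod.abs_eq scaleC_tensor.abs_eq abs_tensor_eqI)
qed

lemma tprod_scale_right: "a \<otimes> (c *\<^sub>C b) = c *\<^sub>C (a \<otimes> b)"
proof -
  have "basis (a, c *\<^sub>C b) - c *\<^sub>C basis (a, b) \<in> bilinear_relations"
    unfolding bilinear_relations_def by blast
  then show ?thesis by (simp add: tprod.abs_eq scaleC_tensor.abs_eq abs_tensor_eqI)
qed

lemmas tprod_bilinear = tprod_add_left tprod_add_right tprod_scale_left tprod_scale_right

lemma abs_tensor_eq_lin_ext: "abs_tensor p = lin_ext (\<lambda>(a, b). a \<otimes> b) p"
proof -
  have "clinear abs_tensor"
    by (rule clinearI) (simp_all add: plus_tensor.abs_eq scaleC_tensor.abs_eq)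
  then have "abs_tensor (lin_ext basis p) = lin_ext (\<lambda>k. abs_tensor (basis k)) p"
    by (rule clinear_of_lin_ext)
  then show ?thesis by (simp add: lin_ext_single tprod.abs_eq case_prod_unfold)
qed

lemma tensor_cases: obtains p where "t = lin_ext (\<lambda>(a, b). a \<otimes> b) p"
  by (metis abs_tensor_eq_lin_ext Quotient_abs_rep[OF Quotient_tensor])

lemma clinear_eq_on_tprod:
  assumes f: "clinear f" and g: "clinear g" and eq: "\<And>a b. f (a \<otimes> b) = g (a \<otimes> b)"
  shows "f t = g t"
proof -
  obtain p where "t = lin_ext (\<lambda>(a, b). a \<otimes> b) p" by (rule tensor_cases)
  then show ?thesis
    by (simp add: clinear_of_lin_ext[OF f] clinear_of_lin_ext[OF g] case_prod_unfold eq)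
qed

text \<open>\<open>A\<close> is a subspace and \<open>f\<close> is bilinear on \<open>A \<times> A\<close>, so that \<open>tensor_lift A f\<close> is the induced linear
  map on \<open>tensor_space A\<close>.\<close>

definition bilinear_on :: "'a::complex_vector set \<Rightarrow> ('a \<Rightarrow> 'a \<Rightarrow> 'v::complex_vector) \<Rightarrow> bool" where
  "bilinear_on A f \<longleftrightarrow> cvec.subspace A \<and>
     (\<forall>a\<in>A. \<forall>a'\<in>A. \<forall>b\<in>A. f (a + a') b = f a b + f a' b) \<and>
     (\<forall>a\<in>A. \<forall>b\<in>A. \<forall>b'\<in>A. f a (b + b') = f a b + f a b') \<and>
     (\<forall>c. \<forall>a\<in>A. \<forall>b\<in>A. f (c *\<^sub>C a) b = c *\<^sub>C f a b) \<and>
     (\<forall>c. \<forall>a\<in>A. \<forall>b\<in>A. f a (c *\<^sub>C b) = c *\<^sub>C f a b)"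

lemma tensor_lift_abs':
  assumes "bilinear_on A f" "Poly_Mapping.keys p \<subseteq> A \<times> A"
  shows "tensor_lift A f (abs_tensor p) = lin_ext (\<lambda>(a, b). f a b) p"
  by (rule tensor_lift_abs) (use assms in \<open>auto simp: bilinear_on_def\<close>)

lemma tensor_lift_tprod:
  assumes "bilinear_on A f" "a \<in> A" "b \<in> A"
  shows "tensor_lift A f (a \<otimes> b) = f a b"
  using tensor_lift_abs'[OF assms(1), of "basis (a, b)"] assms(2,3) by (simp add: tprod.abs_eq)

lemma tensor_space_rep:
  assumes "t \<in> tensor_space A"
  shows "\<exists>p. Poly_Mapping.keys p \<subseteq> A \<times> A \<and> abs_tensor p = t"
  using assms unfolding tensor_space_def
proof (induction rule: cvec.span_induct_alt)
  case base
  show ?case by (intro exI[of _ 0]) (simp add: zero_tensor.abs_eq)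
next
  case (step c x y)
  then obtain a b p where x: "x = a \<otimes> b" "a \<in> A" "b \<in> A"
    and p: "Poly_Mapping.keys p \<subseteq> A \<times> A" "abs_tensor p = y" by blast
  have "Poly_Mapping.keys (c *\<^sub>C basis (a, b)) \<subseteq> A \<times> A"
    using x by (auto simp: in_keys_iff lookup_scaleC lookup_single when_def split: if_splits)
  then have "Poly_Mapping.keys (c *\<^sub>C basis (a, b) + p) \<subseteq> A \<times> A"
    using p(1) Poly_Mapping.keys_add[of "c *\<^sub>C basis (a, b)" p] by blast
  moreover have "abs_tensor (c *\<^sub>C basis (a, b) + p) = c *\<^sub>C x + y"
    by (simp add: x p tprod.abs_eq scaleC_tensor.abs_eq plus_tensor.abs_eq flip: p(2))
  ultimately show ?case by blast
qed

lemma subspace_tensor_space: "cvec.subspace (tensor_space A)"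
  unfolding tensor_space_def by (rule cvec.subspace_span)

lemma tprod_in_tensor_space: "a \<in> A \<Longrightarrow> b \<in> A \<Longrightarrow> a \<otimes> b \<in> tensor_space A"
  unfolding tensor_space_def by (intro cvec.span_base) blast

lemma tensor_lift_add:
  assumes "bilinear_on A f" "s \<in> tensor_space A" "t \<in> tensor_space A"
  shows "tensor_lift A f (s + t) = tensor_lift A f s + tensor_lift A f t"
proof -
  obtain p q where p: "Poly_Mapping.keys p \<subseteq> A \<times> A" "abs_tensor p = s"
    and q: "Poly_Mapping.keys q \<subseteq> A \<times> A" "abs_tensor q = t"
    using assms(2,3)[THEN tensor_space_rep] by blast
  have "Poly_Mapping.keys (p + q) \<subseteq> A \<times> A"
    using p(1) q(1) Poly_Mapping.keys_add[of p q] by blast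
  from tensor_lift_abs'[OF assms(1) this] show ?thesis
    using tensor_lift_abs'[OF assms(1) p(1)] tensor_lift_abs'[OF assms(1) q(1)] p(2) q(2)
    by (simp add: plus_tensor.abs_eq[symmetric] clinear_add[OF linear_lin_ext])
qed

lemma tensor_lift_scale:
  assumes "bilinear_on A f" "s \<in> tensor_space A"
  shows "tensor_lift A f (c *\<^sub>C s) = c *\<^sub>C tensor_lift A f s"
proof -
  obtain p where p: "Poly_Mapping.keys p \<subseteq> A \<times> A" "abs_tensor p = s"
    using assms(2)[THEN tensor_space_rep] by blast
  have "Poly_Mapping.keys (c *\<^sub>C p) \<subseteq> A \<times> A"
    using p(1) by (auto simp: in_keys_iff lookup_scaleC subset_iff)
  from tensor_lift_abs'[OF assms(1) this] show ?thesis
    using tensor_lift_abs'[OF assms(1) p(1)] p(2)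
    by (simp add: scaleC_tensor.abs_eq[symmetric] clinear_scale[OF linear_lin_ext])
qed

lemma tensor_lift_zero: "bilinear_on A f \<Longrightarrow> tensor_lift A f 0 = 0"
  using tensor_lift_scale[of A f 0 0] cvec.subspace_0[OF subspace_tensor_space, of A] by simp

lemma tensor_lift_sum:
  assumes f: "bilinear_on A f" and "\<And>i. i \<in> I \<Longrightarrow> g i \<in> tensor_space A"
  shows "tensor_lift A f (sum g I) = (\<Sum>i\<in>I. tensor_lift A f (g i))"
  using assms(2)
proof (induction I rule: infinite_finite_induct)
  case (insert i I)
  then have "sum g I \<in> tensor_space A"
    by (intro cvec.subspace_sum[OF subspace_tensor_space]) auto
  with insert show ?case by (simp add: tensor_lift_add[OF f])
qed (simp_all add: tensor_lift_zero[OF f])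

lemma tensor_lift_lin_ext:
  assumes f: "bilinear_on A f" and g: "\<And>k. g k \<in> tensor_space A"
  shows "tensor_lift A f (lin_ext g p) = lin_ext (\<lambda>k. tensor_lift A f (g k)) p"
  unfolding lin_ext_def
  by (simp add: tensor_lift_sum[OF f] tensor_lift_scale[OF f] g
      cvec.subspace_scale[OF subspace_tensor_space])

lemma tensor_space_UNIV: "t \<in> tensor_space UNIV"
proof -
  obtain p where "t = lin_ext (\<lambda>(a, b). a \<otimes> b) p" by (rule tensor_cases)
  then show ?thesis
    by (auto simp: lin_ext_def case_prod_unfold intro!: cvec.subspace_sum[OF subspace_tensor_space]
        cvec.subspace_scale[OF subspace_tensor_space] tprod_in_tensor_space)
qed

lemma clinear_tensor_lift: "bilinear_on UNIV f \<Longrightarrow> clinear (tensor_lift UNIV f)"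
  by (intro clinearI tensor_lift_add tensor_lift_scale tensor_space_UNIV)

lemma bilinear_left_act: "bilinear_on UNIV (\<lambda>b c. (a * b) \<otimes> (c :: 'h::complex_hilbert_space cop))"
  by (simp add: bilinear_on_def cvec.subspace_UNIV distrib_left tprod_bilinear)

lemma bilinear_right_act: "bilinear_on UNIV (\<lambda>b c. b \<otimes> (c * (d :: 'h::complex_hilbert_space cop)))"
  by (simp add: bilinear_on_def cvec.subspace_UNIV distrib_right tprod_bilinear)

lemma clinear_left_act: "clinear (left_act a)"
  unfolding left_act_def by (rule clinear_tensor_lift[OF bilinear_left_act])

lemma clinear_right_act: "clinear (\<lambda>t. right_act t d)"
  unfolding right_act_def by (rule clinear_tensor_lift[OF bilinear_right_act])

lemma left_act_tprod [simp]: "left_act a (b \<otimes> c) = (a * b) \<otimes> c"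
  unfolding left_act_def by (simp add: tensor_lift_tprod[OF bilinear_left_act])

lemma right_act_tprod [simp]: "right_act (b \<otimes> c) d = b \<otimes> (c * d)"
  unfolding right_act_def by (simp add: tensor_lift_tprod[OF bilinear_right_act])

lemma left_act_one: "left_act 1 t = t"
  by (rule clinear_eq_on_tprod[OF clinear_left_act cvec.linear_ident]) simp

lemma right_act_one: "right_act t 1 = t"
  by (rule clinear_eq_on_tprod[OF clinear_right_act cvec.linear_ident]) simp

lemma right_act_scale: "right_act t (c *\<^sub>C d) = c *\<^sub>C right_act t d"
  by (rule clinear_eq_on_tprod[OF clinear_right_act
        clinear_compose[OF clinear_right_act cvec.linear_scale_self]])
    (simp add: tprod_scale_right)

lemma right_act_add: "right_act t (d + e) = right_act t d + right_act t e"
  by (rule clinear_eq_on_tprod[OF clinear_right_act clinear_plus[OF clinear_right_act clinear_right_act]])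
    (simp add: tprod_add_right distrib_left)

lemma left_act_scale: "left_act (c *\<^sub>C d) t = c *\<^sub>C left_act d t"
  by (rule clinear_eq_on_tprod[OF clinear_left_act
        clinear_compose[OF clinear_left_act cvec.linear_scale_self]])
    (simp add: tprod_scale_left)

lemma left_act_add: "left_act (d + e) t = left_act d t + left_act e t"
  by (rule clinear_eq_on_tprod[OF clinear_left_act clinear_plus[OF clinear_left_act clinear_left_act]])
    (simp add: tprod_add_left distrib_right)

lemma clinear_nc_eval: "clinear (nc_eval X)"
  unfolding nc_eval_def by (rule linear_lin_ext)

lemma nc_eval_basis [simp]: "nc_eval X (basis w) = prod_list (map X w)"
  by (simp add: nc_eval_def)

lemma bilinear_nc_eval2: "bilinear_on UNIV (\<lambda>P Q. nc_eval X P \<otimes> nc_eval X Q)"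
  by (simp add: bilinear_on_def cvec.subspace_UNIV clinear_add[OF clinear_nc_eval]
      clinear_scale[OF clinear_nc_eval] tprod_bilinear)

lemma clinear_nc_eval2: "clinear (nc_eval2 X)"
  unfolding nc_eval2_def by (rule clinear_tensor_lift[OF bilinear_nc_eval2])

lemma nc_eval2_tprod [simp]: "nc_eval2 X (P \<otimes> Q) = nc_eval X P \<otimes> nc_eval X Q"
  unfolding nc_eval2_def by (simp add: tensor_lift_tprod[OF bilinear_nc_eval2])

text \<open>The factorizations of a word \<open>w\<close> as \<open>u j v\<close>, over which the free difference quotient sums.\<close>

definition splits :: "'n \<Rightarrow> 'n list \<Rightarrow> ('n list \<times> 'n list) set" where
  "splits j w = {(u, v). w = u @ [j] @ v}"

lemma splits_Nil [simp]: "splits j [] = {}"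
  by (simp add: splits_def)

lemma splits_Cons:
  "splits j (x # w) = (if x = j then {([], w)} else {}) \<union> (\<lambda>(u, v). (x # u, v)) ` splits j w"
  by (auto simp: splits_def Cons_eq_append_conv)

lemma finite_splits [simp]: "finite (splits j w)"
  by (induction w) (auto simp: splits_Cons)

lemma sum_splits_Cons:
  fixes f :: "'n list \<Rightarrow> 'n list \<Rightarrow> 'b::comm_monoid_add"
  shows "(\<Sum>(u, v)\<in>splits j (x # w). f u v) =
    (if x = j then f [] w else 0) + (\<Sum>(u, v)\<in>splits j w. f (x # u) v)"
proof -
  have "(\<Sum>(u, v)\<in>(\<lambda>(u, v). (x # u, v)) ` splits j w. f u v) = (\<Sum>(u, v)\<in>splits j w. f (x # u) v)"
    by (subst sum.reindex) (auto simp: inj_on_def case_prod_unfold)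
  then show ?thesis
    unfolding splits_Cons by (subst sum.union_disjoint) auto
qed

lemma sum_splits_append:
  fixes f :: "'n list \<Rightarrow> 'n list \<Rightarrow> 'b::comm_monoid_add"
  shows "(\<Sum>(a, b)\<in>splits j (u @ v). f a b) =
    (\<Sum>(a, b)\<in>splits j u. f a (b @ v)) + (\<Sum>(a, b)\<in>splits j v. f (u @ a) b)"
  by (induction u arbitrary: f) (simp_all add: sum_splits_Cons add.assoc)

lemma clinear_free_diff: "clinear (free_diff j)"
  unfolding free_diff_def by (rule linear_lin_ext)

lemma nc_eval2_free_diff:
  "nc_eval2 X (free_diff j P) =
    lin_ext (\<lambda>w. \<Sum>(u, v)\<in>splits j w. prod_list (map X u) \<otimes> prod_list (map X v)) P"
  unfolding free_diff_def splits_def[symmetric]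
  by (simp add: clinear_of_lin_ext[OF clinear_nc_eval2] clinear_sum[OF clinear_nc_eval2]
      case_prod_unfold)

lemma (in tracial) subspace_M: "cvec.subspace M"
  by (simp add: cvec.subspace_def)

lemma (in tracial) tau2_free_diff:
  assumes X: "\<And>i. X i \<in> M"
  shows "tau2 M \<tau> (nc_eval2 X (free_diff j P)) =
    lin_ext (\<lambda>w. \<Sum>(u, v)\<in>splits j w. \<tau> (prod_list (map X u)) * \<tau> (prod_list (map X v))) P"
proof -
  have bil: "bilinear_on M (\<lambda>a b. \<tau> a * \<tau> b)"
    by (simp add: bilinear_on_def subspace_M tau_add tau_scaleC scaleC_complex_def algebra_simps)
  have in_ts: "prod_list (map X u) \<otimes> prod_list (map X v) \<in> tensor_space M" for u v
    by (intro tprod_in_tensor_space M_prod_list X)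
  show ?thesis
    unfolding tau2_def nc_eval2_free_diff
    by (subst tensor_lift_lin_ext[OF bil])
      (auto simp: case_prod_unfold tensor_lift_sum[OF bil] tensor_lift_tprod[OF bil]
        in_ts M_prod_list X intro!: cvec.subspace_sum[OF subspace_tensor_space])
qed

section \<open>The space L2\<close>

context tracial
begin

lemma l2_equiv_refl: "x \<in> l2_cauchy M \<tau> \<Longrightarrow> (x, x) \<in> l2_equiv M \<tau>"
  by (simp add: l2_equiv_def)

lemma l2_rep_L2: "\<xi> \<in> L2 M \<tau> \<Longrightarrow> l2_rep \<xi> \<in> l2_cauchy M \<tau>"
proof -
  assume "\<xi> \<in> L2 M \<tau>"
  then obtain x where x: "x \<in> l2_cauchy M \<tau>" "\<xi> = l2_equiv M \<tau> `` {x}"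
    by (auto simp: L2_def quotient_def)
  then have "x \<in> \<xi>" using l2_equiv_refl by auto
  then have "l2_rep \<xi> \<in> \<xi>" unfolding l2_rep_def by (rule someI[of "\<lambda>a. a \<in> \<xi>"])
  then show ?thesis using x by (auto simp: l2_equiv_def)
qed

lemma l2_rep_embed:
  assumes "b \<in> M"
  shows "l2_rep (l2_embed M \<tau> b) \<in> l2_cauchy M \<tau>"
    and "(\<lambda>k. norm2 \<tau> (l2_rep (l2_embed M \<tau> b) k - b)) \<longlonglongrightarrow> 0"
proof -
  have c: "(\<lambda>_. b) \<in> l2_cauchy M \<tau>" using assms by (auto simp: l2_cauchy_def)
  then have "(\<lambda>_. b) \<in> l2_embed M \<tau> b" using l2_equiv_refl by (auto simp: l2_embed_def)
  then have "l2_rep (l2_embed M \<tau> b) \<in> l2_embed M \<tau> b"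
    unfolding l2_rep_def by (rule someI[of "\<lambda>a. a \<in> l2_embed M \<tau> b"])
  then have e: "((\<lambda>_. b), l2_rep (l2_embed M \<tau> b)) \<in> l2_equiv M \<tau>" by (simp add: l2_embed_def)
  then show rep: "l2_rep (l2_embed M \<tau> b) \<in> l2_cauchy M \<tau>" by (auto simp: l2_equiv_def)
  have "norm2 \<tau> (b - l2_rep (l2_embed M \<tau> b) k) = norm2 \<tau> (l2_rep (l2_embed M \<tau> b) k - b)" for k
    using rep assms by (intro norm2_minus_commute) (auto simp: l2_cauchy_def)
  then show "(\<lambda>k. norm2 \<tau> (l2_rep (l2_embed M \<tau> b) k - b)) \<longlonglongrightarrow> 0"
    using e by (simp add: l2_equiv_def)
qed

lemma l2_cauchy_in_M: "x \<in> l2_cauchy M \<tau> \<Longrightarrow> x k \<in> M"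
  by (auto simp: l2_cauchy_def)

lemma norm2_abs_diff: "a \<in> M \<Longrightarrow> b \<in> M \<Longrightarrow> \<bar>norm2 \<tau> a - norm2 \<tau> b\<bar> \<le> norm2 \<tau> (a - b)"
  using norm2_triangle_diff[of a b] norm2_triangle_diff[of b a] norm2_minus_commute[of a b] by auto

lemma l2_norm_lim:
  assumes \<xi>: "\<xi> \<in> L2 M \<tau>"
  shows "(\<lambda>k. norm2 \<tau> (l2_rep \<xi> k)) \<longlonglongrightarrow> l2_norm \<tau> \<xi>"
proof -
  define x where "x = l2_rep \<xi>"
  have x: "x \<in> l2_cauchy M \<tau>" unfolding x_def by (rule l2_rep_L2[OF \<xi>])
  have "Cauchy (\<lambda>k. norm2 \<tau> (x k))"
    unfolding Cauchy_def dist_real_def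
  proof (intro allI impI)
    fix e :: real assume "e > 0"
    then obtain m where "\<forall>k\<ge>m. \<forall>l\<ge>m. norm2 \<tau> (x k - x l) < e"
      using x by (auto simp: l2_cauchy_def)
    then show "\<exists>m. \<forall>k\<ge>m. \<forall>l\<ge>m. \<bar>norm2 \<tau> (x k) - norm2 \<tau> (x l)\<bar> < e"
      using norm2_abs_diff[OF l2_cauchy_in_M[OF x] l2_cauchy_in_M[OF x]] by (meson le_less_trans)
  qed
  then obtain N where N: "(\<lambda>k. norm2 \<tau> (x k)) \<longlonglongrightarrow> N"
    using Cauchy_convergent_iff convergent_def by blast
  then have "(\<lambda>k. complex_of_real ((norm2 \<tau> (x k))\<^sup>2)) \<longlonglongrightarrow> complex_of_real (N\<^sup>2)"
    by (intro tendsto_intros)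
  moreover have "\<tau> (x k * adj (x k)) = complex_of_real ((norm2 \<tau> (x k))\<^sup>2)" for k
    by (rule tau_mult_adj_self) (rule l2_cauchy_in_M[OF x])
  ultimately have "l2_inner \<tau> \<xi> \<xi> = complex_of_real (N\<^sup>2)"
    unfolding l2_inner_def x_def[symmetric] by (intro limI) simp
  moreover have "0 \<le> N"
    by (rule LIMSEQ_le_const[OF N]) (auto intro!: norm2_nonneg l2_cauchy_in_M[OF x])
  ultimately have "l2_norm \<tau> \<xi> = N" by (simp add: l2_norm_def)
  with N show ?thesis by (simp add: x_def)
qed

lemma l2_norm_nonneg: "\<xi> \<in> L2 M \<tau> \<Longrightarrow> 0 \<le> l2_norm \<tau> \<xi>"
  by (rule LIMSEQ_le_const[OF l2_norm_lim]) (auto intro!: norm2_nonneg l2_cauchy_in_M l2_rep_L2)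

lemma l2_tau_bound:
  assumes \<xi>: "\<xi> \<in> L2 M \<tau>" and a: "a \<in> M"
  shows "cmod (l2_tau M \<tau> \<xi> a) \<le> l2_norm \<tau> \<xi> * norm2 \<tau> a"
proof -
  define x b y where "x = l2_rep \<xi>" and "b = adj a" and "y = l2_rep (l2_embed M \<tau> b)"
  have b: "b \<in> M" using a by (simp add: b_def)
  have x: "x \<in> l2_cauchy M \<tau>" unfolding x_def by (rule l2_rep_L2[OF \<xi>])
  have y: "y \<in> l2_cauchy M \<tau>" and lim: "(\<lambda>k. norm2 \<tau> (y k - b)) \<longlonglongrightarrow> 0"
    unfolding y_def by (rule l2_rep_embed[OF b])+
  note xM = l2_cauchy_in_M[OF x] and yM = l2_cauchy_in_M[OF y]
  have nx: "(\<lambda>k. norm2 \<tau> (x k)) \<longlonglongrightarrow> l2_norm \<tau> \<xi>"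
    unfolding x_def by (rule l2_norm_lim[OF \<xi>])
  have ny: "(\<lambda>k. norm2 \<tau> (y k)) \<longlonglongrightarrow> norm2 \<tau> b"
  proof (rule LIM_zero_cancel, rule Lim_null_comparison[OF _ lim])
    show "\<forall>\<^sub>F k in sequentially. norm (norm2 \<tau> (y k) - norm2 \<tau> b) \<le> norm2 \<tau> (y k - b)"
      using norm2_abs_diff[OF yM b] by simp
  qed
  have "Cauchy (\<lambda>k. \<tau> (x k * adj b))"
    unfolding Cauchy_def dist_norm
  proof (intro allI impI)
    fix e :: real assume e: "e > 0"
    have pos: "norm2 \<tau> b + 1 > 0" using norm2_nonneg[OF b] by linarith
    then have "e / (norm2 \<tau> b + 1) > 0" using e by simp
    then obtain m where m: "\<forall>k\<ge>m. \<forall>l\<ge>m. norm2 \<tau> (x k - x l) < e / (norm2 \<tau> b + 1)"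
      using x unfolding l2_cauchy_def by blast
    have "norm (\<tau> (x k * adj b) - \<tau> (x l * adj b)) < e" if "k \<ge> m" "l \<ge> m" for k l
    proof -
      have "\<tau> (x k * adj b) - \<tau> (x l * adj b) = \<tau> ((x k - x l) * adj b)"
        using xM b by (simp add: tau_diff left_diff_distrib)
      also have "cmod \<dots> \<le> norm2 \<tau> (x k - x l) * norm2 \<tau> b"
        by (intro tau_Cauchy_Schwarz M_diff xM b)
      also have "\<dots> \<le> norm2 \<tau> (x k - x l) * (norm2 \<tau> b + 1)"
        by (intro mult_left_mono norm2_nonneg M_diff xM) simp
      also have "\<dots> < e" using m that pos by (simp add: field_simps)
      finally show ?thesis .
    qed
    then show "\<exists>m. \<forall>k\<ge>m. \<forall>l\<ge>m. norm (\<tau> (x k * adj b) - \<tau> (x l * adj b)) < e" by blast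
  qed
  then obtain z where z: "(\<lambda>k. \<tau> (x k * adj b)) \<longlonglongrightarrow> z"
    using Cauchy_convergent_iff convergent_def by blast
  have "(\<lambda>k. \<tau> (x k * adj (y k)) - \<tau> (x k * adj b)) \<longlonglongrightarrow> 0"
  proof (rule Lim_null_comparison)
    show "(\<lambda>k. norm2 \<tau> (x k) * norm2 \<tau> (y k - b)) \<longlonglongrightarrow> 0"
      using tendsto_mult[OF nx lim] by simp
    have "norm (\<tau> (x k * adj (y k)) - \<tau> (x k * adj b)) \<le> norm2 \<tau> (x k) * norm2 \<tau> (y k - b)" for k
      using tau_Cauchy_Schwarz[OF xM M_diff[OF yM b], of k k] xM yM b
      by (simp add: tau_diff right_diff_distrib)
    then show "\<forall>\<^sub>F k in sequentially.
        norm (\<tau> (x k * adj (y k)) - \<tau> (x k * adj b)) \<le> norm2 \<tau> (x k) * norm2 \<tau> (y k - b)"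
      by simp
  qed
  from tendsto_add[OF this z] have lim_xy: "(\<lambda>k. \<tau> (x k * adj (y k))) \<longlonglongrightarrow> z" by simp
  then have "l2_tau M \<tau> \<xi> a = z"
    unfolding l2_tau_def l2_inner_def x_def y_def b_def by (rule limI)
  moreover have "cmod z \<le> l2_norm \<tau> \<xi> * norm2 \<tau> b"
    using tau_Cauchy_Schwarz[OF xM yM]
    by (intro LIMSEQ_le[OF tendsto_norm[OF lim_xy] tendsto_mult[OF nx ny]]) auto
  ultimately show ?thesis using a by (simp add: b_def norm2_adj)
qed

lemma conjugate_system_L2: "conjugate_system M \<tau> Y \<xi> \<Longrightarrow> \<xi> j \<in> L2 M \<tau>"
  by (simp add: conjugate_system_def l2_closure_def)

lemma conjugate_system_eq:
  "conjugate_system M \<tau> Y \<xi> \<Longrightarrow>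
    tau2 M \<tau> (nc_eval2 Y (free_diff j P)) = l2_tau M \<tau> (\<xi> j) (nc_eval Y P)"
  by (simp add: conjugate_system_def)

section \<open>Relations pass to the free difference quotients\<close>

text \<open>\<open>mult_bound K a\<close> says that left multiplication by \<open>a\<close> has norm at most \<open>K\<close> for the 2-norm.\<close>

definition mult_bound :: "real \<Rightarrow> 'h cop \<Rightarrow> bool" where
  "mult_bound K a \<longleftrightarrow> (\<forall>x\<in>M. norm2 \<tau> (a * x) \<le> K * norm2 \<tau> x)"

lemma mult_boundD: "mult_bound K a \<Longrightarrow> x \<in> M \<Longrightarrow> norm2 \<tau> (a * x) \<le> K * norm2 \<tau> x"
  by (simp add: mult_bound_def)

lemma mult_bound_norm2: "mult_bound K a \<Longrightarrow> norm2 \<tau> a \<le> K"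
  using mult_boundD[of K a 1] by simp

lemma mult_bound_mono: "mult_bound K a \<Longrightarrow> K \<le> K' \<Longrightarrow> mult_bound K' a"
  unfolding mult_bound_def by (meson mult_right_mono norm2_nonneg order_trans)

lemma mult_bound_add:
  assumes "a \<in> M" "b \<in> M" "mult_bound K a" "mult_bound L b"
  shows "mult_bound (K + L) (a + b)"
  unfolding mult_bound_def
proof
  fix x assume x: "x \<in> M"
  have "norm2 \<tau> (a * x + b * x) \<le> norm2 \<tau> (a * x) + norm2 \<tau> (b * x)"
    using assms x by (intro norm2_triangle) auto
  also have "\<dots> \<le> K * norm2 \<tau> x + L * norm2 \<tau> x"
    using assms x by (intro add_mono mult_boundD)
  finally show "norm2 \<tau> ((a + b) * x) \<le> (K + L) * norm2 \<tau> x" by (simp add: algebra_simps)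
qed

lemma mult_bound_scaleC:
  assumes "a \<in> M" "mult_bound K a"
  shows "mult_bound (cmod c * K) (c *\<^sub>C a)"
  using assms by (auto simp: mult_bound_def norm2_scaleC mult.assoc intro!: mult_left_mono)

lemma mult_bound_mult:
  assumes "b \<in> M" "mult_bound K a" "mult_bound L b" "0 \<le> K"
  shows "mult_bound (K * L) (a * b)"
  unfolding mult_bound_def
proof
  fix x assume x: "x \<in> M"
  have "norm2 \<tau> (a * (b * x)) \<le> K * norm2 \<tau> (b * x)" using assms x by (intro mult_boundD) auto
  also have "\<dots> \<le> K * (L * norm2 \<tau> x)" using assms x by (intro mult_left_mono mult_boundD) auto
  finally show "norm2 \<tau> (a * b * x) \<le> K * L * norm2 \<tau> x" by (simp add: mult.assoc)
qed

lemma mult_bound_one: "mult_bound 1 1" by (simp add: mult_bound_def)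

lemma mult_bound_word:
  assumes "\<And>i. Y i \<in> M" "\<And>i. mult_bound L (Y i)" "1 \<le> L"
  shows "mult_bound (L ^ length w) (prod_list (map Y w))"
  using assms by (induction w) (auto intro!: mult_bound_one mult_bound_mult M_prod_list)

lemma mult_bound_word_diff:
  fixes L r :: real
  assumes X: "\<And>i. X i \<in> M" "\<And>i. mult_bound L (X i)" and L: "1 \<le> L"
    and Y: "\<And>i. Y i \<in> M" "\<And>i. mult_bound L (Y i)"
    and r: "0 \<le> r" "\<And>i. mult_bound r (Y i - X i)"
  shows "mult_bound (r * (real (length w) * L ^ length w)) (prod_list (map Y w) - prod_list (map X w))"
proof (induction w)
  case Nil
  then show ?case by (simp add: mult_bound_def)
next
  case (Cons i w)
  let ?Y = "prod_list (map Y w)" and ?X = "prod_list (map X w)"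
  have in_M: "?X \<in> M" "?Y \<in> M" by (intro M_prod_list X Y)+
  have "mult_bound (L * (r * (real (length w) * L ^ length w))) (Y i * (?Y - ?X))"
    using L in_M Y Cons.IH by (intro mult_bound_mult) auto
  moreover have "mult_bound (r * L ^ length w) ((Y i - X i) * ?X)"
    using L r X in_M by (intro mult_bound_mult mult_bound_word) auto
  ultimately have sum: "mult_bound (L * (r * (real (length w) * L ^ length w)) + r * L ^ length w)
      (Y i * (?Y - ?X) + (Y i - X i) * ?X)"
    using in_M X Y by (intro mult_bound_add) auto
  have "r * L ^ length w \<le> r * L ^ length (i # w)"
    using r L by (intro mult_left_mono power_increasing) auto
  moreover have "r * (real (length (i # w)) * L ^ length (i # w)) =
      L * (r * (real (length w) * L ^ length w)) + r * L ^ length (i # w)"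
    by (simp add: algebra_simps)
  ultimately have "L * (r * (real (length w) * L ^ length w)) + r * L ^ length w
      \<le> r * (real (length (i # w)) * L ^ length (i # w))"
    by linarith
  from mult_bound_mono[OF sum this] show ?case
    by (simp add: algebra_simps)
qed

text \<open>The functional \<open>(\<tau> \<otimes> \<tau>) ((\<partial>\<^sub>j P)(Y) \<cdot> (1 \<otimes> q(Y)))\<close> for a word \<open>q\<close>.\<close>

definition diff_pairing :: "('n \<Rightarrow> 'h cop) \<Rightarrow> 'n \<Rightarrow> 'n list \<Rightarrow> 'n ncpoly \<Rightarrow> complex" where
  "diff_pairing Y j q = lin_ext (\<lambda>w. \<Sum>(u, v)\<in>splits j w.
     \<tau> (prod_list (map Y u)) * \<tau> (prod_list (map Y (v @ q))))"

text \<open>The conjugate relation for the polynomial \<open>P q\<close>, expanded by the Leibniz rule.\<close>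

lemma conjugate_relation_Leibniz:
  fixes Y :: "'n \<Rightarrow> 'h cop"
  assumes Y: "\<And>i. Y i \<in> M" and \<xi>: "conjugate_system M \<tau> Y \<xi>"
  shows "l2_tau M \<tau> (\<xi> j) (nc_eval Y P * prod_list (map Y q)) = diff_pairing Y j q P +
    (\<Sum>(u, v)\<in>splits j q. \<tau> (nc_eval Y P * prod_list (map Y u)) * \<tau> (prod_list (map Y v)))"
proof -
  let ?w = "\<lambda>w. prod_list (map Y w)"
  have M: "?w w \<in> M" for w by (intro M_prod_list Y)
  define Q where "Q = lin_ext (\<lambda>w. basis (w @ q)) P"
  have lin: "clinear (\<lambda>a. a * b)" for b :: "'h cop"
    by (rule clinearI) (simp_all add: distrib_right)
  have "nc_eval Y Q = lin_ext (\<lambda>w. ?w w * ?w q) P"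
    unfolding Q_def by (simp add: clinear_of_lin_ext[OF clinear_nc_eval])
  also have "\<dots> = nc_eval Y P * ?w q"
    unfolding nc_eval_def by (rule clinear_of_lin_ext[OF lin, symmetric])
  finally have "l2_tau M \<tau> (\<xi> j) (nc_eval Y P * ?w q) = tau2 M \<tau> (nc_eval2 Y (free_diff j Q))"
    using conjugate_system_eq[OF \<xi>] by simp
  also have "\<dots> = lin_ext (\<lambda>w. \<Sum>(u, v)\<in>splits j w. \<tau> (?w u) * \<tau> (?w v)) Q"
    by (rule tau2_free_diff[OF Y])
  also have "\<dots> = lin_ext (\<lambda>w. \<Sum>(u, v)\<in>splits j (w @ q). \<tau> (?w u) * \<tau> (?w v)) P"
    unfolding Q_def by (simp add: clinear_of_lin_ext[OF linear_lin_ext])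
  also have "\<dots> = diff_pairing Y j q P +
      lin_ext (\<lambda>w. \<Sum>(u, v)\<in>splits j q. \<tau> (?w w * ?w u) * \<tau> (?w v)) P"
    unfolding sum_splits_append lin_ext_plus diff_pairing_def by simp
  also have "lin_ext (\<lambda>w. \<Sum>(u, v)\<in>splits j q. \<tau> (?w w * ?w u) * \<tau> (?w v)) P =
      (\<Sum>(u, v)\<in>splits j q. \<tau> (nc_eval Y P * ?w u) * \<tau> (?w v))"
    unfolding case_prod_unfold lin_ext_sum
  proof (rule sum.cong[OF refl])
    fix uv :: "'n list \<times> 'n list"
    have "nc_eval Y P * ?w (fst uv) = lin_ext (\<lambda>w. ?w w * ?w (fst uv)) P"
      unfolding nc_eval_def by (rule clinear_of_lin_ext[OF lin])
    then have "\<tau> (nc_eval Y P * ?w (fst uv)) = lin_ext (\<lambda>w. \<tau> (?w w * ?w (fst uv))) P"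
      by (simp add: tau_lin_ext M) (simp add: lin_ext_def scaleC_complex_def)
    then show "lin_ext (\<lambda>w. \<tau> (?w w * ?w (fst uv)) * \<tau> (?w (snd uv))) P =
        \<tau> (nc_eval Y P * ?w (fst uv)) * \<tau> (?w (snd uv))"
      by (simp add: lin_ext_def scaleC_complex_def sum_distrib_right mult.assoc)
  qed
  finally show ?thesis .
qed

lemma adj_word:
  assumes "\<And>i. self_adjoint (Y i)"
  shows "adj (prod_list (map Y w)) = prod_list (map Y (rev w))"
  using assms by (induction w) (auto simp: self_adjoint_def)

lemma norm2_mult_word:
  assumes Y: "\<And>i. Y i \<in> M" "\<And>i. self_adjoint (Y i)" "\<And>i. mult_bound L (Y i)" "1 \<le> L"
    and a: "a \<in> M"
  shows "norm2 \<tau> (a * prod_list (map Y w)) \<le> L ^ length w * norm2 \<tau> a"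
proof -
  have M: "prod_list (map Y w) \<in> M" by (intro M_prod_list Y)
  have "norm2 \<tau> (a * prod_list (map Y w)) = norm2 \<tau> (prod_list (map Y (rev w)) * adj a)"
    using norm2_adj[of "a * prod_list (map Y w)"] a M Y(2) by (simp add: adj_word)
  also have "\<dots> \<le> L ^ length (rev w) * norm2 \<tau> (adj a)"
    using a Y by (intro mult_boundD mult_bound_word) auto
  finally show ?thesis using a by (simp add: norm2_adj)
qed

lemma diff_pairing_near:
  fixes X :: "'n \<Rightarrow> 'h cop"
  assumes X: "\<And>i. X i \<in> M" "\<And>i. mult_bound L (X i)" and L: "1 \<le> L"
  shows "\<exists>K\<ge>0. \<forall>Y r. (\<forall>i. Y i \<in> M \<and> mult_bound L (Y i) \<and> mult_bound r (Y i - X i)) \<longrightarrow> 0 \<le> r \<longrightarrow>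
    cmod (diff_pairing Y j q P - diff_pairing X j q P) \<le> K * r"
proof -
  define k where "k u v = real (length u + length v) * L ^ (length u + length v)"
    for u v :: "'n list"
  define K where "K = (\<Sum>w\<in>Poly_Mapping.keys P. cmod (Poly_Mapping.lookup P w) *
    (\<Sum>(u, v)\<in>splits j w. k u (v @ q)))"
  have k0: "0 \<le> k u v" for u v using L by (simp add: k_def)
  have "cmod (diff_pairing Y j q P - diff_pairing X j q P) \<le> K * r"
    if Y: "\<And>i. Y i \<in> M" "\<And>i. mult_bound L (Y i)" and d: "\<And>i. mult_bound r (Y i - X i)"
      and r: "0 \<le> r" for Y r
  proof -
    let ?Y = "\<lambda>w. prod_list (map Y w)" and ?X = "\<lambda>w. prod_list (map X w)"
    have M: "?Y w \<in> M" "?X w \<in> M" for w by (intro M_prod_list X Y)+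
    have bX: "cmod (\<tau> (?X w)) \<le> L ^ length w" for w
      by (rule order_trans[OF tau_bound[OF M(2)] mult_bound_norm2]) (intro mult_bound_word X L)
    have bY: "cmod (\<tau> (?Y w)) \<le> L ^ length w" for w
      by (rule order_trans[OF tau_bound[OF M(1)] mult_bound_norm2]) (intro mult_bound_word Y L)
    have wd: "mult_bound (r * (real (length w) * L ^ length w)) (?Y w - ?X w)" for w
      using X Y L r d by (intro mult_bound_word_diff)
    have df: "cmod (\<tau> (?Y w) - \<tau> (?X w)) \<le> r * (real (length w) * L ^ length w)" for w
      using tau_bound[of "?Y w - ?X w"] mult_bound_norm2[OF wd[of w]]
      by (simp add: M tau_diff)
    have pair: "cmod (\<tau> (?Y u) * \<tau> (?Y v) - \<tau> (?X u) * \<tau> (?X v)) \<le> r * k u v" for u v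
    proof -
      have "\<tau> (?Y u) * \<tau> (?Y v) - \<tau> (?X u) * \<tau> (?X v) =
          \<tau> (?Y u) * (\<tau> (?Y v) - \<tau> (?X v)) + (\<tau> (?Y u) - \<tau> (?X u)) * \<tau> (?X v)"
        by (simp add: algebra_simps)
      also have "cmod \<dots> \<le> cmod (\<tau> (?Y u) * (\<tau> (?Y v) - \<tau> (?X v))) +
          cmod ((\<tau> (?Y u) - \<tau> (?X u)) * \<tau> (?X v))"
        by (rule norm_triangle_ineq)
      also have "\<dots> \<le> L ^ length u * (r * (real (length v) * L ^ length v)) +
          r * (real (length u) * L ^ length u) * L ^ length v"
        unfolding norm_mult using L r
        by (intro add_mono mult_mono bX bY df) (auto intro!: mult_nonneg_nonneg)
      also have "\<dots> = r * k u v" by (simp add: k_def power_add algebra_simps)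
      finally show ?thesis .
    qed
    have "diff_pairing Y j q P - diff_pairing X j q P =
      (\<Sum>w\<in>Poly_Mapping.keys P. Poly_Mapping.lookup P w *
        (\<Sum>uv\<in>splits j w. \<tau> (?Y (fst uv)) * \<tau> (?Y (snd uv @ q)) - \<tau> (?X (fst uv)) * \<tau> (?X (snd uv @ q))))"
      unfolding diff_pairing_def lin_ext_def scaleC_complex_def case_prod_unfold
      by (simp only: sum_subtractf right_diff_distrib)
    also have "cmod \<dots> \<le> (\<Sum>w\<in>Poly_Mapping.keys P. cmod (Poly_Mapping.lookup P w) *
        (\<Sum>uv\<in>splits j w. r * k (fst uv) (snd uv @ q)))"
      by (intro order_trans[OF norm_sum] sum_mono, unfold norm_mult)
        (intro mult_left_mono norm_ge_zero order_trans[OF norm_sum] sum_mono pair)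
    also have "\<dots> = K * r"
      by (simp add: K_def sum_distrib_left sum_distrib_right mult_ac case_prod_unfold)
    finally show ?thesis .
  qed
  moreover have "0 \<le> K"
    unfolding K_def by (intro sum_nonneg mult_nonneg_nonneg) (auto intro: k0 sum_nonneg)
  ultimately show ?thesis by blast
qed

lemma nc_eval_near:
  assumes X: "\<And>i. X i \<in> M" "\<And>i. mult_bound L (X i)" and L: "1 \<le> L"
  shows "\<exists>K\<ge>0. \<forall>Y r. (\<forall>i. Y i \<in> M \<and> mult_bound L (Y i) \<and> mult_bound r (Y i - X i)) \<longrightarrow> 0 \<le> r \<longrightarrow>
    norm2 \<tau> (nc_eval Y P - nc_eval X P) \<le> K * r"
proof -
  define K where "K = (\<Sum>w\<in>Poly_Mapping.keys P. cmod (Poly_Mapping.lookup P w) *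
    (real (length w) * L ^ length w))"
  have "norm2 \<tau> (nc_eval Y P - nc_eval X P) \<le> K * r"
    if Y: "\<And>i. Y i \<in> M" "\<And>i. mult_bound L (Y i)" and d: "\<And>i. mult_bound r (Y i - X i)"
      and r: "0 \<le> r" for Y r
  proof -
    let ?Y = "\<lambda>w. prod_list (map Y w)" and ?X = "\<lambda>w. prod_list (map X w)"
    have M: "?Y w \<in> M" "?X w \<in> M" for w by (intro M_prod_list X Y)+
    have "nc_eval Y P - nc_eval X P =
        (\<Sum>w\<in>Poly_Mapping.keys P. Poly_Mapping.lookup P w *\<^sub>C (?Y w - ?X w))"
      by (simp add: nc_eval_def lin_ext_def sum_subtractf cvec.scale_right_diff_distrib)
    also have "norm2 \<tau> \<dots> \<le>
        (\<Sum>w\<in>Poly_Mapping.keys P. norm2 \<tau> (Poly_Mapping.lookup P w *\<^sub>C (?Y w - ?X w)))"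
      using M by (intro norm2_sum) auto
    also have "\<dots> \<le> (\<Sum>w\<in>Poly_Mapping.keys P. cmod (Poly_Mapping.lookup P w) *
        (r * (real (length w) * L ^ length w)))"
      using M by (intro sum_mono) (auto simp: norm2_scaleC intro!: mult_left_mono mult_bound_norm2
          mult_bound_word_diff X Y L r d)
    also have "\<dots> = K * r" by (simp add: K_def sum_distrib_left sum_distrib_right mult_ac)
    finally show ?thesis .
  qed
  moreover have "0 \<le> K" unfolding K_def using L by (intro sum_nonneg) auto
  ultimately show ?thesis by blast
qed

text \<open>If \<open>P(X) = 0\<close>, then \<open>P(Y)\<close> has 2-norm \<open>O(r)\<close> for \<open>Y\<close> at distance \<open>r\<close> from \<open>X\<close>, so in
  the conjugate relation for \<open>P q\<close> at \<open>Y\<close> every term but the pairing with \<open>\<partial>\<^sub>j P\<close> is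
  \<open>O(r (1 + \<parallel>\<xi>\<^sub>j\<parallel>\<^sub>2))\<close>.\<close>

lemma diff_pairing_estimate:
  fixes X :: "'n \<Rightarrow> 'h cop"
  assumes X: "\<And>i. X i \<in> M" "\<And>i. mult_bound L (X i)" and L: "1 \<le> L" and P: "nc_eval X P = 0"
  shows "\<exists>K. \<forall>Y r \<xi>. (\<forall>i. Y i \<in> M \<and> self_adjoint (Y i) \<and> mult_bound L (Y i) \<and> mult_bound r (Y i - X i)) \<longrightarrow>
    0 \<le> r \<longrightarrow> conjugate_system M \<tau> Y \<xi> \<longrightarrow>
    cmod (diff_pairing X j q P) \<le> K * (r * (1 + l2_norm \<tau> (\<xi> j)))"
proof -
  let ?near = "\<lambda>Y r. \<forall>i. Y i \<in> M \<and> mult_bound L (Y i) \<and> mult_bound r (Y i - X i)"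
  obtain K1 where K1: "0 \<le> K1" "\<forall>Y r. ?near Y r \<longrightarrow> 0 \<le> r \<longrightarrow>
      cmod (diff_pairing Y j q P - diff_pairing X j q P) \<le> K1 * r"
    using diff_pairing_near[where X = X and L = L and j = j and q = q and P = P, OF X L]
    by (elim exE conjE) (rule that)
  obtain K2 where K2: "0 \<le> K2" "\<forall>Y r. ?near Y r \<longrightarrow> 0 \<le> r \<longrightarrow>
      norm2 \<tau> (nc_eval Y P - nc_eval X P) \<le> K2 * r"
    using nc_eval_near[where X = X and L = L and P = P, OF X L]
    by (elim exE conjE) (rule that)
  define KB where "KB = (\<Sum>(u, v)\<in>splits j q. L ^ length u * L ^ length v)"
  have KB: "0 \<le> KB" unfolding KB_def using L by (intro sum_nonneg) auto
  define K where "K = K1 + K2 * KB + L ^ length q * K2"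
  have main: "cmod (diff_pairing X j q P) \<le> K * (r * (1 + l2_norm \<tau> (\<xi> j)))"
    if Y: "\<And>i. Y i \<in> M" "\<And>i. mult_bound L (Y i)" and sa: "\<And>i. self_adjoint (Y i)"
      and d: "\<And>i. mult_bound r (Y i - X i)"
      and r: "0 \<le> r" and \<xi>: "conjugate_system M \<tau> Y \<xi>" for Y r \<xi>
  proof -
    let ?Y = "\<lambda>w. prod_list (map Y w)"
    let ?B = "\<Sum>(u, v)\<in>splits j q. \<tau> (nc_eval Y P * ?Y u) * \<tau> (?Y v)"
    let ?T = "l2_tau M \<tau> (\<xi> j) (nc_eval Y P * ?Y q)"
    define x where "x = l2_norm \<tau> (\<xi> j)"
    have x: "0 \<le> x" unfolding x_def by (intro l2_norm_nonneg conjugate_system_L2[OF \<xi>])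
    have M: "?Y w \<in> M" for w by (intro M_prod_list Y)
    have PM: "nc_eval Y P \<in> M" by (intro M_nc_eval Y)
    have pn: "norm2 \<tau> (nc_eval Y P) \<le> K2 * r" using K2(2)[rule_format, of Y r] P Y d r by simp
    have b: "norm2 \<tau> (?Y w) \<le> L ^ length w" for w
      using Y L by (intro mult_bound_norm2 mult_bound_word)
    have "cmod ?B \<le> (\<Sum>uv\<in>splits j q. (K2 * r * L ^ length (fst uv)) * L ^ length (snd uv))"
      unfolding case_prod_unfold
    proof (intro order_trans[OF norm_sum] sum_mono, unfold norm_mult, intro mult_mono)
      fix uv :: "'n list \<times> 'n list"
      show "cmod (\<tau> (nc_eval Y P * ?Y (fst uv))) \<le> K2 * r * L ^ length (fst uv)"
        by (rule order_trans[OF tau_mult_bound[OF PM M]], intro mult_mono pn b)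
          (use K2(1) r norm2_nonneg[OF M] in auto)
      show "cmod (\<tau> (?Y (snd uv))) \<le> L ^ length (snd uv)"
        by (rule order_trans[OF tau_bound[OF M] b])
    qed (use K2(1) r L in auto)
    also have "\<dots> = K2 * KB * r"
      by (simp add: KB_def sum_distrib_left mult_ac case_prod_unfold)
    finally have B: "cmod ?B \<le> K2 * KB * r" .
    have "norm2 \<tau> (nc_eval Y P * ?Y q) \<le> L ^ length q * norm2 \<tau> (nc_eval Y P)"
      by (intro norm2_mult_word Y sa L PM)
    also have "\<dots> \<le> L ^ length q * (K2 * r)" using L pn by (intro mult_left_mono) auto
    finally have qn: "norm2 \<tau> (nc_eval Y P * ?Y q) \<le> L ^ length q * (K2 * r)" .
    have "cmod ?T \<le> x * norm2 \<tau> (nc_eval Y P * ?Y q)"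
      unfolding x_def by (intro l2_tau_bound conjugate_system_L2[OF \<xi>] M_mult PM M)
    also have "\<dots> \<le> x * (L ^ length q * (K2 * r))" by (rule mult_left_mono[OF qn x])
    also have "\<dots> = L ^ length q * K2 * (r * x)" by simp
    finally have T: "cmod ?T \<le> L ^ length q * K2 * (r * x)" .
    have near: "cmod (diff_pairing Y j q P - diff_pairing X j q P) \<le> K1 * r"
      using K1(2)[rule_format, of Y r] Y d r by simp
    have "diff_pairing X j q P = ?T - ?B - (diff_pairing Y j q P - diff_pairing X j q P)"
      using conjugate_relation_Leibniz[OF Y(1) \<xi>, of j P q] by simp
    then have "cmod (diff_pairing X j q P) =
        cmod (?T - ?B - (diff_pairing Y j q P - diff_pairing X j q P))" by (rule arg_cong)
    also have "\<dots> \<le> cmod (?T - ?B) + cmod (diff_pairing Y j q P - diff_pairing X j q P)"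
      by (rule norm_triangle_ineq4)
    also have "\<dots> \<le> cmod ?T + cmod ?B + cmod (diff_pairing Y j q P - diff_pairing X j q P)"
      by (intro add_right_mono norm_triangle_ineq4)
    also have "\<dots> \<le> L ^ length q * K2 * (r * x) + K2 * KB * r + K1 * r"
      by (intro add_mono T B near)
    also have "\<dots> \<le> K * (r * (1 + x))"
    proof -
      have "0 \<le> L ^ length q * K2 * r + K2 * KB * (r * x) + K1 * (r * x)"
        using L K1(1) K2(1) KB r x by (intro add_nonneg_nonneg mult_nonneg_nonneg) auto
      then show ?thesis by (simp add: K_def algebra_simps)
    qed
    finally show ?thesis by (simp add: x_def)
  qed
  show ?thesis by (intro exI[of _ K] allI impI, rule main) auto
qed

text \<open>The polynomial \<open>(\<tau> \<circ> ev\<^sub>X \<otimes> id) (\<partial>\<^sub>j P)\<close>.\<close>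

definition slice_diff :: "('n \<Rightarrow> 'h cop) \<Rightarrow> 'n \<Rightarrow> 'n ncpoly \<Rightarrow> 'n ncpoly" where
  "slice_diff X j = lin_ext (\<lambda>w. \<Sum>(u, v)\<in>splits j w. \<tau> (prod_list (map X u)) *\<^sub>C basis v)"

text \<open>The pairing with \<open>q\<close> is \<open>\<tau>(R(X) q(X))\<close> for \<open>R = slice_diff X j P\<close>, and \<open>R(X)\<^sup>*\<close> is a combination of
  words in \<open>X\<close>, so \<open>\<tau>(R(X) R(X)\<^sup>*) = 0\<close>.\<close>

lemma nc_eval_slice_diff_eq_0:
  fixes X :: "'n \<Rightarrow> 'h cop"
  assumes X: "\<And>i. X i \<in> M" "\<And>i. self_adjoint (X i)" and zero: "\<And>q. diff_pairing X j q P = 0"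
  shows "nc_eval X (slice_diff X j P) = 0"
proof -
  let ?X = "\<lambda>w. prod_list (map X w)"
  have M: "?X w \<in> M" for w by (intro M_prod_list X)
  define R where "R = slice_diff X j P"
  have RM: "nc_eval X R \<in> M" by (intro M_nc_eval X)
  have orth: "\<tau> (nc_eval X R * ?X q) = 0" for q
  proof -
    let ?f = "\<lambda>w. \<Sum>(u, v)\<in>splits j w. \<tau> (?X u) *\<^sub>C (?X v * ?X q)"
    have lin: "clinear (\<lambda>a. a * ?X q)" by (rule clinearI) (simp_all add: distrib_right)
    have "nc_eval X R * ?X q = lin_ext ?f P"
      unfolding R_def slice_diff_def clinear_of_lin_ext[OF clinear_nc_eval] clinear_of_lin_ext[OF lin]
      by (simp add: clinear_sum[OF clinear_nc_eval] clinear_scale[OF clinear_nc_eval]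
          sum_distrib_right case_prod_unfold)
    moreover have fM: "?f w \<in> M" for w using M by (intro M_sum) auto
    moreover have "\<tau> (?f w) = (\<Sum>(u, v)\<in>splits j w. \<tau> (?X u) * \<tau> (?X (v @ q)))" for w
      using M by (subst tau_sum) (auto simp: tau_scaleC case_prod_unfold)
    ultimately have "\<tau> (nc_eval X R * ?X q) = diff_pairing X j q P"
      by (simp add: tau_lin_ext[OF fM]) (simp add: diff_pairing_def lin_ext_def scaleC_complex_def)
    then show ?thesis by (simp add: zero)
  qed
  have adj_sum: "adj (sum f I) = (\<Sum>i\<in>I. adj (f i))" for f :: "'n list \<Rightarrow> 'h cop" and I
    by (induction I rule: infinite_finite_induct) auto
  have "adj (nc_eval X R) =
      (\<Sum>w\<in>Poly_Mapping.keys R. cnj (Poly_Mapping.lookup R w) *\<^sub>C ?X (rev w))"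
    by (simp add: nc_eval_def lin_ext_def adj_sum adj_word X)
  then have "\<tau> (nc_eval X R * adj (nc_eval X R)) = 0"
    using RM M by (simp add: sum_distrib_left tau_sum tau_scaleC orth)
  then have "norm2 \<tau> (nc_eval X R) = 0" by (simp add: norm2_def)
  with RM show ?thesis unfolding R_def by (intro norm2_eq_0)
qed

text \<open>The first letter of a word of maximal length can be stripped: only the factorization with
  \<open>u\<close> empty reaches a word of length one less.\<close>

lemma lookup_slice_diff:
  assumes len: "\<forall>w\<in>Poly_Mapping.keys P. length w \<le> Suc m" and v: "length v = m"
  shows "Poly_Mapping.lookup (slice_diff X j P) v = Poly_Mapping.lookup P (j # v)"
proof -
  have lin: "clinear (\<lambda>p. Poly_Mapping.lookup p v)"
    by (rule clinearI) (simp_all add: lookup_add lookup_scaleC)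
  let ?g = "\<lambda>w. \<Sum>(u, v')\<in>splits j w. \<tau> (prod_list (map X u)) * (1 when v' = v)"
  have g: "?g w = (1 when w = j # v)" if "length w \<le> Suc m" for w
  proof (cases w)
    case (Cons x w')
    have "(\<Sum>(u, v')\<in>splits j w'. \<tau> (prod_list (map X (x # u))) * (1 when v' = v)) = 0"
      by (rule sum.neutral) (use that Cons v in \<open>auto simp: splits_def when_def\<close>)
    then show ?thesis
      unfolding Cons sum_splits_Cons by (auto simp: when_def)
  qed simp
  have "Poly_Mapping.lookup (slice_diff X j P) v = lin_ext ?g P"
    unfolding slice_diff_def clinear_of_lin_ext[OF lin]
    by (simp add: clinear_sum[OF lin] case_prod_unfold lookup_scaleC scaleC_complex_def lookup_single)
  also have "\<dots> = (\<Sum>w\<in>Poly_Mapping.keys P. Poly_Mapping.lookup P w * (1 when w = j # v))"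
    unfolding lin_ext_def scaleC_complex_def by (intro sum.cong refl) (use len g in auto)
  also have "\<dots> = Poly_Mapping.lookup P (j # v)"
    by (simp add: when_def in_keys_iff if_distrib cong: if_cong)
  finally show ?thesis .
qed

lemma keys_slice_diff:
  assumes len: "\<forall>w\<in>Poly_Mapping.keys P. length w \<le> Suc m"
  shows "\<forall>v\<in>Poly_Mapping.keys (slice_diff X j P). length v \<le> m"
proof (rule ccontr)
  assume "\<not> ?thesis"
  then obtain v where v: "v \<in> Poly_Mapping.keys (slice_diff X j P)" "length v > m" by auto
  have "\<forall>w\<in>Poly_Mapping.keys P. length w \<le> Suc (length v)" using len v(2) by fastforce
  then have "Poly_Mapping.lookup (slice_diff X j P) v = Poly_Mapping.lookup P (j # v)"
    by (rule lookup_slice_diff) simp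
  moreover have "j # v \<notin> Poly_Mapping.keys P" using len v(2) by fastforce
  ultimately show False using v(1) by (simp add: in_keys_iff)
qed

lemma no_relation_of_slice_diff:
  assumes slice: "\<And>P j. nc_eval X P = 0 \<Longrightarrow> nc_eval X (slice_diff X j P) = 0"
    and P: "nc_eval X P = 0"
  shows "P = 0"
proof -
  have "P = 0" if "\<forall>w\<in>Poly_Mapping.keys P. length w \<le> m" "nc_eval X P = 0" for m P
    using that
  proof (induction m arbitrary: P)
    case 0
    then have "Poly_Mapping.keys P \<subseteq> {[]}" by auto
    then have "nc_eval X P = Poly_Mapping.lookup P [] *\<^sub>C 1"
      unfolding nc_eval_def by (subst lin_ext_superset[of "{[]}"]) auto
    then have "Poly_Mapping.lookup P [] *\<^sub>C (1 :: 'h cop) = 0" using 0(2) by (simp only:)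
    then have "\<tau> (Poly_Mapping.lookup P [] *\<^sub>C 1) = 0" by (simp only: tau_zero)
    then have "Poly_Mapping.lookup P [] = 0" by (simp add: tau_scaleC)
    with \<open>Poly_Mapping.keys P \<subseteq> {[]}\<close> show ?case
      by (intro poly_mapping_eqI) (auto simp: in_keys_iff)
  next
    case (Suc m)
    have "slice_diff X j P = 0" for j
      using keys_slice_diff[OF Suc.prems(1)] slice[OF Suc.prems(2)] by (intro Suc.IH)
    then have top: "Poly_Mapping.lookup P (j # v) = 0" if "length v = m" for j v
      using lookup_slice_diff[OF Suc.prems(1) that] by (metis lookup_zero)
    have "length w \<le> m" if w: "w \<in> Poly_Mapping.keys P" for w
    proof (rule ccontr)
      assume "\<not> length w \<le> m"
      then have "length w = Suc m" using Suc.prems(1) w by fastforce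
      then obtain j v where "w = j # v" "length v = m" by (auto simp: length_Suc_conv)
      then show False using top w by (simp add: in_keys_iff)
    qed
    with Suc.prems show ?case by (intro Suc.IH) auto
  qed
  moreover have "\<exists>m. \<forall>w\<in>Poly_Mapping.keys P. length w \<le> m"
    by (rule exI[of _ "Max (length ` Poly_Mapping.keys P)"]) simp
  ultimately show ?thesis using P by blast
qed

text \<open>Absence of relations follows if \<open>X\<close> has perturbations \<open>Y\<close>, arbitrarily close, with conjugate
  systems of 2-norm small compared to the inverse of the distance \<open>r\<close>.\<close>

lemma no_relation:
  assumes X: "\<And>i. X i \<in> M" "\<And>i. self_adjoint (X i)" "\<And>i. mult_bound L (X i)" and L: "1 \<le> L"
    and near: "\<And>e. 0 < e \<Longrightarrow> \<exists>Y r \<xi>. (\<forall>i. Y i \<in> M \<and> self_adjoint (Y i) \<and> mult_bound L (Y i) \<and>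
      mult_bound r (Y i - X i)) \<and> 0 \<le> r \<and> conjugate_system M \<tau> Y \<xi> \<and>
      (\<forall>j. r * (1 + l2_norm \<tau> (\<xi> j)) < e)"
    and P: "nc_eval X P = 0"
  shows "P = 0"
proof (rule no_relation_of_slice_diff[OF _ P])
  fix P j assume P: "nc_eval X P = 0"
  have "diff_pairing X j q P = 0" for q
  proof -
    obtain K where K: "\<And>Y r \<xi>. (\<forall>i. Y i \<in> M \<and> self_adjoint (Y i) \<and> mult_bound L (Y i) \<and>
        mult_bound r (Y i - X i)) \<Longrightarrow> 0 \<le> r \<Longrightarrow> conjugate_system M \<tau> Y \<xi> \<Longrightarrow>
        cmod (diff_pairing X j q P) \<le> K * (r * (1 + l2_norm \<tau> (\<xi> j)))"
      using diff_pairing_estimate[OF X(1,3) L P, where ?j = j and ?q = q] by blast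
    have "cmod (diff_pairing X j q P) \<le> 0 + d" if d: "0 < d" for d
    proof -
      have "0 < d / (\<bar>K\<bar> + 1)" using d by simp
      then obtain Y r \<xi> where Y: "\<forall>i. Y i \<in> M \<and> self_adjoint (Y i) \<and> mult_bound L (Y i) \<and>
          mult_bound r (Y i - X i)" "0 \<le> r" "conjugate_system M \<tau> Y \<xi>"
        and small: "r * (1 + l2_norm \<tau> (\<xi> j)) < d / (\<bar>K\<bar> + 1)"
        using near by meson
      have nn: "0 \<le> r * (1 + l2_norm \<tau> (\<xi> j))"
        using Y(2) l2_norm_nonneg[OF conjugate_system_L2[OF Y(3)], of j] by simp
      have "cmod (diff_pairing X j q P) \<le> K * (r * (1 + l2_norm \<tau> (\<xi> j)))" by (rule K[OF Y])
      also have "\<dots> \<le> (\<bar>K\<bar> + 1) * (r * (1 + l2_norm \<tau> (\<xi> j)))"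
        using nn by (intro mult_right_mono) auto
      also have "\<dots> \<le> d" using small by (simp add: field_simps)
      finally show ?thesis by simp
    qed
    then have "cmod (diff_pairing X j q P) \<le> 0" by (rule field_le_epsilon)
    then show ?thesis by simp
  qed
  then show "nc_eval X (slice_diff X j P) = 0" by (intro nc_eval_slice_diff_eq_0 X)
qed

end

section \<open>Semicircular perturbations\<close>

lemma continuous_on_semicircle: "continuous_on {-2..2} (\<lambda>x. x ^ k * sqrt (4 - x\<^sup>2) :: real)"
  by (intro continuous_intros)

lemma semicircle_first_moment: "integral {-2..2} (\<lambda>x. x ^ 1 * sqrt (4 - x\<^sup>2)) = (0 :: real)"
proof -
  \<comment> \<open>\<open>F\<close> is an antiderivative of the integrand.\<close>
  define F where "F x = - ((4 - x\<^sup>2) * sqrt (4 - x\<^sup>2)) / 3" for x :: real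
  have "((\<lambda>x. x ^ 1 * sqrt (4 - x\<^sup>2)) has_integral F 2 - F (- 2)) {-2..2}"
  proof (rule fundamental_theorem_of_calculus_interior)
    show "continuous_on {-2..2} F" unfolding F_def by (intro continuous_intros) auto
    fix x :: real assume "x \<in> {-2<..<2}"
    then have pos: "0 < 4 - x\<^sup>2" using abs_square_less_1[of "x / 2"] by (auto simp: power_divide)
    have "(F has_real_derivative x ^ 1 * sqrt (4 - x\<^sup>2)) (at x)"
      unfolding F_def using pos real_sqrt_mult_self[of "4 - x\<^sup>2"]
      by (auto intro!: derivative_eq_intros simp: field_simps power2_eq_square)
    then show "(F has_vector_derivative x ^ 1 * sqrt (4 - x\<^sup>2)) (at x)"
      by (simp add: has_real_derivative_iff_has_vector_derivative)
  qed simp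
  then show ?thesis by (simp add: F_def integral_unique)
qed

lemma semicircle_second_moment:
  "integral {-2..2} (\<lambda>x. x\<^sup>2 * sqrt (4 - x\<^sup>2)) = integral {-2..2} (\<lambda>x. x ^ 0 * sqrt (4 - x\<^sup>2) :: real)"
proof -
  \<comment> \<open>The derivative of \<open>F\<close> is the difference of the two integrands.\<close>
  define F where "F x = x * ((4 - x\<^sup>2) * sqrt (4 - x\<^sup>2)) / 4" for x :: real
  have int: "((\<lambda>x. x ^ 0 * sqrt (4 - x\<^sup>2) - x\<^sup>2 * sqrt (4 - x\<^sup>2)) has_integral F 2 - F (- 2)) {-2..2}"
  proof (rule fundamental_theorem_of_calculus_interior)
    show "continuous_on {-2..2} F" unfolding F_def by (intro continuous_intros) auto
    fix x :: real assume "x \<in> {-2<..<2}"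
    then have pos: "0 < 4 - x\<^sup>2" using abs_square_less_1[of "x / 2"] by (auto simp: power_divide)
    have eq: "(4 - x\<^sup>2) / sqrt (4 - x\<^sup>2) = sqrt (4 - x\<^sup>2)" using pos by (simp add: real_div_sqrt)
    have "(F has_real_derivative
        ((4 - x\<^sup>2) * sqrt (4 - x\<^sup>2) + x * ((- 2 * x) * sqrt (4 - x\<^sup>2) +
          (- x) * ((4 - x\<^sup>2) / sqrt (4 - x\<^sup>2)))) / 4) (at x)"
      unfolding F_def using pos
      by (auto intro!: derivative_eq_intros simp: field_simps)
    also have "((4 - x\<^sup>2) * sqrt (4 - x\<^sup>2) + x * ((- 2 * x) * sqrt (4 - x\<^sup>2) +
          (- x) * ((4 - x\<^sup>2) / sqrt (4 - x\<^sup>2)))) / 4 = x ^ 0 * sqrt (4 - x\<^sup>2) - x\<^sup>2 * sqrt (4 - x\<^sup>2)"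
      unfolding eq by (simp add: field_simps power2_eq_square)
    finally show "(F has_vector_derivative x ^ 0 * sqrt (4 - x\<^sup>2) - x\<^sup>2 * sqrt (4 - x\<^sup>2)) (at x)"
      by (simp add: has_real_derivative_iff_has_vector_derivative)
  qed simp
  have "integral {-2..2} (\<lambda>x. x ^ 0 * sqrt (4 - x\<^sup>2) - x\<^sup>2 * sqrt (4 - x\<^sup>2) :: real) = 0"
    using int by (simp add: F_def integral_unique)
  moreover have "integral {-2..2} (\<lambda>x. x ^ 0 * sqrt (4 - x\<^sup>2) - x\<^sup>2 * sqrt (4 - x\<^sup>2) :: real) =
      integral {-2..2} (\<lambda>x. x ^ 0 * sqrt (4 - x\<^sup>2)) - integral {-2..2} (\<lambda>x. x\<^sup>2 * sqrt (4 - x\<^sup>2))"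
    by (intro integral_diff integrable_continuous_real continuous_on_semicircle)
  ultimately show ?thesis by simp
qed

lemma semicircle_even_moment:
  "integral {-2..2} (\<lambda>x. x ^ (2 * k) * sqrt (4 - x\<^sup>2)) \<le>
    (2 ^ k)\<^sup>2 * integral {-2..2} (\<lambda>x. x ^ 0 * sqrt (4 - x\<^sup>2) :: real)"
proof -
  have "x ^ (2 * k) * sqrt (4 - x\<^sup>2) \<le> (2 ^ k)\<^sup>2 * (x ^ 0 * sqrt (4 - x\<^sup>2))"
    if "x \<in> {-2..2}" for x :: real
  proof -
    have x2: "x\<^sup>2 \<le> 4" using that abs_le_square_iff[of x 2] by auto
    then have "(x\<^sup>2) ^ k \<le> 4 ^ k" by (intro power_mono) auto
    moreover have "(4 :: real) ^ k = (2 ^ k)\<^sup>2" 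
      by (simp only: power_even_eq[symmetric] power_mult) simp
    ultimately show ?thesis using x2 by (simp add: power_mult mult_right_mono)
  qed
  then have "integral {-2..2} (\<lambda>x. x ^ (2 * k) * sqrt (4 - x\<^sup>2)) \<le>
      integral {-2..2} (\<lambda>x. (2 ^ k)\<^sup>2 * (x ^ 0 * sqrt (4 - x\<^sup>2)) :: real)"
    by (intro integral_le integrable_continuous_real continuous_intros)
  then show ?thesis by simp
qed

context tracial
begin

lemma semicircularD:
  assumes "semicircular M \<tau> s"
  shows "s \<in> M" "self_adjoint s"
    and "\<tau> (s ^ k) = complex_of_real (1 / (2 * pi) * integral {-2..2} (\<lambda>x. x ^ k * sqrt (4 - x\<^sup>2)))"
  using assms by (auto simp: semicircular_def)

text \<open>The area of the half disk is read off from \<open>\<tau> 1 = 1\<close>.\<close>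

lemma semicircle_area:
  assumes "semicircular M \<tau> s"
  shows "integral {-2..2} (\<lambda>x. x ^ 0 * sqrt (4 - x\<^sup>2)) = 2 * pi"
proof -
  have "complex_of_real 1 =
      complex_of_real (1 / (2 * pi) * integral {-2..2} (\<lambda>x. x ^ 0 * sqrt (4 - x\<^sup>2)))"
    using semicircularD(3)[OF assms, of 0] by simp
  then have "1 = 1 / (2 * pi) * integral {-2..2} (\<lambda>x. x ^ 0 * sqrt (4 - x\<^sup>2))"
    unfolding of_real_eq_iff .
  then show ?thesis by (simp add: field_simps)
qed

lemma semicircular_mean: "semicircular M \<tau> s \<Longrightarrow> \<tau> s = 0"
  using semicircularD(3)[of s 1] semicircle_first_moment by simp

lemma semicircular_variance: "semicircular M \<tau> s \<Longrightarrow> \<tau> (s * s) = 1"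
  using semicircularD(3)[of s 2] semicircle_second_moment semicircle_area[of s]
  by (simp add: power2_eq_square)

lemma semicircular_mult_bound:
  assumes s: "semicircular M \<tau> s"
  shows "mult_bound 2 s"
  unfolding mult_bound_def
proof
  fix x assume x: "x \<in> M"
  show "norm2 \<tau> (s * x) \<le> 2 * norm2 \<tau> x"
  proof (rule norm2_left_bound_of_moments[OF semicircularD(1,2)[OF s]])
    fix k
    have "Re (\<tau> (s ^ (2 * k))) = 1 / (2 * pi) * integral {-2..2} (\<lambda>x. x ^ (2 * k) * sqrt (4 - x\<^sup>2))"
      using semicircularD(3)[OF s, of "2 * k"] by simp
    also have "\<dots> \<le> 1 / (2 * pi) * ((2 ^ k)\<^sup>2 * (2 * pi))"
      using semicircle_even_moment[of k] unfolding semicircle_area[OF s]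
      by (intro mult_left_mono) auto
    also have "\<dots> = (2 ^ k)\<^sup>2" by simp
    finally show "Re (\<tau> (s ^ (2 * k))) \<le> (2 ^ k)\<^sup>2" .
  qed (use x in auto)
qed

lemma free_semicircularsD:
  assumes "free_semicirculars M \<tau> Y S"
  shows "semicircular M \<tau> (S j)"
    and "freely_independent \<tau> (case_option (range Y) (\<lambda>j. {S j}))"
  using assms by (auto simp: free_semicirculars_def)

lemma free_semicircular_uncorrelated:
  assumes Y: "\<And>i. Y i \<in> M" and S: "free_semicirculars M \<tau> Y S"
  shows "\<tau> (Y i * S j) = 0"
proof -
  note s = free_semicircularsD(1)[OF S, of j]
  have sM: "S j \<in> M" by (rule semicircularD(1)[OF s])
  define a where "a = Y i + (- \<tau> (Y i)) *\<^sub>C 1"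
  have a0: "\<tau> a = 0" using Y by (simp add: a_def tau_add tau_scaleC del: cvec.scale_minus_left)
  have "a \<in> generated_algebra (range Y)"
    unfolding a_def by (intro generated_algebra.intros) auto
  moreover have "S j \<in> generated_algebra {S j}" by (intro generated_algebra.intros) auto
  ultimately have "\<tau> (prod_list [a, S j]) = 0"
    using free_semicircularsD(2)[OF S, unfolded freely_independent_def, rule_format,
        of "[a, S j]" "[None, Some j]"] a0 semicircular_mean[OF s] by simp
  moreover have "a * S j = Y i * S j + (- \<tau> (Y i)) *\<^sub>C S j"
    by (simp add: a_def distrib_right del: cvec.scale_minus_left)
  ultimately show ?thesis
    using Y sM by (simp add: tau_add tau_scaleC semicircular_mean[OF s] del: cvec.scale_minus_left)
qed

lemma perturb_in_M:
  "(\<And>i. Y i \<in> M) \<Longrightarrow> free_semicirculars M \<tau> Y S \<Longrightarrow> perturb Y t S j \<in> M"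
  using semicircularD(1)[OF free_semicircularsD(1), of Y S j] by (auto simp: perturb_def)

lemma self_adjoint_perturb:
  "(\<And>i. self_adjoint (Y i)) \<Longrightarrow> free_semicirculars M \<tau> Y S \<Longrightarrow> self_adjoint (perturb Y t S j)"
  using semicircularD(2)[OF free_semicircularsD(1)]
  by (auto simp: perturb_def self_adjoint_def)

text \<open>Freeness makes \<open>Y\<^sub>j\<close> and \<open>S\<^sub>j\<close> orthogonal.\<close>

lemma norm2_perturb:
  assumes Y: "\<And>i. Y i \<in> M" "\<And>i. self_adjoint (Y i)" and S: "free_semicirculars M \<tau> Y S"
    and t: "0 \<le> t"
  shows "(norm2 \<tau> (perturb Y t S j))\<^sup>2 = (norm2 \<tau> (Y j))\<^sup>2 + t"
proof -
  note s = free_semicircularsD(1)[OF S, of j]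
  note sM = semicircularD(1)[OF s]
  have sa: "adj (Y j) = Y j" "adj (S j) = S j"
    using Y semicircularD(2)[OF s] by (auto simp: self_adjoint_def)
  have YS: "\<tau> (Y j * S j) = 0" "\<tau> (S j * Y j) = 0"
    using free_semicircular_uncorrelated[OF Y(1) S] tau_commute[OF Y(1)[of j] sM] by auto
  let ?c = "complex_of_real (sqrt t)"
  have "\<tau> (perturb Y t S j * adj (perturb Y t S j)) =
      \<tau> (Y j * Y j + ?c *\<^sub>C (Y j * S j) + (?c *\<^sub>C (S j * Y j) + (?c * ?c) *\<^sub>C (S j * S j)))"
    by (simp add: perturb_def sa distrib_left distrib_right scaleC_add_right scaleC_scaleC add_ac)
  also have "\<dots> = \<tau> (Y j * Y j) + ?c * ?c"
    using Y sM YS by (simp add: tau_add tau_scaleC semicircular_variance[OF s])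
  also have "?c * ?c = complex_of_real t" using t by (simp flip: of_real_mult)
  finally show ?thesis
    using perturb_in_M[OF Y(1) S] Y by (simp add: norm2_power2 sa)
qed

section \<open>Fisher information and entropy\<close>

text \<open>The Cramer-Rao inequality: \<open>\<tau>(\<xi>\<^sub>j Z\<^sub>j) = 1\<close>.\<close>

lemma Cramer_Rao:
  assumes Z: "\<And>i. Z i \<in> M" and \<xi>: "conjugate_system M \<tau> Z \<xi>"
  shows "1 \<le> l2_norm \<tau> (\<xi> j) * norm2 \<tau> (Z j)"
proof -
  have "l2_tau M \<tau> (\<xi> j) (Z j) = tau2 M \<tau> (nc_eval2 Z (free_diff j (basis [j])))"
    using conjugate_system_eq[OF \<xi>, of j "basis [j]"] by simp
  also have "\<dots> = 1"
    using tau2_free_diff[where X = Z, OF Z] by (simp add: sum_splits_Cons)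
  finally show ?thesis
    using l2_tau_bound[OF conjugate_system_L2[OF \<xi>] Z, of j j] by simp
qed

lemma free_fisher_cases:
  fixes Z :: "'n::finite \<Rightarrow> 'h cop"
  obtains "free_fisher M \<tau> Z = \<infinity>"
  | \<xi> where "conjugate_system M \<tau> Z \<xi>" "free_fisher M \<tau> Z = ereal (\<Sum>j\<in>UNIV. (l2_norm \<tau> (\<xi> j))\<^sup>2)"
proof (cases "\<exists>\<xi>. conjugate_system M \<tau> Z \<xi>")
  case True
  then have "conjugate_system M \<tau> Z (SOME \<xi>. conjugate_system M \<tau> Z \<xi>)" by (rule someI_ex)
  then show ?thesis using that(2) True by (simp add: free_fisher_def)
next
  case False
  then show ?thesis using that(1) by (simp add: free_fisher_def)
qed

lemma free_fisher_lower_bound: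
  fixes Z :: "'n::finite \<Rightarrow> 'h cop"
  assumes Z: "\<And>i. Z i \<in> M" and C: "0 < C" "\<And>i. (norm2 \<tau> (Z i))\<^sup>2 \<le> C"
  shows "ereal (CARD('n) / C) \<le> free_fisher M \<tau> Z"
proof (cases rule: free_fisher_cases[of Z])
  case (2 \<xi>)
  have "1 / C \<le> (l2_norm \<tau> (\<xi> j))\<^sup>2" for j
  proof -
    have "1 \<le> (l2_norm \<tau> (\<xi> j) * norm2 \<tau> (Z j))\<^sup>2"
      using Cramer_Rao[OF Z 2(1)] by (rule one_le_power)
    also have "\<dots> \<le> (l2_norm \<tau> (\<xi> j))\<^sup>2 * C"
      unfolding power_mult_distrib by (intro mult_left_mono C) simp
    finally show ?thesis using C(1) by (simp add: field_simps)
  qed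
  then have "(\<Sum>j\<in>(UNIV :: 'n set). 1 / C) \<le> (\<Sum>j\<in>UNIV. (l2_norm \<tau> (\<xi> j))\<^sup>2)"
    by (intro sum_mono)
  then show ?thesis by (simp add: 2(2))
qed simp

end

text \<open>The function \<open>f\<close> need not be measurable: the nonnegative integral is a supremum over simple functions
  below the integrand, and only its monotonicity is used.\<close>

lemma ereal_integral_upper_bound:
  assumes K: "0 \<le> K" and pos: "\<And>t. 0 < t \<Longrightarrow> f t \<le> ereal (K / (1 + t)\<^sup>2)"
    and d: "0 \<le> d" "0 < \<epsilon>" "0 < h"
    and neg: "\<And>t. 0 < t \<Longrightarrow> t \<le> h \<Longrightarrow> f t \<le> ereal (- (d / (\<epsilon> + t)))"
  shows "ereal_integral f \<le> ereal (K - d * (ln (\<epsilon> + h) - ln \<epsilon>))"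
proof -
  have "e2ennreal (f t) \<le> ennreal (K / (1 + t)\<^sup>2)" if "0 < t" for t
    using e2ennreal_mono[OF pos[OF that]] by (simp add: e2ennreal_ereal)
  then have "(\<integral>\<^sup>+t\<in>{0<..}. e2ennreal (f t) \<partial>lborel) \<le>
      (\<integral>\<^sup>+t. ennreal (K / (1 + t)\<^sup>2) * indicator {0..} t \<partial>lborel)"
    by (intro nn_integral_mono) (simp add: indicator_def)
  also have "\<dots> = ennreal (0 - (- K / (1 + 0)))"
  proof (rule nn_integral_FTC_atLeast)
    show "((\<lambda>t. - K / (1 + t)) has_real_derivative K / (1 + t)\<^sup>2) (at t)" if "0 \<le> t" for t
      using that by (auto intro!: derivative_eq_intros simp: power2_eq_square)
    show "((\<lambda>t. - K / (1 + t)) \<longlongrightarrow> 0) at_top"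
      by (intro tendsto_divide_0[OF tendsto_const] filterlim_at_top_imp_at_infinity
          filterlim_tendsto_add_at_top[OF tendsto_const filterlim_ident])
  qed (use K in auto)
  finally have P: "enn2ereal (\<integral>\<^sup>+t\<in>{0<..}. e2ennreal (f t) \<partial>lborel) \<le> ereal K"
    using K by (simp add: less_eq_ennreal.rep_eq enn2ereal_ennreal)
  have deriv: "((\<lambda>t. d * ln (\<epsilon> + t)) has_real_derivative d / (\<epsilon> + t)) (at t)" if "0 \<le> t" for t
    using that d by (auto intro!: derivative_eq_intros)
  have "(\<integral>\<^sup>+t. ennreal (d / (\<epsilon> + t)) * indicator {0..h} t \<partial>lborel) =
      ennreal (d * ln (\<epsilon> + h) - d * ln (\<epsilon> + 0))"
    by (rule nn_integral_FTC_Icc) (use d in \<open>auto intro: deriv\<close>)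
  then have "ennreal (d * ln (\<epsilon> + h) - d * ln (\<epsilon> + 0)) =
      (\<integral>\<^sup>+t. ennreal (d / (\<epsilon> + t)) * indicator {0..h} t \<partial>lborel)" by (rule sym)
  also have "\<dots> \<le> (\<integral>\<^sup>+t\<in>{0<..}. e2ennreal (- f t) \<partial>lborel)"
  proof (rule nn_integral_mono_AE)
    have "e2ennreal (ereal (d / (\<epsilon> + t))) \<le> e2ennreal (- f t)" if "0 < t" "t \<le> h" for t
      using neg[OF that] by (intro e2ennreal_mono) (cases "f t"; simp)
    then have "ennreal (d / (\<epsilon> + t)) * indicator {0..h} t \<le> e2ennreal (- f t) * indicator {0<..} t"
      if "t \<noteq> 0" for t
      using that by (auto simp: indicator_def e2ennreal_ereal)
    moreover have "AE t in lborel. t \<noteq> (0 :: real)" by (rule AE_lborel_singleton)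
    ultimately show "AE t in lborel. ennreal (d / (\<epsilon> + t)) * indicator {0..h} t
        \<le> e2ennreal (- f t) * indicator {0<..} t" by auto
  qed
  finally have "ennreal (d * (ln (\<epsilon> + h) - ln \<epsilon>)) \<le> (\<integral>\<^sup>+t\<in>{0<..}. e2ennreal (- f t) \<partial>lborel)"
    by (simp add: right_diff_distrib)
  moreover have "0 \<le> d * (ln (\<epsilon> + h) - ln \<epsilon>)" using d by simp
  ultimately have N: "ereal (d * (ln (\<epsilon> + h) - ln \<epsilon>)) \<le>
      enn2ereal (\<integral>\<^sup>+t\<in>{0<..}. e2ennreal (- f t) \<partial>lborel)"
    by (simp add: less_eq_ennreal.rep_eq enn2ereal_ennreal)
  show ?thesis
    unfolding ereal_integral_def using ereal_minus_mono[OF P N] by simp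
qed

lemma ereal_le_divide_neg:
  assumes "b < 0" "x \<le> ereal (a * b)"
  shows "ereal a \<le> x / ereal b"
  using assms by (cases x) (auto simp: field_simps ereal_divide)

section \<open>Full entropy dimension bounds the Fisher information\<close>

context tracial
begin

text \<open>If \<open>\<Phi>\<^sup>* \<ge> c / (\<epsilon> + t)\<close> for \<open>t \<le> h\<close>, then the entropy is at most \<open>(c / 4) ln \<epsilon> + O(1)\<close>.  The
  Cramer-Rao inequality bounds the positive part of the integrand by \<open>n C / (1 + t)\<^sup>2\<close>.  The
  bound on \<open>h\<close> ensures that \<open>n / (1 + t)\<close> uses up at most half of \<open>c / (\<epsilon> + t)\<close>.\<close>

lemma free_entropy_upper_bound:
  fixes Y :: "'n::finite \<Rightarrow> 'h cop"
  assumes Y: "\<And>i. Y i \<in> M" "\<And>i. self_adjoint (Y i)" and C: "1 \<le> C" "\<And>i. (norm2 \<tau> (Y i))\<^sup>2 \<le> C"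
    and ex: "\<exists>S. free_semicirculars M \<tau> Y S"
    and c: "0 < c" "0 < \<epsilon>" "\<epsilon> \<le> h" "h \<le> c / (4 * CARD('n))"
    and \<Phi>: "\<And>t S. 0 < t \<Longrightarrow> t \<le> h \<Longrightarrow> free_semicirculars M \<tau> Y S \<Longrightarrow>
      ereal (c / (\<epsilon> + t)) \<le> free_fisher M \<tau> (perturb Y t S)"
  shows "free_entropy M \<tau> Y \<le> ereal (1 / 2 * (real CARD('n) * C - c / 2 * (ln h - ln \<epsilon>)) +
    real CARD('n) / 2 * ln (2 * pi * exp 1))"
proof -
  define n where "n = real CARD('n)"
  have n: "1 \<le> n" by (simp add: n_def Suc_leI)
  define S where "S = (SOME S. free_semicirculars M \<tau> Y S)"
  have S: "free_semicirculars M \<tau> Y S" unfolding S_def using ex by (rule someI_ex)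
  define f where "f t = ereal (n / (1 + t)) - free_fisher M \<tau> (perturb Y t S)" for t
  have f_le: "f t \<le> ereal (n / (1 + t) - x)" if "ereal x \<le> free_fisher M \<tau> (perturb Y t S)" for t x
    using ereal_minus_mono[OF order_refl that, of "ereal (n / (1 + t))"] by (simp add: f_def)
  have "ereal_integral f \<le> ereal (n * C - c / 2 * (ln (\<epsilon> + h) - ln \<epsilon>))"
  proof (rule ereal_integral_upper_bound)
    fix t :: real assume t: "0 < t"
    have "ereal (n / (C + t)) \<le> free_fisher M \<tau> (perturb Y t S)"
      unfolding n_def
    proof (rule free_fisher_lower_bound)
      show "(norm2 \<tau> (perturb Y t S i))\<^sup>2 \<le> C + t" for i
        using norm2_perturb[OF Y S] C(2)[of i] t by simp
    qed (use t C in \<open>auto intro!: perturb_in_M Y S\<close>)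
    from f_le[OF this] have "f t \<le> ereal (n / (1 + t) - n / (C + t))" .
    also have "n / (1 + t) - n / (C + t) \<le> n * C / (1 + t)\<^sup>2"
    proof -
      have "n / (1 + t) - n / (C + t) = n * (C - 1) / ((1 + t) * (C + t))"
        using t C(1) by (simp add: field_simps)
      also have "\<dots> \<le> n * C / ((1 + t) * (1 + t))"
        using t C(1) n by (intro frac_le mult_mono mult_pos_pos) auto
      finally show ?thesis by (simp add: power2_eq_square)
    qed
    finally show "f t \<le> ereal (n * C / (1 + t)\<^sup>2)" by simp
  next
    fix t assume t: "0 < t" "t \<le> h"
    have "n * (\<epsilon> + t) \<le> n * (2 * h)" using t c n by (intro mult_left_mono) auto
    also have "\<dots> \<le> c / 2" using c(4) n by (simp add: n_def[symmetric] field_simps)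
    finally have "n \<le> c / 2 / (\<epsilon> + t)" using t c by (simp add: field_simps)
    moreover have "n / (1 + t) \<le> n" using t n by (simp add: field_simps)
    moreover have "c / 2 / (\<epsilon> + t) = c / (\<epsilon> + t) / 2" by simp
    ultimately have "n / (1 + t) - c / (\<epsilon> + t) \<le> - (c / 2 / (\<epsilon> + t))"
      by linarith
    then show "f t \<le> ereal (- (c / 2 / (\<epsilon> + t)))"
      using f_le[OF \<Phi>[OF t S]] by (meson ereal_less_eq(3) order_trans)
  qed (use c C n in auto)
  also have "\<dots> \<le> ereal (n * C - c / 2 * (ln h - ln \<epsilon>))"
    using c by (auto intro!: mult_left_mono)
  finally have "ereal (1 / 2) * ereal_integral f \<le>
      ereal (1 / 2) * ereal (n * C - c / 2 * (ln h - ln \<epsilon>))"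
    by (rule ereal_mult_left_mono) simp
  then have "ereal (1 / 2) * ereal_integral f + ereal (n / 2 * ln (2 * pi * exp 1)) \<le>
      ereal (1 / 2) * ereal (n * C - c / 2 * (ln h - ln \<epsilon>)) + ereal (n / 2 * ln (2 * pi * exp 1))"
    by (rule add_right_mono)
  then show ?thesis
    unfolding free_entropy_def free_entropy_via_def S_def[symmetric] n_def[symmetric] f_def[symmetric]
    by simp
qed

text \<open>Full entropy dimension forces \<open>(\<epsilon> + t) \<Phi>\<^sup>*\<close> to come arbitrarily close to zero: if it were at
  least \<open>\<delta>\<close> for all \<open>\<epsilon>, t < \<delta>\<close>, the entropy would be at most \<open>(\<delta> / 4) ln \<surd>\<epsilon>\<close> for small \<open>\<epsilon>\<close>, and the dimension at most
  \<open>n - \<delta> / 4\<close>.\<close>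

lemma full_dimension_small_fisher:
  fixes X :: "'n::finite \<Rightarrow> 'h cop"
  assumes X: "\<And>i. X i \<in> M" "\<And>i. self_adjoint (X i)"
    and S: "dimension_semicirculars M \<tau> X S"
    and dim: "free_entropy_dim_via M \<tau> X S = ereal (real CARD('n))" and \<delta>: "0 < \<delta>"
  shows "\<exists>\<epsilon> t S' \<xi>. 0 < \<epsilon> \<and> \<epsilon> < \<delta> \<and> 0 < t \<and> t < \<delta> \<and> free_semicirculars M \<tau> (perturb X \<epsilon> S) S' \<and>
    conjugate_system M \<tau> (perturb (perturb X \<epsilon> S) t S') \<xi> \<and>
    (\<epsilon> + t) * (\<Sum>j\<in>UNIV. (l2_norm \<tau> (\<xi> j))\<^sup>2) < \<delta>"
proof (rule ccontr)
  assume contra: "\<not> ?thesis"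
  define n where "n = real CARD('n)"
  have n: "1 \<le> n" by (simp add: n_def Suc_leI)
  have free: "free_semicirculars M \<tau> X S"
    and room: "\<And>\<epsilon>. 0 < \<epsilon> \<Longrightarrow> \<exists>S'. free_semicirculars M \<tau> (perturb X \<epsilon> S) S'"
    using S by (auto simp: dimension_semicirculars_def)
  define h where "h = min (\<delta> / 2) (\<delta> / (4 * n))"
  have h: "0 < h" "h < \<delta>" "h \<le> \<delta> / (4 * n)" using \<delta> n by (auto simp: h_def min_def)
  define C where "C = 1 + h + (\<Sum>i\<in>UNIV. (norm2 \<tau> (X i))\<^sup>2)"
  define K where "K = 1 / 2 * (n * C - \<delta> / 2 * ln h) + n / 2 * ln (2 * pi * exp 1)"
  have \<chi>: "free_entropy M \<tau> (perturb X \<epsilon> S) \<le> ereal (K + \<delta> / 4 * ln \<epsilon>)" if \<epsilon>: "0 < \<epsilon>" "\<epsilon> \<le> h" for \<epsilon>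
  proof -
    have "free_entropy M \<tau> (perturb X \<epsilon> S) \<le> ereal (1 / 2 * (CARD('n) * C - \<delta> / 2 * (ln h - ln \<epsilon>)) +
        CARD('n) / 2 * ln (2 * pi * exp 1))"
    proof (rule free_entropy_upper_bound)
      show "perturb X \<epsilon> S i \<in> M" "self_adjoint (perturb X \<epsilon> S i)" for i
        by (intro perturb_in_M self_adjoint_perturb X free)+
      show "1 \<le> C" unfolding C_def using h(1) by (simp add: sum_nonneg)
      show "(norm2 \<tau> (perturb X \<epsilon> S i))\<^sup>2 \<le> C" for i
        using norm2_perturb[OF X free, of \<epsilon> i] \<epsilon>
          member_le_sum[of i UNIV "\<lambda>i. (norm2 \<tau> (X i))\<^sup>2"]
        by (simp add: C_def)
      show "\<exists>S'. free_semicirculars M \<tau> (perturb X \<epsilon> S) S'" by (rule room[OF \<epsilon>(1)])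
      show "h \<le> \<delta> / (4 * CARD('n))" using h(3) by (simp add: n_def)
      fix t S' assume t: "0 < t" "t \<le> h" and S': "free_semicirculars M \<tau> (perturb X \<epsilon> S) S'"
      show "ereal (\<delta> / (\<epsilon> + t)) \<le> free_fisher M \<tau> (perturb (perturb X \<epsilon> S) t S')"
      proof (cases rule: free_fisher_cases[of "perturb (perturb X \<epsilon> S) t S'"])
        case (2 \<xi>)
        have "\<epsilon> < \<delta>" "t < \<delta>" using \<epsilon> t h by auto
        then have "\<not> (\<epsilon> + t) * (\<Sum>j\<in>UNIV. (l2_norm \<tau> (\<xi> j))\<^sup>2) < \<delta>"
          using contra \<epsilon>(1) t(1) S' 2(1) by blast
        then show ?thesis using \<epsilon>(1) t(1) by (simp add: 2(2) field_simps)
      qed simp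
    qed (use \<delta> \<epsilon> in auto)
    also have "1 / 2 * (CARD('n) * C - \<delta> / 2 * (ln h - ln \<epsilon>)) + CARD('n) / 2 * ln (2 * pi * exp 1) =
        K + \<delta> / 4 * ln \<epsilon>"
      by (simp add: K_def n_def field_simps)
    finally show ?thesis .
  qed
  have "\<forall>\<^sub>F \<epsilon> in at_right 0. ereal (\<delta> / 4) \<le> free_entropy M \<tau> (perturb X \<epsilon> S) / ereal (ln (sqrt \<epsilon>))"
  proof -
    \<comment> \<open>Half of the logarithmic decay absorbs the constant \<open>K\<close>.\<close>
    have "\<forall>\<^sub>F \<epsilon> in at_right (0 :: real). ln \<epsilon> < min (- 8 * K / \<delta>) 0"
      using ln_at_0 unfolding filterlim_at_bot_dense by blast
    moreover have "\<forall>\<^sub>F \<epsilon> in at_right (0 :: real). \<epsilon> \<in> {0<..<h}"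
      using h(1) by (intro eventually_at_right_real)
    ultimately show ?thesis
    proof eventually_elim
      case (elim \<epsilon>)
      have sq: "ln (sqrt \<epsilon>) = ln \<epsilon> / 2" using elim by (simp add: ln_sqrt)
      have "K < - \<delta> / 8 * ln \<epsilon>" using elim(1) \<delta> by (simp add: field_simps)
      then have "K + \<delta> / 4 * ln \<epsilon> \<le> \<delta> / 4 * ln (sqrt \<epsilon>)"
        unfolding sq by (simp add: field_simps)
      then have "free_entropy M \<tau> (perturb X \<epsilon> S) \<le> ereal (\<delta> / 4 * ln (sqrt \<epsilon>))"
        using \<chi>[of \<epsilon>] elim(2) by (auto intro: order_trans)
      then show ?case using elim(1) by (intro ereal_le_divide_neg) (auto simp: sq)
    qed
  qed
  then have "ereal (\<delta> / 4) \<le>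
      Liminf (at_right 0) (\<lambda>\<epsilon>. free_entropy M \<tau> (perturb X \<epsilon> S) / ereal (ln (sqrt \<epsilon>)))"
    by (rule Liminf_bounded)
  with dim \<delta> show False
    unfolding free_entropy_dim_via_def
    by (cases "Liminf (at_right 0) (\<lambda>\<epsilon>. free_entropy M \<tau> (perturb X \<epsilon> S) / ereal (ln (sqrt \<epsilon>)))") auto
qed

text \<open>Here \<open>Y = X + \<surd>\<epsilon> S + \<surd>t S'\<close> is at distance at most \<open>r = 2 \<surd>\<epsilon> + 2 \<surd>t\<close> from \<open>X\<close>.\<close>

lemma full_dimension_no_relation:
  fixes X :: "'n::finite \<Rightarrow> 'h cop"
  assumes X: "\<And>i. X i \<in> M" "\<And>i. self_adjoint (X i)"
    and large: "sufficiently_large M \<tau> X"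
    and dim: "free_entropy_dim M \<tau> X = ereal (real CARD('n))"
    and P: "nc_eval X P = 0"
  shows "P = 0"
proof -
  define S where "S = (SOME S. dimension_semicirculars M \<tau> X S)"
  have S: "dimension_semicirculars M \<tau> X S"
    unfolding S_def using large unfolding sufficiently_large_def by (rule someI_ex)
  then have free: "free_semicirculars M \<tau> X S" by (simp add: dimension_semicirculars_def)
  have dimS: "free_entropy_dim_via M \<tau> X S = ereal (real CARD('n))"
    using dim by (simp add: free_entropy_dim_def S_def)
  have "\<exists>K\<ge>0. mult_bound K (X i)" for i
    using norm2_left_bounded[OF X(1)[of i]] unfolding mult_bound_def by metis
  then obtain K where K: "\<And>i. 0 \<le> K i" "\<And>i. mult_bound (K i) (X i)" by metis
  \<comment> \<open>The slack of 4 accommodates the perturbations, which have \<open>r \<le> 4\<close>.\<close>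
  define L where "L = (\<Sum>i\<in>UNIV. K i) + 4"
  have bX: "mult_bound (L - 4) (X i)" for i
    by (rule mult_bound_mono[OF K(2)]) (auto simp: L_def intro!: member_le_sum K(1))
  have L: "4 \<le> L" by (simp add: L_def sum_nonneg K(1))
  show ?thesis
  proof (rule no_relation[OF X, where L = L])
    show "mult_bound L (X i)" for i by (rule mult_bound_mono[OF bX]) simp
    show "1 \<le> L" using L by simp
    show "nc_eval X P = 0" by (rule P)
    fix e :: real assume e: "0 < e"
    \<comment> \<open>Both \<open>r\<close> and \<open>r \<parallel>\<xi>\<^sub>j\<parallel>\<^sub>2\<close> turn out to be at most \<open>4 s\<close>.\<close>
    define s where "s = min 1 (e / 16)"
    have s: "0 < s" "s \<le> 1" "16 * s \<le> e" using e by (auto simp: s_def)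
    obtain \<epsilon> t S' \<xi> where \<epsilon>: "0 < \<epsilon>" "\<epsilon> < s\<^sup>2" and t: "0 < t" "t < s\<^sup>2"
      and S': "free_semicirculars M \<tau> (perturb X \<epsilon> S) S'"
      and \<xi>: "conjugate_system M \<tau> (perturb (perturb X \<epsilon> S) t S') \<xi>"
      and small: "(\<epsilon> + t) * (\<Sum>j\<in>UNIV. (l2_norm \<tau> (\<xi> j))\<^sup>2) < s\<^sup>2"
      using full_dimension_small_fisher[OF X S dimS, of "s\<^sup>2"] s(1) by auto
    define Y where "Y = perturb (perturb X \<epsilon> S) t S'"
    define r where "r = 2 * sqrt \<epsilon> + 2 * sqrt t"
    have r0: "0 \<le> r" using \<epsilon> t by (simp add: r_def)
    have sqrts: "sqrt \<epsilon> \<le> s" "sqrt t \<le> s"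
      using \<epsilon> t s by (auto intro!: real_le_lsqrt)
    have r: "r \<le> 4 * s" using sqrts by (simp add: r_def)
    have pX: "perturb X \<epsilon> S i \<in> M" "self_adjoint (perturb X \<epsilon> S i)" for i
      by (intro perturb_in_M self_adjoint_perturb X free)+
    have YM: "Y i \<in> M" "self_adjoint (Y i)" for i
      unfolding Y_def by (intro perturb_in_M self_adjoint_perturb pX S')+
    have diff: "mult_bound r (Y i - X i)" for i
    proof -
      have sM: "semicircular M \<tau> (S i)" "semicircular M \<tau> (S' i)"
        using free S' by (auto dest: free_semicircularsD(1))
      have "mult_bound (cmod (complex_of_real (sqrt \<epsilon>)) * 2 + cmod (complex_of_real (sqrt t)) * 2)
          (complex_of_real (sqrt \<epsilon>) *\<^sub>C S i + complex_of_real (sqrt t) *\<^sub>C S' i)"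
        using sM by (intro mult_bound_add mult_bound_scaleC semicircular_mult_bound M_scaleC)
          (auto dest: semicircularD(1))
      moreover have "complex_of_real (sqrt \<epsilon>) *\<^sub>C S i + complex_of_real (sqrt t) *\<^sub>C S' i = Y i - X i"
        by (simp add: Y_def perturb_def)
      ultimately show ?thesis using \<epsilon> t by (simp add: r_def mult.commute)
    qed
    have bY: "mult_bound L (Y i)" for i
    proof -
      have "mult_bound (L - 4 + r) (X i + (Y i - X i))"
        using X YM by (intro mult_bound_add bX diff) auto
      then have "mult_bound (L - 4 + r) (Y i)" by simp
      then show ?thesis by (rule mult_bound_mono) (use r s in auto)
    qed
    have "r * (1 + l2_norm \<tau> (\<xi> j)) < e" for j
    proof -
      define x where "x = l2_norm \<tau> (\<xi> j)"
      have x0: "0 \<le> x" unfolding x_def by (intro l2_norm_nonneg conjugate_system_L2[OF \<xi>])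
      have "x\<^sup>2 \<le> (\<Sum>j\<in>UNIV. (l2_norm \<tau> (\<xi> j))\<^sup>2)"
        unfolding x_def by (rule member_le_sum) auto
      then have "(\<epsilon> + t) * x\<^sup>2 \<le> (\<epsilon> + t) * (\<Sum>j\<in>UNIV. (l2_norm \<tau> (\<xi> j))\<^sup>2)"
        using \<epsilon> t by (intro mult_left_mono) auto
      with small have x: "(\<epsilon> + t) * x\<^sup>2 < s\<^sup>2" by simp
      have "r\<^sup>2 \<le> 8 * (\<epsilon> + t)"
      proof -
        have "0 \<le> (sqrt \<epsilon> - sqrt t)\<^sup>2" by simp
        then show ?thesis using \<epsilon> t by (simp add: r_def power2_sum power2_diff power_mult_distrib)
      qed
      then have "r\<^sup>2 * x\<^sup>2 \<le> 8 * (\<epsilon> + t) * x\<^sup>2" by (intro mult_right_mono) auto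
      also have "\<dots> = 8 * ((\<epsilon> + t) * x\<^sup>2)" by (rule mult.assoc)
      also have "\<dots> \<le> 16 * s\<^sup>2" using x zero_le_power2[of s] by linarith
      finally have "(r * x)\<^sup>2 \<le> (4 * s)\<^sup>2" by (simp add: power_mult_distrib)
      then have "r * x \<le> 4 * s" by (rule power2_le_imp_le) (use s(1) in simp)
      then have "r * (1 + x) \<le> 8 * s" using r by (simp add: distrib_left)
      then show ?thesis using s by (simp add: x_def)
    qed
    then show "\<exists>Y r \<xi>. (\<forall>i. Y i \<in> M \<and> self_adjoint (Y i) \<and> mult_bound L (Y i) \<and>
        mult_bound r (Y i - X i)) \<and> 0 \<le> r \<and> conjugate_system M \<tau> Y \<xi> \<and>
        (\<forall>j. r * (1 + l2_norm \<tau> (\<xi> j)) < e)"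
      using YM bY diff r0 \<xi>
      by (intro exI[of _ Y] exI[of _ r] exI[of _ \<xi>]) (auto simp: Y_def)
  qed
qed

end

section \<open>The derivations\<close>

text \<open>The product of noncommutative polynomials, by concatenation of words.\<close>

definition nc_mult :: "'n ncpoly \<Rightarrow> 'n ncpoly \<Rightarrow> 'n ncpoly" where
  "nc_mult P Q = lin_ext (\<lambda>u. lin_ext (\<lambda>v. basis (u @ v)) Q) P"

lemma lin_ext_scale: "lin_ext (\<lambda>k. c *\<^sub>C f k) p = c *\<^sub>C lin_ext f p"
  unfolding lin_ext_def by (simp add: cvec.scale_sum_right scaleC_scaleC mult.commute)

lemma nc_eval_nc_mult: "nc_eval X (nc_mult P Q) = nc_eval X P * nc_eval X Q"
proof -
  have 1: "clinear (\<lambda>a. a * b)" "clinear (\<lambda>a. b * a)" for b :: "'h::complex_hilbert_space cop"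
    by (rule clinearI; simp add: distrib_left distrib_right)+
  have left: "nc_eval X P * b = lin_ext (\<lambda>u. prod_list (map X u) * b) P" for b
    unfolding nc_eval_def by (rule clinear_of_lin_ext[OF 1(1)])
  have 2: "nc_eval X P * nc_eval X Q = lin_ext (\<lambda>u. prod_list (map X u) * nc_eval X Q) P"
    unfolding left by (rule refl)
  have 3: "prod_list (map X u) * nc_eval X Q = lin_ext (\<lambda>v. prod_list (map X u) * prod_list (map X v)) Q"
    for u unfolding nc_eval_def by (rule clinear_of_lin_ext[OF 1(2)])
  show ?thesis
    unfolding 2 3 nc_mult_def by (simp add: clinear_of_lin_ext[OF clinear_nc_eval])
qed

text \<open>The evaluated free difference quotient \<open>(\<partial>\<^sub>j P)(X)\<close>.\<close>

abbreviation eval_diff :: "('n \<Rightarrow> 'h::complex_hilbert_space cop) \<Rightarrow> 'n \<Rightarrow> 'n ncpoly \<Rightarrow> 'h cop tensor" where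
  "eval_diff X j P \<equiv> nc_eval2 X (free_diff j P)"

lemma clinear_eval_diff: "clinear (eval_diff X j)"
  by (rule clinear_compose[OF clinear_free_diff clinear_nc_eval2])

lemma eval_diff_basis:
  "eval_diff X j (basis w) = (\<Sum>(u, v)\<in>splits j w. prod_list (map X u) \<otimes> prod_list (map X v))"
  by (simp add: nc_eval2_free_diff)

lemma eval_diff_append:
  "eval_diff X j (basis (u @ v)) = right_act (eval_diff X j (basis u)) (prod_list (map X v)) +
    left_act (prod_list (map X u)) (eval_diff X j (basis v))"
  unfolding eval_diff_basis sum_splits_append
  by (simp add: clinear_sum[OF clinear_right_act] clinear_sum[OF clinear_left_act] case_prod_unfold)

lemma eval_diff_nc_mult:
  "eval_diff X j (nc_mult P Q) =
    right_act (eval_diff X j P) (nc_eval X Q) + left_act (nc_eval X P) (eval_diff X j Q)"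
proof -
  have linQ: "clinear (nc_mult P)" for P :: "'n ncpoly"
    unfolding nc_mult_def[abs_def]
    by (rule clinearI) (simp_all add: clinear_add[OF linear_lin_ext] clinear_scale[OF linear_lin_ext]
        lin_ext_plus lin_ext_scale)
  have linP: "clinear (\<lambda>P. nc_mult P Q)"
    unfolding nc_mult_def by (rule linear_lin_ext)
  have rQ: "clinear (\<lambda>Q. right_act s (nc_eval X Q) + left_act a (eval_diff X j Q))" for s a
    by (intro clinear_plus clinear_compose[OF clinear_nc_eval] clinear_compose[OF clinear_eval_diff]
        clinear_left_act clinearI) (simp_all add: right_act_add right_act_scale)
  have rP: "clinear (\<lambda>P. right_act (eval_diff X j P) b + left_act (nc_eval X P) t)" for b t
    by (intro clinear_plus clinear_compose[OF clinear_nc_eval] clinear_compose[OF clinear_eval_diff]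
        clinear_right_act clinearI) (simp_all add: left_act_add left_act_scale)
  have "eval_diff X j (nc_mult (basis u) Q) =
      right_act (eval_diff X j (basis u)) (nc_eval X Q) +
      left_act (nc_eval X (basis u)) (eval_diff X j Q)" for u
    by (rule clinear_eq_on_basis[OF clinear_compose[OF linQ clinear_eval_diff] rQ])
      (simp add: nc_mult_def eval_diff_append)
  then show ?thesis
    by (rule clinear_eq_on_basis[OF clinear_compose[OF linP clinear_eval_diff] rP])
qed

lemma eval_diff_in_tensor_space: "eval_diff X j P \<in> tensor_space (poly_algebra X)"
proof -
  have "prod_list (map X w) \<in> poly_algebra X" for w by (metis nc_eval_basis rangeI)
  then show ?thesis
    unfolding nc_eval2_free_diff lin_ext_def
    by (auto intro!: cvec.subspace_sum[OF subspace_tensor_space]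
        cvec.subspace_scale[OF subspace_tensor_space] tprod_in_tensor_space)
qed

text \<open>A derivation is determined by its values on the generators.\<close>

lemma derivation_on_word:
  assumes D: "derivation_on (poly_algebra X) D"
    and gen: "\<And>i. D (X i) = (if j = i then 1 \<otimes> 1 else 0)"
  shows "D (prod_list (map X w)) = eval_diff X j (basis w)"
proof -
  have in_alg: "prod_list (map X w) \<in> poly_algebra X" for w by (metis nc_eval_basis rangeI)
  have gen_alg: "X i \<in> poly_algebra X" for i using in_alg[of "[i]"] by simp
  have mult: "D (a * b) = right_act (D a) b + left_act a (D b)"
    if "a \<in> poly_algebra X" "b \<in> poly_algebra X" for a b
    using D that unfolding derivation_on_def by blast
  have "D 1 = D 1 + D 1"
    using mult[OF in_alg[of "[]"] in_alg[of "[]"]] by (simp add: right_act_one left_act_one)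
  then have D1: "D 1 = 0" by simp
  show ?thesis
  proof (induction w)
    case Nil
    then show ?case by (simp add: D1 eval_diff_basis)
  next
    case (Cons i w)
    have "eval_diff X j (basis [i]) = D (X i)"
      unfolding eval_diff_basis by (simp add: sum_splits_Cons gen)
    then have "eval_diff X j (basis (i # w)) = D (X i * prod_list (map X w))"
      using eval_diff_append[of X j "[i]" w] Cons mult[OF gen_alg in_alg] by simp
    then show ?case by simp
  qed
qed

lemma derivation_on_unique:
  assumes D: "derivation_on (poly_algebra X) D"
    and gen: "\<And>i. D (X i) = (if j = i then 1 \<otimes> 1 else 0)"
  shows "D (nc_eval X P) = eval_diff X j P"
proof -
  have "D (nc_eval X (P + Q)) = D (nc_eval X P) + D (nc_eval X Q)" for P Q
    using D unfolding derivation_on_def by (simp add: clinear_add[OF clinear_nc_eval])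
  moreover have "D (nc_eval X (c *\<^sub>C P)) = c *\<^sub>C D (nc_eval X P)" for c P
    using D unfolding derivation_on_def by (simp add: clinear_scale[OF clinear_nc_eval])
  ultimately have "clinear (\<lambda>P. D (nc_eval X P))" by (rule clinearI)
  then show ?thesis
    by (rule clinear_eq_on_basis[OF _ clinear_eval_diff]) (simp add: derivation_on_word[OF D gen])
qed

text \<open>Without relations, \<open>P(X) \<mapsto> (\<partial>\<^sub>j P)(X)\<close> is well defined.\<close>

lemma ex1_derivation:
  assumes no_rel: "\<And>P. nc_eval X P = 0 \<Longrightarrow> P = 0"
  shows "\<exists>!D. D \<in> poly_algebra X \<rightarrow>\<^sub>E tensor_space (poly_algebra X) \<and>
    derivation_on (poly_algebra X) D \<and> (\<forall>i. D (X i) = (if j = i then 1 \<otimes> 1 else 0))"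
proof (rule ex1I)
  have inj: "inj (nc_eval X)"
  proof (rule injI)
    fix P Q assume "nc_eval X P = nc_eval X Q"
    then have "nc_eval X (P + (- 1) *\<^sub>C Q) = 0"
      by (simp add: clinear_add[OF clinear_nc_eval] clinear_scale[OF clinear_nc_eval] scaleC_one
          del: cvec.scale_minus_left) (simp add: scaleC_one)
    then show "P = Q" using no_rel[of "P + (- 1) *\<^sub>C Q"] by (simp add: scaleC_one)
  qed
  define D where "D = restrict (\<lambda>a. eval_diff X j (inv (nc_eval X) a)) (poly_algebra X)"
  have D_eval: "D (nc_eval X P) = eval_diff X j P" for P
    by (simp add: D_def inv_f_f[OF inj])
  have "derivation_on (poly_algebra X) D"
    unfolding derivation_on_def
    by (auto simp: D_eval clinear_add[OF clinear_eval_diff] clinear_scale[OF clinear_eval_diff]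
        eval_diff_nc_mult
        simp flip: clinear_add[OF clinear_nc_eval] clinear_scale[OF clinear_nc_eval] nc_eval_nc_mult)
  moreover have "D (X i) = (if j = i then 1 \<otimes> 1 else 0)" for i
    using D_eval[of "basis [i]"] unfolding eval_diff_basis by (simp add: sum_splits_Cons)
  moreover have "D \<in> poly_algebra X \<rightarrow>\<^sub>E tensor_space (poly_algebra X)"
    unfolding D_def by (auto intro: eval_diff_in_tensor_space)
  ultimately show "D \<in> poly_algebra X \<rightarrow>\<^sub>E tensor_space (poly_algebra X) \<and>
    derivation_on (poly_algebra X) D \<and> (\<forall>i. D (X i) = (if j = i then 1 \<otimes> 1 else 0))" by blast
  fix E assume E: "E \<in> poly_algebra X \<rightarrow>\<^sub>E tensor_space (poly_algebra X) \<and>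
    derivation_on (poly_algebra X) E \<and> (\<forall>i. E (X i) = (if j = i then 1 \<otimes> 1 else 0))"
  show "E = D"
  proof (rule PiE_ext)
    show "E \<in> poly_algebra X \<rightarrow>\<^sub>E tensor_space (poly_algebra X)" using E by blast
    show "D \<in> poly_algebra X \<rightarrow>\<^sub>E tensor_space (poly_algebra X)" by fact
    fix a assume "a \<in> poly_algebra X"
    then obtain P where "a = nc_eval X P" by blast
    then show "E a = D a" using derivation_on_unique[of X E j P] E D_eval by simp
  qed
qed

section \<open>Transfer along an enlargement\<close>

lemma enlargement_nc_eval:
  assumes "tracial_wstar_space M \<tau>" "enlargement M \<tau> N \<sigma> \<iota>" and X: "\<And>i. X i \<in> M"
  shows "\<iota> (nc_eval X P) = nc_eval (\<iota> \<circ> X) P"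
proof -
  interpret tracial M \<tau> by unfold_locales fact
  have add: "\<And>a b. a \<in> M \<Longrightarrow> b \<in> M \<Longrightarrow> \<iota> (a + b) = \<iota> a + \<iota> b"
    and mult: "\<And>a b. a \<in> M \<Longrightarrow> b \<in> M \<Longrightarrow> \<iota> (a * b) = \<iota> a * \<iota> b"
    and scale: "\<And>c a. a \<in> M \<Longrightarrow> \<iota> (c *\<^sub>C a) = c *\<^sub>C \<iota> a" and one: "\<iota> 1 = 1"
    using assms(2) by (simp_all add: enlargement_def)
  have zero: "\<iota> 0 = 0" using scale[of 0 0] by simp
  have word: "\<iota> (prod_list (map X w)) = prod_list (map (\<iota> \<circ> X) w)" for w
    by (induction w) (simp_all add: one mult X M_prod_list)
  have sum: "\<iota> (sum f I) = (\<Sum>i\<in>I. \<iota> (f i))" if "\<And>i. f i \<in> M" for f :: "'c list \<Rightarrow> 'a cop" and I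
    using that by (induction I rule: infinite_finite_induct) (simp_all add: zero add M_sum)
  show ?thesis
    unfolding nc_eval_def lin_ext_def
    by (simp add: sum M_prod_list X scale word)
qed

theorem corollary3p16:
  fixes M :: "'h::complex_hilbert_space cop set" and \<tau> :: "'h cop \<Rightarrow> complex"
    and X :: "'n::finite \<Rightarrow> 'h cop"
    and N :: "'k::complex_hilbert_space cop set" and \<sigma> :: "'k cop \<Rightarrow> complex"
    and \<iota> :: "'h cop \<Rightarrow> 'k cop"
  assumes "tracial_wstar_space M \<tau>"
    and "\<And>i. X i \<in> M" and "\<And>i. self_adjoint (X i)"
    and "enlargement M \<tau> N \<sigma> \<iota>" and "sufficiently_large N \<sigma> (\<iota> \<circ> X)"
    and "free_entropy_dim N \<sigma> (\<iota> \<circ> X) = ereal (real CARD('n))"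
  shows "(\<nexists>P :: 'n ncpoly. P \<noteq> 0 \<and> nc_eval X P = 0) \<and>
    (\<forall>j. \<exists>!D. D \<in> poly_algebra X \<rightarrow>\<^sub>E tensor_space (poly_algebra X) \<and>
       derivation_on (poly_algebra X) D \<and>
       (\<forall>i. D (X i) = (if j = i then 1 \<otimes> 1 else 0)))"
proof -
  have N: "tracial_wstar_space N \<sigma>" "\<And>a. a \<in> M \<Longrightarrow> \<iota> a \<in> N" "\<And>a. a \<in> M \<Longrightarrow> \<iota> (adj a) = adj (\<iota> a)"
    using assms(4) by (auto simp: enlargement_def)
  interpret N: tracial N \<sigma> by unfold_locales fact
  have no_rel: "P = 0" if P: "nc_eval X P = 0" for P :: "'n ncpoly"
  proof (rule N.full_dimension_no_relation[where X = "\<iota> \<circ> X"])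
    show "(\<iota> \<circ> X) i \<in> N" "self_adjoint ((\<iota> \<circ> X) i)" for i
      using N(2)[OF assms(2)[of i]] N(3)[OF assms(2)[of i]] assms(3)[of i]
      by (simp_all add: self_adjoint_def)
    have "nc_eval (\<iota> \<circ> X) P = \<iota> (nc_eval X P)"
      by (rule enlargement_nc_eval[OF assms(1,4,2), symmetric])
    also have "\<dots> = nc_eval (\<iota> \<circ> X) 0"
      using P enlargement_nc_eval[OF assms(1,4,2), where P = 0] by (simp add: clinear_zero[OF clinear_nc_eval])
    finally show "nc_eval (\<iota> \<circ> X) P = 0" by (simp add: clinear_zero[OF clinear_nc_eval])
  qed fact+
  then show ?thesis by (intro conjI allI ex1_derivation) blast+
qed

end
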